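(* Let $s>1$ and let $n\ge1$ be an integer. For every $u_0\in H^s_+$, there exists a unique solution $u\in C(\mathbb R,H^s_+)$ of the Cauchy problem $$\partial_tu=X_{J_{2n}}(u),\qquad u(0)=u_0.$$ Moreover, $u$ satisfies $$\partial_tH_u=[B_{u,n},H_u],$$ with $$B_{u,n}(h)=\frac{-i}{4}\left(\sum_{j=0}^{2n-2}H_u^j(1)\,\Pi\big(\overline{H_u^{2n-2-j}(1)}\,h\big)-\sum_{k=1}^{n-1}(h|H_u^{2k-1}(1))\,H_u^{2n-2k-1}(1)\right).$$ Finally, for all integers $n,p\ge1$, one has the commutation identity $$\{J_{2n},J_{2p}\}=0.$$
   Context: $\mathbb S^1$ is the unit circle, $(u|v)=\int_{\mathbb S^1}u\overline v\,\frac{d\theta}{2\pi}$; $E_+$ denotes the elements $u$ of a space $E$ of distributions on $\mathbb S^1$ with $\hat u(k)=0$ for $k<0$; $H^s_+=(H^s(\mathbb S^1))_+$ with $H^s$ the Sobolev space; $\Pi:L^2(\mathbb S^1)\to L^2_+$ is the orthogonal projector. For $u\in H^{1/2}_+$, $H_u(h)=\Pi(u\overline h)$ is the $\mathbb C$-antilinear Hankel operator on $L^2_+$ and $J_{2n}(u)=(H_u^{2n}(1)|1)$. $[B,H]=BH-HB$. $L^2_+$ carries the symplectic form $\omega(u,v)=4\,\mathrm{Im}(u|v)$. For a real function $F$ on a dense subspace $\mathcal D$ of $L^2_+$, its Hamiltonian vector field $X_F:\mathcal D\to L^2_+$ (if it exists) is defined by $\lim_{t\to0}\frac{F(u+th)-F(u)}{t}=\omega(h,X_F(u))$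 for all $u,h\in\mathcal D$; the Poisson bracket is $\{F,G\}(u)=\omega(X_F(u),X_G(u))$. On $\mathcal D=H^s_+$ the Hamiltonian vector field of $J_{2n}$ is $X_{J_{2n}}(u)=\frac1{2i}\sum_{j=0}^{n-1}H_u^{2j}(1)H_u^{2n-2j-1}(1)$ (pointwise products of functions). *)

theory Defs
  imports "HOL-Analysis.Analysis"
begin

section \<open>Functions on the unit circle\<close>

text \<open>The unit circle with the normalised arc length \<open>d\<theta>/2\<pi>\<close>.\<close>

definition circle :: "complex measure" where
  "circle = distr (uniform_measure lborel {0..<2*pi}) (restrict_space borel (sphere 0 1)) cis"

lemma space_circle [simp]: "space circle = sphere 0 1"
  by (simp add: circle_def space_restrict_space)

lemma emeasure_circle_space: "emeasure circle (space circle) = 1"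
proof -
  have cis: "cis \<in> measurable (uniform_measure lborel {0..<2*pi}) (restrict_space borel (sphere 0 1))"
  proof (rule measurable_restrict_space2)
    have "cis \<in> borel_measurable borel"
      by (intro borel_measurable_continuous_onI continuous_intros)
    then show "cis \<in> borel_measurable (uniform_measure lborel {0..<2*pi})"
      by (simp cong: measurable_cong_sets)
  qed auto
  have "sphere 0 1 \<in> sets (restrict_space borel (sphere (0::complex) 1))"
    by (auto simp: sets_restrict_space_iff)
  with cis have "emeasure circle (space circle) = emeasure (uniform_measure lborel {0..<2*pi}) UNIV"
    by (simp add: circle_def emeasure_distr space_restrict_space vimage_def del: mem_sphere)
  also have "\<dots> = 1"
    by (simp add: emeasure_uniform_measure ennreal_divide_self)
  finally show ?thesis .
qed

text \<open>
  Complex measurable functions on the circle, modulo equality almost everywhere. Pointwise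
  products, sums and conjugates are total on this type; square integrability and Sobolev
  regularity are expressed by subsets of it.
\<close>

quotient_type circfun = "complex \<Rightarrow> complex" / partial:
  "\<lambda>f g. f \<in> borel_measurable circle \<and> g \<in> borel_measurable circle \<and> (AE z in circle. f z = g z)"
proof (rule part_equivpI)
  show "\<exists>f::complex \<Rightarrow> complex. f \<in> borel_measurable circle \<and> f \<in> borel_measurable circle \<and>
      (AE z in circle. f z = f z)"
    by (rule exI[of _ "\<lambda>_. 0"]) simp
  show "symp (\<lambda>f g::complex \<Rightarrow> complex. f \<in> borel_measurable circle \<and>
      g \<in> borel_measurable circle \<and> (AE z in circle. f z = g z))"
    by (rule sympI) (auto elim: AE_mp)
  show "transp (\<lambda>f g::complex \<Rightarrow> complex. f \<in> borel_measurable circle \<and>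
      g \<in> borel_measurable circle \<and> (AE z in circle. f z = g z))"
    by (rule transpI) auto
qed

instantiation circfun :: comm_ring_1
begin

lift_definition zero_circfun :: circfun is "\<lambda>_. 0" by simp
lift_definition one_circfun :: circfun is "\<lambda>_. 1" by simp
lift_definition plus_circfun :: "circfun \<Rightarrow> circfun \<Rightarrow> circfun" is "\<lambda>f g z. f z + g z" by auto
lift_definition minus_circfun :: "circfun \<Rightarrow> circfun \<Rightarrow> circfun" is "\<lambda>f g z. f z - g z" by auto
lift_definition uminus_circfun :: "circfun \<Rightarrow> circfun" is "\<lambda>f z. - f z" by auto
lift_definition times_circfun :: "circfun \<Rightarrow> circfun \<Rightarrow> circfun" is "\<lambda>f g z. f z * g z" by auto

instance
proof
  have "\<not> (AE z in circle. False)"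
    using emeasure_circle_space by (subst AE_iff_measurable[OF sets.top]) auto
  then show "(0::circfun) \<noteq> 1"
    by transfer simp
qed (transfer; auto simp: algebra_simps)+

end

lift_definition const :: "complex \<Rightarrow> circfun" is "\<lambda>c _. c" by simp

lift_definition circ_conj :: "circfun \<Rightarrow> circfun" is "\<lambda>f z. cnj (f z)"
  by (auto intro: borel_measurable_continuous_on[where f = cnj] continuous_intros)

lift_definition monomial :: "int \<Rightarrow> circfun" is "\<lambda>k z. z powi k"
  by (auto simp: power_int_def circle_def intro!: measurable_restrict_space1)

lift_definition circle_integral :: "circfun \<Rightarrow> complex" is "\<lambda>f. integral\<^sup>L circle f"
  by (auto intro: integral_cong_AE)

section \<open>The spaces \<open>L\<^sup>2\<close> and \<open>H\<^sup>s\<close>\<close>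

lift_definition square_integrable :: "circfun \<Rightarrow> bool"
  is "\<lambda>f. integrable circle (\<lambda>z. (cmod (f z))\<^sup>2)"
  by (intro integrable_cong_AE) auto

definition L2 :: "circfun set" where
  "L2 = {u. square_integrable u}"

definition inner_L2 :: "circfun \<Rightarrow> circfun \<Rightarrow> complex" where
  "inner_L2 u v = circle_integral (u * circ_conj v)"

definition norm_L2 :: "circfun \<Rightarrow> real" where
  "norm_L2 u = sqrt (Re (inner_L2 u u))"

definition fourier :: "circfun \<Rightarrow> int \<Rightarrow> complex" where
  "fourier u k = inner_L2 u (monomial k)"

text \<open>For \<open>s \<ge> 0\<close> this is the Sobolev space, all of whose elements are square integrable functions.\<close>

definition Hs :: "real \<Rightarrow> circfun set" where
  "Hs s = {u \<in> L2. (\<lambda>k. (1 + (real_of_int k)\<^sup>2) powr s * (cmod (fourier u k))\<^sup>2) summable_on UNIV}"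

definition norm_Hs :: "real \<Rightarrow> circfun \<Rightarrow> real" where
  "norm_Hs s u = sqrt (\<Sum>\<^sub>\<infinity>k. (1 + (real_of_int k)\<^sup>2) powr s * (cmod (fourier u k))\<^sup>2)"

definition plus_part :: "circfun set \<Rightarrow> circfun set" where
  "plus_part E = {u \<in> E. \<forall>k<0. fourier u k = 0}"

abbreviation L2_plus :: "circfun set" where "L2_plus \<equiv> plus_part L2"

abbreviation Hs_plus :: "real \<Rightarrow> circfun set" where "Hs_plus s \<equiv> plus_part (Hs s)"

text \<open>Convergence in the normed space \<open>H\<^sup>s\<^sub>+\<close>.\<close>

definition tendsto_Hs :: "real \<Rightarrow> ('a \<Rightarrow> circfun) \<Rightarrow> circfun \<Rightarrow> 'a filter \<Rightarrow> bool" where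
  "tendsto_Hs s f l F \<longleftrightarrow>
     l \<in> Hs_plus s \<and> (\<forall>\<^sub>F x in F. f x \<in> Hs_plus s) \<and> ((\<lambda>x. norm_Hs s (f x - l)) \<longlongrightarrow> 0) F"

section \<open>Hankel operators\<close>

text \<open>The orthogonal projector of \<open>L\<^sup>2\<close> onto \<open>L\<^sup>2\<^sub>+\<close>.\<close>

definition szego :: "circfun \<Rightarrow> circfun" where
  "szego f = (THE g. g \<in> L2_plus \<and> (\<forall>h\<in>L2_plus. inner_L2 (f - g) h = 0))"

text \<open>
  For \<open>h \<in> L\<^sup>2\<^sub>+\<close> the product lies in \<open>L\<^sup>2\<close> whenever \<open>u\<close> is bounded, in particular
  for \<open>u \<in> H\<^sup>s\<close> with \<open>s > 1/2\<close>.
\<close>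

definition hankel :: "circfun \<Rightarrow> circfun \<Rightarrow> circfun" where
  "hankel u h = szego (u * circ_conj h)"

text \<open>
  For even \<open>m\<close> the inner product is real (\<open>(H\<^sub>u(a)|b) = (H\<^sub>u(b)|a)\<close>, so \<open>H\<^sub>u\<^sup>2\<close> is self-adjoint);
  the real part only turns \<open>J\<^sub>m\<close> into a real-valued function.
\<close>

definition J :: "nat \<Rightarrow> circfun \<Rightarrow> real" where
  "J m u = Re (inner_L2 ((hankel u ^^ m) 1) 1)"

section \<open>Hamiltonian formalism on \<open>L\<^sup>2\<^sub>+\<close>\<close>

definition symp_form :: "circfun \<Rightarrow> circfun \<Rightarrow> real" where
  "symp_form u v = 4 * Im (inner_L2 u v)"

definition is_hamiltonian_vector_at ::
    "circfun set \<Rightarrow> (circfun \<Rightarrow> real) \<Rightarrow> circfun \<Rightarrow> circfun \<Rightarrow> bool" where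
  "is_hamiltonian_vector_at D F u v \<longleftrightarrow> v \<in> L2_plus \<and>
     (\<forall>h\<in>D. ((\<lambda>t::real. (F (u + const t * h) - F u) / t) \<longlongrightarrow> symp_form h v) (at 0))"

definition hamiltonian_vf :: "circfun set \<Rightarrow> (circfun \<Rightarrow> real) \<Rightarrow> circfun \<Rightarrow> circfun" where
  "hamiltonian_vf D F u = (THE v. is_hamiltonian_vector_at D F u v)"

definition poisson :: "circfun set \<Rightarrow> (circfun \<Rightarrow> real) \<Rightarrow> (circfun \<Rightarrow> real) \<Rightarrow> circfun \<Rightarrow> real" where
  "poisson D F G u = symp_form (hamiltonian_vf D F u) (hamiltonian_vf D G u)"

text \<open>
  A solution in \<open>C(\<real>, H\<^sup>s\<^sub>+)\<close> of \<open>\<partial>\<^sub>tu = X(u)\<close>, \<open>u(0) = u\<^sub>0\<close>, the time derivative being taken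
  in \<open>H\<^sup>s\<^sub>+\<close>.
\<close>

definition Hs_solution ::
    "real \<Rightarrow> (circfun \<Rightarrow> circfun) \<Rightarrow> circfun \<Rightarrow> (real \<Rightarrow> circfun) \<Rightarrow> bool" where
  "Hs_solution s X u0 u \<longleftrightarrow>
     (\<forall>t. u t \<in> Hs_plus s) \<and>
     (\<forall>t. tendsto_Hs s u (u t) (at t)) \<and>
     (\<forall>t. tendsto_Hs s (\<lambda>r. const (1 / of_real r) * (u (t + r) - u t)) (X (u t)) (at 0)) \<and>
     u 0 = u0"

section \<open>Lax pairs\<close>

definition opnorm_L2_plus :: "(circfun \<Rightarrow> circfun) \<Rightarrow> ennreal" where
  "opnorm_L2_plus A = (SUP h\<in>{h \<in> L2_plus. norm_L2 h \<le> 1}. ennreal (norm_L2 (A h)))"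

text \<open>The derivative of a curve of operators on \<open>L\<^sup>2\<^sub>+\<close>, with respect to the operator norm.\<close>

definition has_operator_derivative ::
    "(real \<Rightarrow> circfun \<Rightarrow> circfun) \<Rightarrow> (circfun \<Rightarrow> circfun) \<Rightarrow> real \<Rightarrow> bool" where
  "has_operator_derivative A A' t \<longleftrightarrow>
     ((\<lambda>r. opnorm_L2_plus (\<lambda>h. const (1 / of_real r) * (A (t + r) h - A t h) - A' h)) \<longlongrightarrow> 0) (at 0)"

definition commutator ::
    "(circfun \<Rightarrow> circfun) \<Rightarrow> (circfun \<Rightarrow> circfun) \<Rightarrow> circfun \<Rightarrow> circfun" where
  "commutator B H h = B (H h) - H (B h)"

definition lax_B :: "circfun \<Rightarrow> nat \<Rightarrow> circfun \<Rightarrow> circfun" where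
  "lax_B u n h = const (- \<i> / 4) *
     ((\<Sum>j=0..2*n-2. (hankel u ^^ j) 1 * szego (circ_conj ((hankel u ^^ (2*n-2-j)) 1) * h))
      - (\<Sum>k=1..n-1. const (inner_L2 h ((hankel u ^^ (2*k-1)) 1)) * (hankel u ^^ (2*n-2*k-1)) 1))"

end

theory Submission
  imports Defs
begin

text \<open>Write \<open>a\<^sub>j = H\<^sub>u\<^sup>j(1)\<close>. The Hamiltonian field is a sum of products \<open>a\<^sub>2\<^sub>l a\<^sub>2\<^sub>n\<^sub>-\<^sub>2\<^sub>l\<^sub>-\<^sub>1\<close>, and the identity
  \<open>H\<^bsub>a H\<^sub>u(b)\<^esub>(h) = a \<Pi>(b\<^sup>* H\<^sub>u h) + H\<^sub>a(\<Pi>(H\<^sub>u(b)\<^sup>* h)) - (H\<^sub>u b|h) a\<close>, used with the two factors in either order, yields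
  the Lax equation \<open>H\<^sub>X = [B, H\<^sub>u]\<close> with \<open>B\<close> skew-adjoint. Since \<open>B(1)\<close> is \<open>-i/4\<close> times a real combination of
  the \<open>a\<^sub>2\<^sub>l\<close>, the derivative of \<open>J\<^sub>2\<^sub>p\<close> along the field of \<open>J\<^sub>2\<^sub>n\<close> vanishes, which is the commutation of the \<open>J\<^sub>2\<^sub>n\<close>.

  Along the flow \<open>H\<^sub>u\<close> stays unitarily equivalent to its initial value, so its trace norm is conserved; it is
  finite for \<open>s > 1\<close> and bounds \<open>\<Sum> |u\<^sub>2\<^sub>k| + |u\<^sub>2\<^sub>k\<^sub>+\<^sub>1|\<close>, the sums of the matrix coefficients \<open>(H\<^sub>u e\<^sub>k|e\<^sub>k)\<close> and
  \<open>(H\<^sub>u e\<^sub>k\<^sub>+\<^sub>1|e\<^sub>k)\<close>. The field is bounded by a power of this Wiener norm times the Sobolev norm, hence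
  Gronwall's lemma excludes blow-up.\<close>

text \<open>Since \<open>Hs_plus s\<close> is only a subset of \<open>circfun\<close>, the dynamics
  is moved into one Banach type \<open>ell2\<close> of square summable sequences. The same function
  appears there in two encodings, weighted (the phase space of the equation) and unweighted (the
  space on which Hankel operators act); Riesz-Fischer and Parseval bring the results back to the
  circle.

  No unitary propagator is built. The standard basis, prescribed at a time \<open>\<tau>\<close>, is
  transported to time 0 by the skew-adjoint field, and Bessel's inequality at time 0 does the work
  of the invariance of the trace norm. The condition s > 1 makes the inverse weights
  \<open>(1 + k\<^sup>2) powr (-s/2)\<close> summable, which yields both the embedding into the
  Wiener algebra and the finiteness of the trace norm.

  Maximal intervals of existence are avoided: Picard iteration is run only for globally Lipschitz
  fields, so the Hamiltonian field is first multiplied by a scalar cutoff. A real scalar factor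
  keeps the Lax structure, hence the a priori bound is available before the cutoff is known to be
  inactive.\<close>

no_notation Infinite_Set_Sum.abs_summable_on (infix "abs'_summable'_on" 50)

section \<open>Fourier analysis on the circle\<close>

interpretation circle: finite_measure circle
  by (rule finite_measureI) (simp add: emeasure_circle_space[unfolded space_circle])

lemma measure_circle_space [simp]: "measure circle (sphere 0 1) = 1"
  using emeasure_circle_space by (simp add: measure_def)

lemma sets_circle: "sets circle = sets (restrict_space borel (sphere 0 1))"
  by (simp add: circle_def)

lemma borel_measurable_circle_restrict:
  "f \<in> borel_measurable borel \<Longrightarrow> f \<in> borel_measurable circle"
  by (auto simp: circle_def intro!: measurable_restrict_space1)

lemma borel_measurable_powi [measurable]: "(\<lambda>z::complex. z powi k) \<in> borel_measurable circle"
  by (rule borel_measurable_circle_restrict) (auto simp: power_int_def)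

lemma norm_powi_circle: "z \<in> sphere 0 1 \<Longrightarrow> cmod (z powi k) = 1"
  by (simp add: norm_power_int)

lemma cis_measurable: "cis \<in> measurable lborel (restrict_space borel (sphere 0 1))"
  by (rule measurable_restrict_space2) (auto intro!: borel_measurable_continuous_onI continuous_intros)

lemma integral_circle_eq:
  fixes f :: "complex \<Rightarrow> complex"
  assumes "f \<in> borel_measurable circle"
  shows "integral\<^sup>L circle f = (1 / (2*pi)) *\<^sub>R integral\<^sup>L lborel (\<lambda>x. indicator {0..<2*pi} x *\<^sub>R f (cis x))"
proof -
  have f: "f \<in> borel_measurable (restrict_space borel (sphere 0 1))"
    using assms by (simp cong: measurable_cong_sets add: sets_circle)
  have c: "cis \<in> measurable (uniform_measure lborel {0..<2*pi}) (restrict_space borel (sphere 0 1))"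
    using cis_measurable by (simp cong: measurable_cong_sets)
  have fc: "(\<lambda>x. f (cis x)) \<in> borel_measurable lborel"
    using measurable_compose[OF cis_measurable f] .
  have eq: "indicator {0..<2*pi} x / emeasure lborel {0..<2*pi} = ennreal (indicator {0..<2*pi} x / (2*pi))" for x
    by (auto simp: indicator_def divide_ennreal[symmetric] ennreal_1[symmetric] simp del: ennreal_1)
  have "integral\<^sup>L circle f = integral\<^sup>L (uniform_measure lborel {0..<2*pi}) (\<lambda>x. f (cis x))"
    unfolding circle_def by (rule integral_distr[OF c f])
  also have "\<dots> = integral\<^sup>L lborel (\<lambda>x. (indicator {0..<2*pi} x / (2*pi)) *\<^sub>R f (cis x))"
    unfolding uniform_measure_def eq
    by (subst integral_density[OF fc]) auto
  also have "\<dots> = integral\<^sup>L lborel (\<lambda>x. of_real (1/(2*pi)) * (indicator {0..<2*pi} x *\<^sub>R f (cis x)))"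
    by (intro Bochner_Integration.integral_cong) (auto simp: scaleR_conv_of_real)
  finally show ?thesis by (simp only: integral_mult_right_zero scaleR_conv_of_real)
qed

lemma integral_circle_powi: "integral\<^sup>L circle (\<lambda>z. z powi k) = (if k = 0 then 1 else 0)"
proof (cases "k = 0")
  case True
  then show ?thesis by simp
next
  case False
  \<comment> \<open>The circle is parametrised by a half-open interval, while the fundamental
    theorem of calculus uses a closed one; the endpoint is a null set.\<close>
  have ae: "AE x in lborel. x \<noteq> (2*pi::real)" by (rule AE_lborel_singleton)
  have "integral\<^sup>L lborel (\<lambda>x. indicator {0..<2*pi} x *\<^sub>R (cis x powi k))
      = integral\<^sup>L lborel (\<lambda>x. indicator {0..2*pi} x *\<^sub>R cis (of_int k * x))"
  proof (intro integral_cong_AE)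
    show "(\<lambda>x. indicator {0..<2*pi} x *\<^sub>R (cis x powi k)) \<in> borel_measurable lborel"
      unfolding cis_power_int by (intro borel_measurable_scaleR borel_measurable_indicator)
        (auto intro!: borel_measurable_continuous_onI continuous_intros)
    show "(\<lambda>x. indicator {0..2*pi} x *\<^sub>R cis (of_int k * x)) \<in> borel_measurable lborel"
      by (intro borel_measurable_scaleR borel_measurable_indicator)
        (auto intro!: borel_measurable_continuous_onI continuous_intros)
  qed (use ae in \<open>auto simp: cis_power_int indicator_def elim!: AE_mp\<close>)
  also have "\<dots> = cis (of_int k * (2*pi)) / (\<i> * of_int k) - cis (of_int k * 0) / (\<i> * of_int k)"
  proof (rule integral_FTC_atLeastAtMost)
    fix x :: real
    show "((\<lambda>x. cis (of_int k * x) / (\<i> * of_int k)) has_vector_derivative cis (of_int k * x)) (at x within {0..2*pi})"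
    proof -
      have "((\<lambda>z. exp (\<i> * of_int k * z) / (\<i> * of_int k)) has_field_derivative exp (\<i> * of_int k * of_real x))
          (at (of_real x))"
        by (auto intro!: derivative_eq_intros simp: False)
      from has_vector_derivative_real_field[OF this] show ?thesis
        by (simp add: cis_conv_exp mult_ac has_vector_derivative_at_within)
    qed
  qed (auto intro!: continuous_intros)
  also have "\<dots> = 0"
    by (simp add: cis_conv_exp exp_eq_1)
  finally show ?thesis
    using False by (simp add: integral_circle_eq)
qed

section \<open>Uniqueness of Fourier coefficients for integrable functions\<close>

lemma integrable_circle_bounded:
  assumes "f \<in> borel_measurable circle" "\<And>z. z \<in> sphere 0 1 \<Longrightarrow> cmod (f z) \<le> B"
  shows "integrable circle f"
  by (rule circle.integrable_const_bound[of _ B]) (use assms in auto)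

lemma integrable_circle_mult_bounded:
  fixes f g :: "complex \<Rightarrow> complex"
  assumes f: "integrable circle f" and g: "g \<in> borel_measurable circle"
    "\<And>z. z \<in> sphere 0 1 \<Longrightarrow> cmod (g z) \<le> B"
  shows "integrable circle (\<lambda>z. f z * g z)"
proof (rule Bochner_Integration.integrable_bound)
  show "integrable circle (\<lambda>z. B * cmod (f z))" using f by auto
  show "(\<lambda>z. f z * g z) \<in> borel_measurable circle" using f g by auto
  show "AE z in circle. cmod (f z * g z) \<le> norm (B * cmod (f z))"
  proof (rule AE_I2)
    fix z assume "z \<in> space circle"
    then have "cmod (g z) \<le> \<bar>B\<bar>" using g(2)[of z] by auto
    from mult_left_mono[OF this norm_ge_zero[of "f z"]] show "cmod (f z * g z) \<le> norm (B * cmod (f z))"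
      by (simp add: norm_mult abs_mult mult.commute)
  qed
qed

text \<open>On the circle \<open>Re z = (z + z\<inverse>)/2\<close> and \<open>Im z = (z - z\<inverse>)/(2i)\<close>, so polynomials in the
  coordinates are trigonometric polynomials.\<close>

lemma real_polynomial_function_trig:
  fixes p :: "complex \<Rightarrow> real"
  assumes "real_polynomial_function p"
  shows "\<exists>K c. finite K \<and> (\<forall>z\<in>sphere 0 1. of_real (p z) = (\<Sum>k\<in>K. c k * z powi k))"
  using assms
proof (induction rule: real_polynomial_function.induct)
  case (linear f)
  interpret bounded_linear f by fact
  \<comment> \<open>By real linearity \<open>f z = Re z * f 1 + Im z * f \<i>\<close>; inserting the
    formulas for the coordinates gives these two coefficients.\<close>
  define c where "c = (\<lambda>k::int. if k = 1 then (of_real (f 1) - \<i> * of_real (f \<i>)) / 2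
     else (of_real (f 1) + \<i> * of_real (f \<i>)) / 2)"
  have "of_real (f z) = (\<Sum>k\<in>{1,-1}. c k * z powi k)" if "z \<in> sphere 0 1" for z
  proof -
    have "f z = f (Re z *\<^sub>R 1 + Im z *\<^sub>R \<i>)" 
      using complex_eq[of z] by (simp add: scaleR_conv_of_real mult.commute)
    also have "\<dots> = Re z * f 1 + Im z * f \<i>" by (simp only: add scaleR real_scaleR_def)
    finally have fz: "f z = Re z * f 1 + Im z * f \<i>" .
    have "inverse z = cnj z" using that
      by (metis inverse_unique complex_norm_square mem_sphere_0 of_real_1 power_one)
    then have "z powi -1 = cnj z" by (simp only: power_int_minus power_int_1_right)
    then have "(\<Sum>k\<in>{1,-1}. c k * z powi k) = c 1 * z + c (-1) * cnj z" by simp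
    then show ?thesis
      by (simp add: c_def fz complex_eq_iff field_simps)
  qed
  then show ?case by (intro exI[of _ "{1,-1}"] exI[of _ c] conjI ballI) auto
next
  case (const a)
  show ?case by (rule exI[of _ "{0}"], rule exI[of _ "\<lambda>_. of_real a"]) auto
next
  case (add f g)
  then obtain K c L d where K: "finite K" "\<And>z. z\<in>sphere 0 1 \<Longrightarrow> of_real (f z) = (\<Sum>k\<in>K. c k * z powi k)"
    and L: "finite L" "\<And>z. z\<in>sphere 0 1 \<Longrightarrow> of_real (g z) = (\<Sum>k\<in>L. d k * z powi k)"
    by metis
  have "of_real (f z + g z) = (\<Sum>k\<in>K \<union> L. ((if k \<in> K then c k else 0) + (if k \<in> L then d k else 0)) * z powi k)"
    if "z\<in>sphere 0 1" for z
  proof -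
    have 1: "(\<Sum>k\<in>K. c k * z powi k) = (\<Sum>k\<in>K \<union> L. (if k \<in> K then c k else 0) * z powi k)"
      by (rule sum.mono_neutral_cong_left) (use K L in auto)
    have 2: "(\<Sum>k\<in>L. d k * z powi k) = (\<Sum>k\<in>K \<union> L. (if k \<in> L then d k else 0) * z powi k)"
      by (rule sum.mono_neutral_cong_left) (use K L in auto)
    show ?thesis by (simp only: of_real_add K(2)[OF that] L(2)[OF that] 1 2 sum.distrib distrib_right)
  qed
  then show ?case using K(1) L(1) by (intro exI[of _ "K \<union> L"] exI conjI) auto
next
  case (mult f g)
  then obtain K c L d where K: "finite K" "\<And>z. z\<in>sphere 0 1 \<Longrightarrow> of_real (f z) = (\<Sum>k\<in>K. c k * z powi k)"
    and L: "finite L" "\<And>z. z\<in>sphere 0 1 \<Longrightarrow> of_real (g z) = (\<Sum>k\<in>L. d k * z powi k)"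
    by metis
  define S where "S = (\<lambda>(k,l). k + l) ` (K \<times> L)"
  have "of_real (f z * g z) = (\<Sum>m\<in>S. (\<Sum>x\<in>{x\<in>K \<times> L. fst x + snd x = m}. c (fst x) * d (snd x)) * z powi m)"
    if "z\<in>sphere 0 1" for z
  proof -
    have z: "z \<noteq> 0" using that by auto
    have "of_real (f z * g z) = (\<Sum>x\<in>K \<times> L. (c (fst x) * z powi fst x) * (d (snd x) * z powi snd x))"
      by (simp add: K(2)[OF that] L(2)[OF that] sum_product sum.cartesian_product case_prod_beta)
    also have "\<dots> = (\<Sum>x\<in>K \<times> L. c (fst x) * d (snd x) * z powi (fst x + snd x))"
      by (intro sum.cong) (auto simp: power_int_add z)
    also have "\<dots> = (\<Sum>m\<in>S. \<Sum>x\<in>{x\<in>K \<times> L. fst x + snd x = m}. c (fst x) * d (snd x) * z powi (fst x + snd x))"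
      by (rule sum.group[symmetric]) (auto simp: S_def K L)
    also have "\<dots> = (\<Sum>m\<in>S. (\<Sum>x\<in>{x\<in>K \<times> L. fst x + snd x = m}. c (fst x) * d (snd x)) * z powi m)"
      by (simp add: sum_distrib_right)
    finally show ?thesis .
  qed
  moreover have "finite S" using K L by (auto simp: S_def)
  ultimately show ?case by (intro exI[of _ S] exI conjI) auto
qed

text \<open>Stone-Weierstrass: a polynomial \<open>p\<close> within \<open>e\<close> of
  \<open>g\<close> on the circle is a trigonometric polynomial there, so \<open>f p\<close>
  integrates to 0 and the integral of \<open>f g\<close> is at most \<open>e\<close> times the L^1
  norm of \<open>f\<close>.\<close>

lemma integral_mult_continuous_eq_0:
  fixes f :: "complex \<Rightarrow> complex" and g :: "complex \<Rightarrow> real"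
  assumes f: "integrable circle f" and 0: "\<And>k. integral\<^sup>L circle (\<lambda>z. f z * z powi k) = 0"
    and g: "continuous_on UNIV g"
  shows "integral\<^sup>L circle (\<lambda>z. f z * of_real (g z)) = 0"
proof -
  have gm: "(\<lambda>z. complex_of_real (g z)) \<in> borel_measurable circle"
    using g by (intro borel_measurable_circle_restrict borel_measurable_continuous_onI continuous_intros)
  have "bounded (g ` sphere 0 1)"
    by (intro compact_imp_bounded compact_continuous_image continuous_on_subset[OF g]) auto
  then obtain B where "\<forall>x\<in>g ` sphere 0 1. norm x \<le> B"
    unfolding bounded_iff by blast
  then have B: "\<And>z. z \<in> sphere 0 1 \<Longrightarrow> \<bar>g z\<bar> \<le> B" by auto
  have gi: "integrable circle (\<lambda>z. f z * of_real (g z))"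
    by (rule integrable_circle_mult_bounded[OF f gm, of B]) (use B in auto)
  have "norm (integral\<^sup>L circle (\<lambda>z. f z * of_real (g z))) \<le> e * integral\<^sup>L circle (\<lambda>z. cmod (f z))" if e: "e > 0" for e
  proof -
    have cont: "continuous_on (sphere 0 1) g" using g continuous_on_subset by blast
    obtain p where p: "real_polynomial_function p" "\<And>z. z \<in> sphere 0 1 \<Longrightarrow> \<bar>g z - p z\<bar> < e"
      using Stone_Weierstrass_real_polynomial_function[OF compact_sphere cont e] by metis
    obtain K c where K: "finite K" "\<And>z. z\<in>sphere 0 1 \<Longrightarrow> of_real (p z) = (\<Sum>k\<in>K. c k * z powi k)"
      using real_polynomial_function_trig[OF p(1)] by metis
    have ik: "integrable circle (\<lambda>z. f z * z powi k)" for k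
      by (rule integrable_circle_mult_bounded[OF f borel_measurable_powi, of _ 1]) (simp add: norm_powi_circle)
    have "integral\<^sup>L circle (\<lambda>z. f z * of_real (p z)) = integral\<^sup>L circle (\<lambda>z. \<Sum>k\<in>K. c k * (f z * z powi k))"
      by (intro Bochner_Integration.integral_cong) (auto simp: K sum_distrib_left mult_ac)
    also have "\<dots> = 0" using ik by (simp add: 0)
    finally have p0: "integral\<^sup>L circle (\<lambda>z. f z * of_real (p z)) = 0" .
    have "integrable circle (\<lambda>z. \<Sum>k\<in>K. c k * (f z * z powi k))"
      using ik by auto
    then have pi: "integrable circle (\<lambda>z. f z * of_real (p z))"
      by (rule Bochner_Integration.integrable_cong[THEN iffD1, rotated -1]) (auto simp: K sum_distrib_left mult_ac)
    have "integral\<^sup>L circle (\<lambda>z. f z * of_real (g z)) = integral\<^sup>L circle (\<lambda>z. f z * of_real (g z) - f z * of_real (p z))"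
      using gi pi by (simp add: p0)
    also have "norm \<dots> \<le> integral\<^sup>L circle (\<lambda>z. norm (f z * of_real (g z) - f z * of_real (p z)))"
      by (rule integral_norm_bound)
    also have "\<dots> \<le> integral\<^sup>L circle (\<lambda>z. e * cmod (f z))"
    proof (rule integral_mono)
      show "integrable circle (\<lambda>z. norm (f z * of_real (g z) - f z * of_real (p z)))"
        using gi pi by auto
      show "integrable circle (\<lambda>z. e * cmod (f z))" using f by auto
      fix z assume "z \<in> space circle"
      then have "cmod (f z) * \<bar>g z - p z\<bar> \<le> cmod (f z) * e"
        using p(2)[of z] by (intro mult_left_mono) auto
      then show "norm (f z * of_real (g z) - f z * of_real (p z)) \<le> e * cmod (f z)"
        by (simp add: right_diff_distrib[symmetric] norm_mult mult.commute flip: of_real_diff)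
    qed
    finally show ?thesis by simp
  qed
  then have "norm (integral\<^sup>L circle (\<lambda>z. f z * of_real (g z))) \<le> e" if "e > 0" for e
  proof -
    define I where "I = integral\<^sup>L circle (\<lambda>z. cmod (f z))"
    have I: "I \<ge> 0" by (simp add: I_def)
    have "norm (integral\<^sup>L circle (\<lambda>z. f z * of_real (g z))) \<le> e / (I + 1) * I"
      unfolding I_def[symmetric] using that I
      by (metis I_def \<open>\<And>e. 0 < e \<Longrightarrow> _ e\<close> divide_pos_pos add_nonneg_pos zero_less_one)
    also have "\<dots> \<le> e" using that I by (simp add: field_simps)
    finally show ?thesis .
  qed
  then have "norm (integral\<^sup>L circle (\<lambda>z. f z * of_real (g z))) \<le> 0" by (rule field_le_epsilon) simp
  then show ?thesis by simp
qed

text \<open>Vanishing against continuous functions passes to indicators of closed sets by dominated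
  convergence, then to Borel sets by Dynkin's pi-lambda theorem; an integrable function whose
  integral over every measurable set is 0 vanishes almost everywhere.\<close>

lemma fourier_coeffs_0_imp_AE_0:
  fixes f :: "complex \<Rightarrow> complex"
  assumes f: "integrable circle f" and 0: "\<And>k. integral\<^sup>L circle (\<lambda>z. f z * z powi k) = 0"
  shows "AE z in circle. f z = 0"
proof (rule circle.density_zero[OF f])
  let ?S = "sphere (0::complex) 1"
  have closed: "(LINT z|circle. f z * indicator C z) = 0" if C: "closed C" for C
  proof (cases "C = {}")
    case False
    \<comment> \<open>Continuous ramps, equal to 1 on \<open>C\<close>, that decrease to its
      indicator; closedness of \<open>C\<close> makes the distance positive off
      \<open>C\<close>.\<close>
    define g where "g = (\<lambda>n z. max 0 (1 - real n * infdist z C))"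
    have g0: "continuous_on UNIV (g n)" for n
      unfolding g_def by (intro continuous_intros)
    have gm: "(\<lambda>z. complex_of_real (g n z)) \<in> borel_measurable circle" for n
      by (intro borel_measurable_circle_restrict borel_measurable_continuous_onI continuous_intros g0)
    have lim: "(\<lambda>n. g n z) \<longlonglongrightarrow> indicator C z" for z
    proof (cases "z \<in> C")
      case True
      then show ?thesis by (simp add: g_def)
    next
      case z: False
      then have pos: "infdist z C > 0" using C False
        by (metis in_closed_iff_infdist_zero infdist_nonneg order_le_less)
      then obtain N where N: "1 < real N * infdist z C" using reals_Archimedean3 by blast
      have "g n z = 0" if "n \<ge> N" for n
      proof -
        have "real N * infdist z C \<le> real n * infdist z C" using that pos by (intro mult_right_mono) auto
        with N show ?thesis by (simp add: g_def)
      qed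
      then have "\<forall>\<^sub>F n in sequentially. g n z = indicator C z"
        using z by (auto simp: eventually_sequentially)
      then show ?thesis by (rule tendsto_eventually)
    qed
    have "(\<lambda>n. LINT z|circle. f z * of_real (g n z)) \<longlonglongrightarrow> (LINT z|circle. f z * of_real (indicator C z))"
    proof (rule integral_dominated_convergence[where w = "\<lambda>z. cmod (f z)"])
      show "(\<lambda>z. f z * of_real (indicator C z)) \<in> borel_measurable circle"
        using f C by (intro borel_measurable_times borel_measurable_of_real borel_measurable_indicator')
          (auto simp: borel_measurable_circle_restrict intro!: borel_measurable_circle_restrict borel_measurable_indicator)
      show "\<And>i. (\<lambda>z. f z * of_real (g i z)) \<in> borel_measurable circle" using f gm by auto
      show "AE z in circle. (\<lambda>i. f z * of_real (g i z)) \<longlonglongrightarrow> f z * of_real (indicator C z)"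
        by (intro AE_I2 tendsto_intros lim)
      show "AE z in circle. cmod (f z * of_real (g i z)) \<le> cmod (f z)" for i
        by (intro AE_I2) (auto simp: norm_mult g_def intro!: mult_left_le mult_nonneg_nonneg infdist_nonneg)
    qed (use f in auto)
    moreover have "(LINT z|circle. f z * of_real (g n z)) = 0" for n
      by (rule integral_mult_continuous_eq_0[OF f 0 g0])
    ultimately have "(LINT z|circle. f z * of_real (indicator C z)) = 0"
      by (simp add: LIMSEQ_const_iff)
    moreover have "of_real (indicator C z) = (indicator C z :: complex)" for z by (simp add: indicator_def)
    ultimately show ?thesis by simp
  qed simp
  have intf: "integrable circle (\<lambda>z. f z * indicator B z)" if "B \<in> sets borel" for B
    by (rule integrable_circle_mult_bounded[OF f, of _ 1])
       (use that in \<open>auto simp: indicator_def intro!: borel_measurable_circle_restrict borel_measurable_indicator\<close>)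
  have borel: "(LINT z|circle. f z * indicator B z) = 0" if "B \<in> sets borel" for B
  proof -
    have "B \<in> sigma_sets UNIV (Collect closed)"
      using that by (simp add: borel_eq_closed)
    then show ?thesis
    proof (induction rule: sigma_sets_induct_disjoint[rotated 2, consumes 1, case_names basic empty compl union int_stable sub])
      case int_stable show ?case by (auto simp: Int_stable_def)
    next
      case sub show ?case by simp
    next
      case (basic A) then show ?case using closed by blast
    next
      case empty show ?case by simp
    next
      case (compl A)
      then have A: "A \<in> sets borel" by (simp add: borel_eq_closed)
      have "(LINT z|circle. f z * indicator (UNIV - A) z) = (LINT z|circle. f z - f z * indicator A z)"
        by (intro Bochner_Integration.integral_cong) (auto simp: indicator_def)
      also have "\<dots> = (LINT z|circle. f z) - (LINT z|circle. f z * indicator A z)"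
        using f intf[OF A] by simp
      also have "\<dots> = 0" using compl 0[of 0] by simp
      finally show ?case .
    next
      case (union A)
      have A: "A i \<in> sets borel" for i using union by (auto simp: borel_eq_closed)
      have "(\<lambda>n. LINT z|circle. (\<Sum>i<n. f z * indicator (A i) z)) \<longlonglongrightarrow> (LINT z|circle. f z * indicator (\<Union>i. A i) z)"
      proof (rule integral_dominated_convergence[where w = "\<lambda>z. cmod (f z)"])
        have s: "(\<Sum>i<n. f z * indicator (A i) z) = f z * indicator (\<Union>i<n. A i) z" for n z
          using union(1) by (subst indicator_UN_disjoint)
            (auto simp: sum_distrib_left disjoint_family_on_def)
        show "AE z in circle. (\<lambda>n. \<Sum>i<n. f z * indicator (A i) z) \<longlonglongrightarrow> f z * indicator (\<Union>i. A i) z"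
          unfolding s by (intro AE_I2 tendsto_intros LIMSEQ_indicator_UN)
        show "AE z in circle. cmod (\<Sum>i<n. f z * indicator (A i) z) \<le> cmod (f z)" for n
          unfolding s by (intro AE_I2) (auto simp: norm_mult indicator_def)
        show "(\<lambda>z. \<Sum>i<n. f z * indicator (A i) z) \<in> borel_measurable circle" for n
          by (intro borel_measurable_sum borel_measurable_integrable intf A)
        show "(\<lambda>z. f z * indicator (\<Union>i. A i) z) \<in> borel_measurable circle"
          using intf[of "\<Union>i. A i"] A by auto
      qed (use f in auto)
      moreover have "(LINT z|circle. (\<Sum>i<n. f z * indicator (A i) z)) = 0" for n
        by (subst Bochner_Integration.integral_sum) (simp_all add: intf A union)
      ultimately show ?case by (simp add: LIMSEQ_const_iff)
    qed
  qed
  fix A assume "A \<in> sets circle"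
  then obtain B where B: "B \<in> sets borel" "A = B \<inter> ?S"
    by (auto simp: sets_circle sets_restrict_space)
  show "set_lebesgue_integral circle A f = 0"
    unfolding set_lebesgue_integral_def borel[OF B(1), symmetric]
    by (intro Bochner_Integration.integral_cong) (auto simp: B indicator_def)
qed

section \<open>Trigonometric sums and the Riesz-Fischer theorem\<close>

lemma cnj_powi_circle: "z \<in> sphere 0 1 \<Longrightarrow> cnj (z powi k) = z powi (-k)"
  by (metis power_int_minus inverse_unique complex_norm_square mem_sphere_0 of_real_1 power_one norm_powi_circle)

definition trig_sum :: "(int \<Rightarrow> complex) \<Rightarrow> int set \<Rightarrow> complex \<Rightarrow> complex" where
  "trig_sum a A z = (\<Sum>k\<in>A. a k * z powi k)"

lemma trig_sum_measurable [measurable]: "trig_sum a A \<in> borel_measurable circle"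
  unfolding trig_sum_def by (intro borel_measurable_sum borel_measurable_times borel_measurable_const borel_measurable_powi)

lemma trig_sum_bound: "z \<in> sphere 0 1 \<Longrightarrow> cmod (trig_sum a A z) \<le> (\<Sum>k\<in>A. cmod (a k))"
  unfolding trig_sum_def by (rule order_trans[OF norm_sum]) (simp add: norm_mult norm_power_int)

lemma integrable_powi: "integrable circle (\<lambda>z. z powi k)"
  by (rule integrable_circle_bounded[of _ 1]) (auto simp: norm_power_int)

lemma trig_sum_coeff:
  assumes "finite A"
  shows "(LINT z|circle. trig_sum a A z * z powi (-k)) = (if k \<in> A then a k else 0)"
proof -
  have "(LINT z|circle. trig_sum a A z * z powi (-k)) = (LINT z|circle. (\<Sum>l\<in>A. a l * z powi (l - k)))"
  proof (intro Bochner_Integration.integral_cong refl)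
    fix z assume "z \<in> space circle"
    then have "z \<noteq> 0" by auto
    then have "z powi (l - k) = z powi l * z powi (-k)" for l
      by (simp add: power_int_add[symmetric])
    then show "trig_sum a A z * z powi (-k) = (\<Sum>l\<in>A. a l * z powi (l - k))"
      by (simp add: trig_sum_def sum_distrib_right mult.assoc)
  qed
  also have "\<dots> = (\<Sum>l\<in>A. a l * (if l = k then 1 else 0))"
    by (subst Bochner_Integration.integral_sum)
       (auto simp: integral_circle_powi integrable_powi intro!: sum.cong)
  also have "\<dots> = (if k \<in> A then a k else 0)" using assms by (simp add: if_distrib sum.delta cong: if_cong)
  finally show ?thesis .
qed

lemma trig_sum_norm:
  assumes A: "finite A"
  shows "(LINT z|circle. (cmod (trig_sum a A z))\<^sup>2) = (\<Sum>k\<in>A. (cmod (a k))\<^sup>2)"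
proof -
  have int: "integrable circle (\<lambda>z. trig_sum a A z * z powi (-k))" for k
    by (rule integrable_circle_bounded[of _ "\<Sum>k\<in>A. cmod (a k)"])
       (auto simp: norm_mult norm_power_int intro: trig_sum_bound)
  have "complex_of_real (LINT z|circle. (cmod (trig_sum a A z))\<^sup>2) = (LINT z|circle. of_real ((cmod (trig_sum a A z))\<^sup>2))"
    by (rule integral_complex_of_real[symmetric])
  also have "\<dots> = (LINT z|circle. (\<Sum>k\<in>A. cnj (a k) * (trig_sum a A z * z powi (-k))))"
  proof (intro Bochner_Integration.integral_cong refl)
    fix z assume "z \<in> space circle"
    then have z: "z \<in> sphere 0 1" by simp
    have "of_real ((cmod (trig_sum a A z))\<^sup>2) = trig_sum a A z * cnj (trig_sum a A z)"
      by (rule complex_norm_square)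
    also have "cnj (trig_sum a A z) = (\<Sum>k\<in>A. cnj (a k) * z powi (-k))"
      by (simp only: trig_sum_def cnj_sum complex_cnj_mult cnj_powi_circle[OF z])
    finally show "of_real ((cmod (trig_sum a A z))\<^sup>2) = (\<Sum>k\<in>A. cnj (a k) * (trig_sum a A z * z powi (-k)))"
      by (simp add: sum_distrib_left mult_ac)
  qed
  also have "\<dots> = (\<Sum>k\<in>A. cnj (a k) * a k)"
    by (subst Bochner_Integration.integral_sum) (auto simp: int trig_sum_coeff[OF A] intro!: sum.cong)
  also have "\<dots> = of_real (\<Sum>k\<in>A. (cmod (a k))\<^sup>2)"
    by (simp add: mult.commute flip: complex_norm_square)
  finally show ?thesis using of_real_eq_iff by blast
qed

text \<open>Cauchy criterion for unordered sums. It supplies the blocks of the Riesz-Fischer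
  argument without fixing an enumeration of the integers.\<close>

lemma summable_on_finite_tail:
  fixes q :: "'a \<Rightarrow> real"
  assumes q: "q summable_on UNIV" "\<And>k. q k \<ge> 0" and e: "e > 0"
  shows "\<exists>F. finite F \<and> (\<forall>B. finite B \<longrightarrow> B \<inter> F = {} \<longrightarrow> sum q B \<le> e)"
proof -
  have "(sum q \<longlongrightarrow> infsum q UNIV) (finite_subsets_at_top UNIV)"
    using infsum_tendsto[OF q(1)] by simp
  then have "\<forall>\<^sub>F X in finite_subsets_at_top UNIV. infsum q UNIV - e < sum q X"
    by (rule order_tendstoD) (use e in simp)
  then obtain F where F: "finite F" "infsum q UNIV - e < sum q F"
    by (auto simp: eventually_finite_subsets_at_top)
  have "sum q B \<le> e" if "finite B" "B \<inter> F = {}" for B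
  proof -
    have "sum q (B \<union> F) \<le> infsum q UNIV"
      using q F that by (intro finite_sum_le_infsum) auto
    then show ?thesis using that F by (simp add: sum.union_disjoint)
  qed
  with F show ?thesis by blast
qed

text \<open>Partial sums over suitable blocks have increments with geometrically small L^1 norms,
  hence converge almost everywhere. Termwise integration gives the coefficients of the limit and
  Fatou's lemma the norm bound; the opposite inequality will be Bessel's.\<close>

lemma riesz_fischer:
  assumes sq: "(\<lambda>k. (cmod (a k))\<^sup>2) summable_on (UNIV :: int set)"
  shows "\<exists>g \<in> borel_measurable circle. integrable circle (\<lambda>z. (cmod (g z))\<^sup>2)
    \<and> (\<forall>k. (LINT z|circle. g z * z powi (-k)) = a k)
    \<and> (LINT z|circle. (cmod (g z))\<^sup>2) \<le> (\<Sum>\<^sub>\<infinity>k. (cmod (a k))\<^sup>2)"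
proof -
  define C where "C = (\<Sum>\<^sub>\<infinity>k. (cmod (a k))\<^sup>2)"
  have C0: "C \<ge> 0" unfolding C_def by (rule infsum_nonneg) simp
  have "\<forall>j. \<exists>F. finite F \<and> (\<forall>B. finite B \<longrightarrow> B \<inter> F = {} \<longrightarrow> (\<Sum>k\<in>B. (cmod (a k))\<^sup>2) \<le> (1/4)^j)"
    by (intro allI summable_on_finite_tail[OF sq]) auto
  then obtain F where F: "\<And>j. finite (F j)"
    "\<And>j B. finite B \<Longrightarrow> B \<inter> F j = {} \<Longrightarrow> (\<Sum>k\<in>B. (cmod (a k))\<^sup>2) \<le> (1/4)^j"
    by metis
  \<comment> \<open>The intervals make the sets exhaust the integers and the unions make them
    increase; since \<open>F j\<close> lies in \<open>A j\<close>, the block between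
    \<open>A j\<close> and \<open>A (Suc j)\<close> belongs to the tail of mass at most
    \<open>(1/4)^j\<close>.\<close>
  define A where "A j = (\<Union>i\<le>j. F i) \<union> {-int j..int j}" for j
  have Af: "finite (A j)" for j using F by (auto simp: A_def)
  have Am: "A j \<subseteq> A (Suc j)" for j by (force simp: A_def)
  define D where "D j = trig_sum a (A (Suc j) - A j)" for j
  have Dm [measurable]: "D j \<in> borel_measurable circle" for j by (simp add: D_def)
  have D2: "(LINT z|circle. (cmod (D j z))\<^sup>2) \<le> (1/4)^j" for j
    unfolding D_def using Af by (subst trig_sum_norm) (auto intro!: F(2) simp: A_def)
  have Dbd: "cmod (D j z) \<le> (\<Sum>k\<in>A (Suc j) - A j. cmod (a k))" if "z \<in> sphere 0 1" for j z
    unfolding D_def by (rule trig_sum_bound[OF that])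
  have Di: "integrable circle (D j)" for j
    by (rule integrable_circle_bounded[OF Dm Dbd])
  have D2i: "integrable circle (\<lambda>z. (cmod (D j z))\<^sup>2)" for j
    by (rule circle.integrable_const_bound[of _ "(\<Sum>k\<in>A (Suc j) - A j. cmod (a k))\<^sup>2"])
       (auto intro!: AE_I2 power_mono Dbd)
  have D1: "(LINT z|circle. cmod (D j z)) \<le> (1/2)^j" for j
  proof -
    \<comment> \<open>Arithmetic-geometric mean with weight \<open>2^j\<close> in place of
      Cauchy-Schwarz: the choice balances \<open>(1/2)^j\<close> against
      \<open>2^j * (1/4)^j\<close>.\<close>
    have "cmod (D j z) \<le> ((1/2)^j + 2^j * (cmod (D j z))\<^sup>2) / 2" for z
    proof -
      have "0 \<le> (cmod (D j z) * 2^j - 1)\<^sup>2 / 2^j" by simp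
      also have "\<dots> = 2^j * (cmod (D j z))\<^sup>2 - 2 * cmod (D j z) + (1/2)^j"
        by (simp add: power2_eq_square field_simps)
      finally show ?thesis by simp
    qed
    then have "(LINT z|circle. cmod (D j z)) \<le> (LINT z|circle. ((1/2)^j + 2^j * (cmod (D j z))\<^sup>2) / 2)"
      using Di D2i by (intro integral_mono) auto
    also have "\<dots> = ((1/2)^j + 2^j * (LINT z|circle. (cmod (D j z))\<^sup>2)) / 2"
      using D2i by simp
    also have "\<dots> \<le> ((1/2)^j + 2^j * (1/4)^j) / 2"
      by (intro divide_right_mono add_left_mono mult_left_mono D2) auto
    also have "\<dots> = (1/2)^j" by (simp add: power_mult_distrib[symmetric])
    finally show ?thesis .
  qed
  have D1s: "summable (\<lambda>j. LINT z|circle. cmod (D j z))"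
    by (rule summable_comparison_test'[of "\<lambda>j. (1/2)^j" 0]) (use D1 in \<open>auto simp: summable_geometric\<close>)
  have aes: "AE z in circle. summable (\<lambda>j. cmod (D j z))"
  proof -
    have "(\<integral>\<^sup>+z. (\<Sum>j. ennreal (cmod (D j z))) \<partial>circle) = (\<Sum>j. \<integral>\<^sup>+z. ennreal (cmod (D j z)) \<partial>circle)"
      by (rule nn_integral_suminf) auto
    also have "\<dots> = (\<Sum>j. ennreal (LINT z|circle. cmod (D j z)))"
      by (intro arg_cong[where f=suminf] ext nn_integral_eq_integral integrable_norm Di) auto
    also have "\<dots> \<noteq> \<infinity>"
      using D1s by (simp add: ennreal_suminf_neq_top)
    finally have "AE z in circle. (\<Sum>j. ennreal (cmod (D j z))) \<noteq> \<infinity>"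
      by (rule nn_integral_noteq_infinite[rotated]) (intro borel_measurable_suminf_order measurable_compose[OF Dm] measurable_compose[OF _ measurable_ennreal] borel_measurable_norm measurable_ident)
    then show ?thesis
      by eventually_elim (auto intro: summable_suminf_not_top)
  qed
  define g where "g z = trig_sum a (A 0) z + (\<Sum>j. D j z)" for z
  have gm [measurable]: "g \<in> borel_measurable circle" unfolding g_def by measurable
  have part: "trig_sum a (A n) z = trig_sum a (A 0) z + (\<Sum>j<n. D j z)" for n z
  proof (induction n)
    case (Suc n)
    have "trig_sum a (A (Suc n)) z = trig_sum a (A n) z + D n z"
      unfolding trig_sum_def D_def by (subst sum.subset_diff[OF Am[of n] Af]) simp
    with Suc show ?case by simp
  qed simp
  have aelim: "AE z in circle. (\<lambda>n. trig_sum a (A n) z) \<longlonglongrightarrow> g z"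
    using aes
  proof eventually_elim
    case (elim z)
    have "(\<lambda>n. trig_sum a (A 0) z + (\<Sum>j<n. D j z)) \<longlonglongrightarrow> g z"
      unfolding g_def by (rule tendsto_add[OF tendsto_const summable_LIMSEQ[OF summable_norm_cancel[OF elim]]])
    moreover have "(\<lambda>n. trig_sum a (A n) z) = (\<lambda>n. trig_sum a (A 0) z + (\<Sum>j<n. D j z))"
      by (rule ext) (rule part)
    ultimately show ?case by argo
  qed
  have coeff: "(LINT z|circle. g z * z powi (-k)) = a k" for k
  proof -
    have bi: "integrable circle (\<lambda>z. D j z * z powi (-k))" for j
      by (rule integrable_circle_mult_bounded[OF Di borel_measurable_powi, of _ 1]) (simp add: norm_powi_circle)
    have t0: "integrable circle (\<lambda>z. trig_sum a (A 0) z * z powi (-k))"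
      by (rule integrable_circle_bounded[of _ "\<Sum>k\<in>A 0. cmod (a k)"])
         (auto simp: norm_mult norm_power_int intro: trig_sum_bound)
    have n: "(LINT z|circle. norm (D j z * z powi (-k))) = (LINT z|circle. cmod (D j z))" for j
      by (intro Bochner_Integration.integral_cong) (auto simp: norm_mult norm_power_int)
    have ae2: "AE z in circle. summable (\<lambda>j. norm (D j z * z powi (-k)))"
      using aes AE_space by eventually_elim (simp add: norm_mult norm_power_int)
    have sn: "summable (\<lambda>j. LINT z|circle. norm (D j z * z powi (-k)))" unfolding n by (rule D1s)
    note S = sums_integral[OF bi ae2 sn] and Si = integrable_suminf[OF bi ae2 sn]
    have "(LINT z|circle. g z * z powi (-k)) = (LINT z|circle. trig_sum a (A 0) z * z powi (-k) + (\<Sum>j. D j z * z powi (-k)))"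
    proof (rule integral_cong_AE)
      show "AE z in circle. g z * z powi (-k) = trig_sum a (A 0) z * z powi (-k) + (\<Sum>j. D j z * z powi (-k))"
        using aes unfolding g_def by eventually_elim (simp add: distrib_right suminf_mult2 summable_norm_cancel)
    qed measurable
    also have "\<dots> = (LINT z|circle. trig_sum a (A 0) z * z powi (-k)) + (LINT z|circle. (\<Sum>j. D j z * z powi (-k)))"
      using t0 Si by simp
    finally have e: "(LINT z|circle. g z * z powi (-k)) = \<dots>" .
    have "(\<lambda>n. (LINT z|circle. trig_sum a (A 0) z * z powi (-k)) + (\<Sum>j<n. LINT z|circle. D j z * z powi (-k)))
       \<longlonglongrightarrow> (LINT z|circle. g z * z powi (-k))"
      unfolding e by (rule tendsto_add[OF tendsto_const]) (use S in \<open>simp add: sums_def\<close>)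
    moreover have "(LINT z|circle. trig_sum a (A 0) z * z powi (-k)) + (\<Sum>j<n. LINT z|circle. D j z * z powi (-k))
       = (if k \<in> A n then a k else 0)" for n
    proof -
      have "(LINT z|circle. trig_sum a (A 0) z * z powi (-k)) + (\<Sum>j<n. LINT z|circle. D j z * z powi (-k))
          = (LINT z|circle. trig_sum a (A 0) z * z powi (-k) + (\<Sum>j<n. D j z * z powi (-k)))"
        using t0 bi by simp
      also have "\<dots> = (LINT z|circle. trig_sum a (A n) z * z powi (-k))"
        by (subst part[of n]) (simp add: distrib_right sum_distrib_right)
      finally show ?thesis by (simp add: trig_sum_coeff Af)
    qed
    ultimately have l: "(\<lambda>n. if k \<in> A n then a k else 0) \<longlonglongrightarrow> (LINT z|circle. g z * z powi (-k))"
      by simp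
    have "\<forall>\<^sub>F n in sequentially. (if k \<in> A n then a k else 0) = a k"
      unfolding eventually_sequentially by (rule exI[of _ "nat \<bar>k\<bar>"]) (auto simp: A_def)
    then have "(\<lambda>n. if k \<in> A n then a k else 0) \<longlonglongrightarrow> a k" by (rule tendsto_eventually)
    with l show ?thesis by (rule LIMSEQ_unique)
  qed
  have fatou: "(\<integral>\<^sup>+z. ennreal ((cmod (g z))\<^sup>2) \<partial>circle) \<le> ennreal C"
  proof -
    have "(\<integral>\<^sup>+z. ennreal ((cmod (g z))\<^sup>2) \<partial>circle)
        = (\<integral>\<^sup>+z. liminf (\<lambda>n. ennreal ((cmod (trig_sum a (A n) z))\<^sup>2)) \<partial>circle)"
    proof (rule nn_integral_cong_AE)
      show "AE z in circle. ennreal ((cmod (g z))\<^sup>2) = liminf (\<lambda>n. ennreal ((cmod (trig_sum a (A n) z))\<^sup>2))"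
        using aelim
      proof eventually_elim
        case (elim z)
        have "(\<lambda>n. ennreal ((cmod (trig_sum a (A n) z))\<^sup>2)) \<longlonglongrightarrow> ennreal ((cmod (g z))\<^sup>2)"
          by (intro tendsto_intros elim)
        from lim_imp_Liminf[OF _ this] show ?case by simp
      qed
    qed
    also have "\<dots> \<le> liminf (\<lambda>n. \<integral>\<^sup>+z. ennreal ((cmod (trig_sum a (A n) z))\<^sup>2) \<partial>circle)"
      by (rule nn_integral_liminf) measurable
    also have "\<dots> \<le> liminf (\<lambda>n::nat. ennreal C)"
    proof (rule Liminf_mono, rule always_eventually, rule allI)
      fix n
      have "integrable circle (\<lambda>z. (cmod (trig_sum a (A n) z))\<^sup>2)"
        by (rule circle.integrable_const_bound[of _ "(\<Sum>k\<in>A n. cmod (a k))\<^sup>2"])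
           (auto intro!: AE_I2 power_mono trig_sum_bound)
      then have "(\<integral>\<^sup>+z. ennreal ((cmod (trig_sum a (A n) z))\<^sup>2) \<partial>circle) = ennreal (\<Sum>k\<in>A n. (cmod (a k))\<^sup>2)"
        by (subst nn_integral_eq_integral) (auto simp: trig_sum_norm Af)
      also have "\<dots> \<le> ennreal C"
        unfolding C_def using Af sq by (intro ennreal_leI finite_sum_le_infsum) auto
      finally show "(\<integral>\<^sup>+z. ennreal ((cmod (trig_sum a (A n) z))\<^sup>2) \<partial>circle) \<le> ennreal C" .
    qed
    also have "\<dots> = ennreal C" by (simp add: Liminf_const)
    finally show ?thesis .
  qed
  have gi: "integrable circle (\<lambda>z. (cmod (g z))\<^sup>2)"
    by (rule integrableI_bounded) (use fatou in \<open>auto intro: le_less_trans\<close>)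
  have "ennreal (LINT z|circle. (cmod (g z))\<^sup>2) \<le> ennreal C"
    using fatou nn_integral_eq_integral[OF gi] by simp
  then have "(LINT z|circle. (cmod (g z))\<^sup>2) \<le> C"
    using C0 by (simp add: ennreal_le_iff)
  with gm gi coeff show ?thesis unfolding C_def by blast
qed

section \<open>Integrals, inner products and Fourier coefficients on the quotient type\<close>

lemma cnj_measurable [measurable (raw)]:
  "f \<in> borel_measurable M \<Longrightarrow> (\<lambda>z. cnj (f z)) \<in> borel_measurable M"
  by (rule borel_measurable_continuous_on[where f = cnj]) (auto intro: continuous_intros)

lemma has_sum_diff_complex:
  fixes f g :: "'a \<Rightarrow> complex"
  shows "(f has_sum a) A \<Longrightarrow> (g has_sum b) A \<Longrightarrow> ((\<lambda>x. f x - g x) has_sum (a - b)) A"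
  using has_sum_add[where f = f and g = "\<lambda>x. - g x" and a = a and b = "- b" and A = A] by (simp add: has_sum_uminus)

text \<open>The L^1 predicate. A product of two elements of \<open>L2\<close> lies a priori only in
  this class, and inner products are integrals of such products.\<close>

lift_definition integrable_circ :: "circfun \<Rightarrow> bool" is "\<lambda>f. integrable circle f"
  by (intro integrable_cong_AE) auto

lemma const_0 [simp]: "const 0 = 0" by transfer simp
lemma const_1 [simp]: "const 1 = 1" by transfer simp
lemma const_minus: "const (- a) = - const a" by transfer simp
lemma circ_conj_mult: "circ_conj (u * v) = circ_conj u * circ_conj v"
  by transfer simp
lemma circ_conj_conj [simp]: "circ_conj (circ_conj u) = u" by transfer simp
lemma circ_conj_monomial: "circ_conj (monomial k) = monomial (-k)"
  by transfer (auto simp: cnj_powi_circle simp del: complex_cnj_power_int power_int_minus mem_sphere intro!: AE_I2)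
lemma monomial_mult: "monomial k * monomial l = monomial (k + l)"
  by transfer (auto intro!: AE_I2 power_int_add[symmetric])
lemma monomial_0 [simp]: "monomial 0 = 1" by transfer simp

lemma circle_integral_add:
  "integrable_circ u \<Longrightarrow> integrable_circ v \<Longrightarrow> circle_integral (u + v) = circle_integral u + circle_integral v"
  by transfer simp
lemma circle_integral_diff:
  "integrable_circ u \<Longrightarrow> integrable_circ v \<Longrightarrow> circle_integral (u - v) = circle_integral u - circle_integral v"
  by transfer simp
lemma circle_integral_const_mult: "circle_integral (const c * u) = c * circle_integral u"
  by transfer simp
lemma circle_integral_conj: "circle_integral (circ_conj u) = cnj (circle_integral u)"
  by transfer simp
lemma circle_integral_monomial: "circle_integral (monomial k) = (if k = 0 then 1 else 0)"
  by transfer (simp add: integral_circle_powi)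

lemma L2_add: "u \<in> L2 \<Longrightarrow> v \<in> L2 \<Longrightarrow> u + v \<in> L2"
  unfolding L2_def mem_Collect_eq
proof transfer
  fix f g :: "complex \<Rightarrow> complex"
  assume [measurable]: "f \<in> borel_measurable circle \<and> f \<in> borel_measurable circle \<and> (AE z in circle. f z = f z)"
    "g \<in> borel_measurable circle \<and> g \<in> borel_measurable circle \<and> (AE z in circle. g z = g z)"
    and i: "integrable circle (\<lambda>z. (cmod (f z))\<^sup>2)" "integrable circle (\<lambda>z. (cmod (g z))\<^sup>2)"
  have [measurable]: "f \<in> borel_measurable circle" "g \<in> borel_measurable circle"
    using \<open>f \<in> _ \<and> _\<close> \<open>g \<in> _ \<and> _\<close> by auto
  show "integrable circle (\<lambda>z. (cmod (f z + g z))\<^sup>2)"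
  proof (rule Bochner_Integration.integrable_bound)
    show "integrable circle (\<lambda>z. 2 * (cmod (f z))\<^sup>2 + 2 * (cmod (g z))\<^sup>2)" using i by auto
    show "(\<lambda>z. (cmod (f z + g z))\<^sup>2) \<in> borel_measurable circle" by measurable
    have "(cmod (a + b))\<^sup>2 \<le> 2 * (cmod a)\<^sup>2 + 2 * (cmod b)\<^sup>2" for a b :: complex
    proof -
      have "(cmod (a + b))\<^sup>2 \<le> (cmod a + cmod b)\<^sup>2" by (intro power_mono norm_triangle_ineq) auto
      also have "\<dots> \<le> 2 * (cmod a)\<^sup>2 + 2 * (cmod b)\<^sup>2"
        using zero_le_power2[of "cmod a - cmod b"] by (simp add: power2_eq_square algebra_simps)
      finally show ?thesis .
    qed
    then show "AE z in circle. norm ((cmod (f z + g z))\<^sup>2) \<le> norm (2 * (cmod (f z))\<^sup>2 + 2 * (cmod (g z))\<^sup>2)"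
      by (intro AE_I2) simp
  qed
qed

lemma integrable_L2_mult: "u \<in> L2 \<Longrightarrow> v \<in> L2 \<Longrightarrow> integrable_circ (u * v)"
  unfolding L2_def mem_Collect_eq
proof transfer
  fix f g :: "complex \<Rightarrow> complex"
  assume m: "f \<in> borel_measurable circle \<and> f \<in> borel_measurable circle \<and> (AE z in circle. f z = f z)"
    "g \<in> borel_measurable circle \<and> g \<in> borel_measurable circle \<and> (AE z in circle. g z = g z)"
    and i: "integrable circle (\<lambda>z. (cmod (f z))\<^sup>2)" "integrable circle (\<lambda>z. (cmod (g z))\<^sup>2)"
  have [measurable]: "f \<in> borel_measurable circle" "g \<in> borel_measurable circle"
    using m by auto
  show "integrable circle (\<lambda>z. f z * g z)"
  proof (rule Bochner_Integration.integrable_bound)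
    show "integrable circle (\<lambda>z. (cmod (f z))\<^sup>2 + (cmod (g z))\<^sup>2)" using i by auto
    show "(\<lambda>z. f z * g z) \<in> borel_measurable circle" by measurable
    have "cmod (a * b) \<le> (cmod a)\<^sup>2 + (cmod b)\<^sup>2" for a b :: complex
      using zero_le_power2[of "cmod a - cmod b"] zero_le_power2[of "cmod a"] zero_le_power2[of "cmod b"]
      mult_nonneg_nonneg[OF norm_ge_zero[of a] norm_ge_zero[of b]]
      unfolding norm_mult power2_diff by linarith
    then show "AE z in circle. norm (f z * g z) \<le> norm ((cmod (f z))\<^sup>2 + (cmod (g z))\<^sup>2)"
      by (intro AE_I2) simp
  qed
qed

lemma L2_const_mult: "u \<in> L2 \<Longrightarrow> const c * u \<in> L2"
  unfolding L2_def mem_Collect_eq by transfer (simp add: norm_mult power_mult_distrib)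

lemma L2_conj: "u \<in> L2 \<Longrightarrow> circ_conj u \<in> L2"
  unfolding L2_def mem_Collect_eq by transfer simp

lemma L2_monomial: "monomial k \<in> L2"
  unfolding L2_def mem_Collect_eq
proof transfer
  fix k
  have "integrable circle (\<lambda>z. (cmod (z powi k))\<^sup>2) = integrable circle (\<lambda>z. 1::real)"
    by (intro Bochner_Integration.integrable_cong) (auto simp: norm_power_int)
  then show "integrable circle (\<lambda>z. (cmod (z powi k))\<^sup>2)" by simp
qed

lemma L2_1: "1 \<in> L2" using L2_monomial[of 0] by simp

lemma L2_monomial_mult: "u \<in> L2 \<Longrightarrow> monomial k * u \<in> L2"
  unfolding L2_def mem_Collect_eq
proof transfer
  fix k and f :: "complex \<Rightarrow> complex"
  assume m: "f \<in> borel_measurable circle \<and> f \<in> borel_measurable circle \<and> (AE z in circle. f z = f z)"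
    and i: "integrable circle (\<lambda>z. (cmod (f z))\<^sup>2)"
  have "integrable circle (\<lambda>z. (cmod (z powi k * f z))\<^sup>2) = integrable circle (\<lambda>z. (cmod (f z))\<^sup>2)"
    by (intro Bochner_Integration.integrable_cong) (auto simp: norm_mult norm_power_int)
  then show "integrable circle (\<lambda>z. (cmod (z powi k * f z))\<^sup>2)" using i by simp
qed

lemma L2_0: "0 \<in> L2" using L2_const_mult[OF L2_1, of 0] by simp

lemma L2_minus: "u \<in> L2 \<Longrightarrow> - u \<in> L2" using L2_const_mult[of u "-1"] by (simp add: const_minus)
lemma L2_diff: "u \<in> L2 \<Longrightarrow> v \<in> L2 \<Longrightarrow> u - v \<in> L2" using L2_add[of u "-v"] L2_minus by simp
lemma L2_sum: "(\<And>i. i \<in> I \<Longrightarrow> f i \<in> L2) \<Longrightarrow> sum f I \<in> L2"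
  by (induction I rule: infinite_finite_induct) (auto intro: L2_add L2_0)

lemma inner_L2_add_left: "u \<in> L2 \<Longrightarrow> v \<in> L2 \<Longrightarrow> w \<in> L2 \<Longrightarrow> inner_L2 (u + v) w = inner_L2 u w + inner_L2 v w"
  unfolding inner_L2_def by (simp add: distrib_right circle_integral_add integrable_L2_mult L2_conj)
lemma inner_L2_diff_left: "u \<in> L2 \<Longrightarrow> v \<in> L2 \<Longrightarrow> w \<in> L2 \<Longrightarrow> inner_L2 (u - v) w = inner_L2 u w - inner_L2 v w"
  unfolding inner_L2_def by (simp add: left_diff_distrib circle_integral_diff integrable_L2_mult L2_conj)
lemma inner_L2_const_left: "inner_L2 (const c * u) w = c * inner_L2 u w"
  unfolding inner_L2_def by (simp add: mult.assoc circle_integral_const_mult)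
lemma inner_L2_commute: "inner_L2 v u = cnj (inner_L2 u v)"
  unfolding inner_L2_def by (simp add: circ_conj_mult mult.commute flip: circle_integral_conj)
lemma inner_L2_0_left [simp]: "inner_L2 0 w = 0" using inner_L2_const_left[of 0 0 w] by simp
lemma inner_L2_sum_left: "(\<And>i. i \<in> I \<Longrightarrow> f i \<in> L2) \<Longrightarrow> w \<in> L2 \<Longrightarrow> inner_L2 (sum f I) w = (\<Sum>i\<in>I. inner_L2 (f i) w)"
  by (induction I rule: infinite_finite_induct) (auto simp: inner_L2_add_left L2_sum)
lemma inner_L2_add_right: "u \<in> L2 \<Longrightarrow> v \<in> L2 \<Longrightarrow> w \<in> L2 \<Longrightarrow> inner_L2 w (u + v) = inner_L2 w u + inner_L2 w v"
  using inner_L2_add_left[of u v w] inner_L2_commute by (metis complex_cnj_add)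
lemma inner_L2_diff_right: "u \<in> L2 \<Longrightarrow> v \<in> L2 \<Longrightarrow> w \<in> L2 \<Longrightarrow> inner_L2 w (u - v) = inner_L2 w u - inner_L2 w v"
  using inner_L2_diff_left[of u v w] inner_L2_commute by (metis complex_cnj_diff)
lemma inner_L2_const_right: "inner_L2 w (const c * u) = cnj c * inner_L2 w u"
  using inner_L2_const_left[of c u w] inner_L2_commute by (metis complex_cnj_mult)

lemma inner_L2_self_nonneg: "inner_L2 u u = of_real (Re (inner_L2 u u)) \<and> Re (inner_L2 u u) \<ge> 0"
  unfolding inner_L2_def
proof transfer
  fix f :: "complex \<Rightarrow> complex"
  have "(LINT z|circle. f z * cnj (f z)) = of_real (LINT z|circle. (cmod (f z))\<^sup>2)"
    by (simp add: complex_norm_square[symmetric] flip: integral_complex_of_real)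
  then show "(LINT z|circle. f z * cnj (f z)) = of_real (Re (LINT z|circle. f z * cnj (f z)))
     \<and> 0 \<le> Re (LINT z|circle. f z * cnj (f z))"
    by simp
qed

lemma norm_L2_sq: "(norm_L2 u)\<^sup>2 = Re (inner_L2 u u)"
  unfolding norm_L2_def using inner_L2_self_nonneg by simp

lemma norm_L2_nonneg [simp]: "norm_L2 u \<ge> 0"
  unfolding norm_L2_def using inner_L2_self_nonneg by simp

lemma inner_L2_self: "inner_L2 u u = of_real ((norm_L2 u)\<^sup>2)"
  using inner_L2_self_nonneg norm_L2_sq by metis

lemma fourier_add: "u \<in> L2 \<Longrightarrow> v \<in> L2 \<Longrightarrow> fourier (u + v) k = fourier u k + fourier v k"
  by (simp add: fourier_def inner_L2_add_left L2_monomial)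
lemma fourier_diff: "u \<in> L2 \<Longrightarrow> v \<in> L2 \<Longrightarrow> fourier (u - v) k = fourier u k - fourier v k"
  by (simp add: fourier_def inner_L2_diff_left L2_monomial)
lemma fourier_const_mult: "fourier (const c * u) k = c * fourier u k"
  by (simp add: fourier_def inner_L2_const_left)
lemma fourier_sum: "(\<And>i. i \<in> I \<Longrightarrow> f i \<in> L2) \<Longrightarrow> fourier (sum f I) k = (\<Sum>i\<in>I. fourier (f i) k)"
  by (simp add: fourier_def inner_L2_sum_left L2_monomial)
lemma fourier_monomial: "fourier (monomial l) k = (if k = l then 1 else 0)"
  by (simp add: fourier_def inner_L2_def circ_conj_monomial monomial_mult circle_integral_monomial)
lemma fourier_conj: "fourier (circ_conj u) k = cnj (fourier u (-k))"
  by (simp add: fourier_def inner_L2_def circ_conj_monomial circ_conj_mult flip: circle_integral_conj)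
lemma fourier_monomial_mult: "fourier (monomial l * u) k = fourier u (k - l)"
proof -
  have "monomial l * u * monomial (-k) = u * (monomial l * monomial (-k))" by (simp only: mult_ac)
  also have "monomial l * monomial (-k) = monomial (-(k - l))" by (simp add: monomial_mult)
  finally show ?thesis
    by (simp add: fourier_def inner_L2_def circ_conj_monomial)
qed

text \<open>Integrability, rather than membership in \<open>L2\<close>, is the right hypothesis:
  \<open>L2_mult\<close> applies the criterion to a product whose square integrability is still to
  be shown.\<close>

lemma circ_eq_0I:
  assumes "integrable_circ u" "\<And>k. circle_integral (u * monomial k) = 0"
  shows "u = 0"
  using assms
proof transfer
  fix f :: "complex \<Rightarrow> complex"
  assume "integrable circle f" "\<And>k. (LINT z|circle. f z * z powi k) = 0"
    "f \<in> borel_measurable circle \<and> f \<in> borel_measurable circle \<and> (AE z in circle. f z = f z)"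
  then show "f \<in> borel_measurable circle \<and> (\<lambda>_. 0::complex) \<in> borel_measurable circle \<and> (AE z in circle. f z = 0)"
    using fourier_coeffs_0_imp_AE_0[of f] by simp
qed

lemma fourier_eq_0_imp:
  assumes "u \<in> L2" "\<And>k. fourier u k = 0"
  shows "u = 0"
proof (rule circ_eq_0I)
  show "integrable_circ u" using integrable_L2_mult[OF assms(1) L2_1] by simp
  show "circle_integral (u * monomial k) = 0" for k
    using assms(2)[of "- k"] by (simp add: fourier_def inner_L2_def circ_conj_monomial)
qed

lemma fourier_inject:
  assumes "u \<in> L2" "v \<in> L2" "\<And>k. fourier u k = fourier v k"
  shows "u = v"
  using fourier_eq_0_imp[of "u - v"] assms by (simp add: fourier_diff L2_diff)

section \<open>Parseval's identity and the coefficients of products\<close>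

lemma riesz_fischer_L2:
  assumes "(\<lambda>k. (cmod (a k))\<^sup>2) summable_on (UNIV :: int set)"
  shows "\<exists>u \<in> L2. (\<forall>k. fourier u k = a k) \<and> (norm_L2 u)\<^sup>2 \<le> (\<Sum>\<^sub>\<infinity>k. (cmod (a k))\<^sup>2)"
proof -
  have "\<exists>u. square_integrable u \<and> (\<forall>k. circle_integral (u * monomial (-k)) = a k)
      \<and> Re (circle_integral (u * circ_conj u)) \<le> (\<Sum>\<^sub>\<infinity>k. (cmod (a k))\<^sup>2)"
    using riesz_fischer[OF assms]
  proof transfer
    fix a :: "int \<Rightarrow> complex"
    assume "\<exists>g \<in> borel_measurable circle. integrable circle (\<lambda>z. (cmod (g z))\<^sup>2)
      \<and> (\<forall>k. (LINT z|circle. g z * z powi (-k)) = a k)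
      \<and> (LINT z|circle. (cmod (g z))\<^sup>2) \<le> (\<Sum>\<^sub>\<infinity>k. (cmod (a k))\<^sup>2)"
    then obtain g where g: "g \<in> borel_measurable circle" "integrable circle (\<lambda>z. (cmod (g z))\<^sup>2)"
      "\<forall>k. (LINT z|circle. g z * z powi (-k)) = a k" "(LINT z|circle. (cmod (g z))\<^sup>2) \<le> (\<Sum>\<^sub>\<infinity>k. (cmod (a k))\<^sup>2)"
      by blast
    have "(LINT z|circle. g z * cnj (g z)) = of_real (LINT z|circle. (cmod (g z))\<^sup>2)"
      by (simp add: complex_norm_square[symmetric] flip: integral_complex_of_real)
    with g show "\<exists>u\<in>{f. f \<in> borel_measurable circle \<and> f \<in> borel_measurable circle \<and> (AE z in circle. f z = f z)}.
      integrable circle (\<lambda>z. (cmod (u z))\<^sup>2) \<and> (\<forall>k. (LINT z|circle. u z * z powi (-k)) = a k)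
      \<and> Re (LINT z|circle. u z * cnj (u z)) \<le> (\<Sum>\<^sub>\<infinity>k. (cmod (a k))\<^sup>2)"
      by (intro bexI[of _ g]) auto
  qed
  then show ?thesis
    by (auto simp: L2_def fourier_def inner_L2_def circ_conj_monomial norm_L2_sq)
qed

text \<open>Pythagoras for the projection of \<open>u\<close> on the span of the monomials indexed
  by \<open>A\<close>; positivity of the left side is Bessel's inequality.\<close>

lemma bessel_defect:
  assumes u: "u \<in> L2" and A: "finite A"
  shows "Re (inner_L2 (u - (\<Sum>k\<in>A. const (fourier u k) * monomial k)) (u - (\<Sum>k\<in>A. const (fourier u k) * monomial k)))
    = (norm_L2 u)\<^sup>2 - (\<Sum>k\<in>A. (cmod (fourier u k))\<^sup>2)"
proof -
  define p where "p = (\<Sum>k\<in>A. const (fourier u k) * monomial k)"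
  have p: "p \<in> L2" unfolding p_def by (intro L2_sum L2_const_mult L2_monomial)
  have ip: "inner_L2 v p = (\<Sum>k\<in>A. cnj (fourier u k) * fourier v k)" if "v \<in> L2" for v
  proof -
    have "inner_L2 v p = cnj (\<Sum>k\<in>A. fourier u k * inner_L2 (monomial k) v)"
      using that unfolding p_def
      by (subst inner_L2_commute) (simp add: inner_L2_sum_left L2_const_mult L2_monomial inner_L2_const_left)
    then show ?thesis by (simp add: fourier_def inner_L2_commute[symmetric])
  qed
  have fp: "fourier p k = (if k \<in> A then fourier u k else 0)" for k
    unfolding p_def using A
    by (simp add: fourier_sum L2_const_mult L2_monomial fourier_const_mult fourier_monomial if_distrib cong: if_cong)
  have up: "inner_L2 u p = of_real (\<Sum>k\<in>A. (cmod (fourier u k))\<^sup>2)"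
    by (simp add: ip u mult.commute flip: complex_norm_square)
  have pp: "inner_L2 p p = of_real (\<Sum>k\<in>A. (cmod (fourier u k))\<^sup>2)"
    by (simp add: ip p fp mult.commute flip: complex_norm_square)
  have pu: "inner_L2 p u = of_real (\<Sum>k\<in>A. (cmod (fourier u k))\<^sup>2)"
    using inner_L2_commute[of p u] up by simp
  have "inner_L2 (u - p) (u - p) = inner_L2 u u - inner_L2 u p - inner_L2 p u + inner_L2 p p"
    using u p by (simp add: inner_L2_diff_left inner_L2_diff_right L2_diff)
  then show ?thesis unfolding p_def[symmetric] by (simp add: up pp pu norm_L2_sq)
qed

lemma bessel:
  assumes "u \<in> L2" "finite A"
  shows "(\<Sum>k\<in>A. (cmod (fourier u k))\<^sup>2) \<le> (norm_L2 u)\<^sup>2"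
proof -
  have "0 \<le> (norm_L2 u)\<^sup>2 - (\<Sum>k\<in>A. (cmod (fourier u k))\<^sup>2)"
    unfolding bessel_defect[OF assms, symmetric] using inner_L2_self_nonneg by blast
  then show ?thesis by simp
qed

lemma fourier_summable: "u \<in> L2 \<Longrightarrow> (\<lambda>k. (cmod (fourier u k))\<^sup>2) summable_on UNIV"
  by (rule nonneg_bdd_above_summable_on) (auto intro!: bdd_aboveI bessel)

text \<open>Riesz-Fischer produces \<open>v\<close> with the same coefficients and with the norm
  bound opposite to Bessel's; uniqueness of coefficients gives \<open>v = u\<close>. This takes the
  place of a density argument in \<open>L2\<close>.\<close>

lemma parseval: 
  assumes u: "u \<in> L2"
  shows "((\<lambda>k. (cmod (fourier u k))\<^sup>2) has_sum (norm_L2 u)\<^sup>2) UNIV"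
proof -
  obtain v where v: "v \<in> L2" "\<And>k. fourier v k = fourier u k" "(norm_L2 v)\<^sup>2 \<le> (\<Sum>\<^sub>\<infinity>k. (cmod (fourier u k))\<^sup>2)"
    using riesz_fischer_L2[OF fourier_summable[OF u]] by blast
  have "v = u" using fourier_inject[OF v(1) u v(2)] .
  moreover have "(\<Sum>\<^sub>\<infinity>k. (cmod (fourier u k))\<^sup>2) \<le> (norm_L2 u)\<^sup>2"
    by (rule infsum_le_finite_sums[OF fourier_summable[OF u]]) (simp add: bessel u)
  ultimately have "(\<Sum>\<^sub>\<infinity>k. (cmod (fourier u k))\<^sup>2) = (norm_L2 u)\<^sup>2" using v(3) by simp
  then show ?thesis using fourier_summable[OF u] by (metis has_sum_infsum)
qed

text \<open>Polarisation: the same formula expresses the inner product and each product of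
  coefficients through squares, so Parseval's identity can be summed term by term.\<close>

lemma parseval_inner:
  assumes u: "u \<in> L2" and v: "v \<in> L2"
  shows "((\<lambda>k. fourier u k * cnj (fourier v k)) has_sum inner_L2 u v) UNIV"
proof -
  define N :: "circfun \<Rightarrow> complex" where "N w = of_real ((norm_L2 w)\<^sup>2)" for w
  have N: "((\<lambda>k. complex_of_real ((cmod (fourier w k))\<^sup>2)) has_sum N w) UNIV" if "w \<in> L2" for w
    unfolding N_def by (rule has_sum_of_real[OF parseval[OF that]])
  have iv: "const \<i> * v \<in> L2" using v by (rule L2_const_mult)
  have Ni: "N (u + w) = N u + N w + inner_L2 u w + inner_L2 w u"
    "N (u - w) = N u + N w - inner_L2 u w - inner_L2 w u" if "w \<in> L2" for w
    using that u unfolding N_def inner_L2_self[symmetric]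
    by (simp_all add: inner_L2_add_left inner_L2_add_right
       inner_L2_diff_left inner_L2_diff_right L2_add L2_diff)
  have pol: "inner_L2 u v = (N (u + v) - N (u - v) + \<i> * N (u + const \<i> * v) - \<i> * N (u - const \<i> * v)) / 4"
    unfolding Ni[OF v] Ni[OF iv] inner_L2_const_left inner_L2_const_right by (simp add: algebra_simps)
  have polc: "a * cnj b = (of_real ((cmod (a + b))\<^sup>2) - of_real ((cmod (a - b))\<^sup>2)
     + \<i> * of_real ((cmod (a + \<i> * b))\<^sup>2) - \<i> * of_real ((cmod (a - \<i> * b))\<^sup>2)) / 4" for a b
    by (simp only: complex_norm_square) (simp add: algebra_simps)
  have "((\<lambda>k. (of_real ((cmod (fourier (u + v) k))\<^sup>2) - of_real ((cmod (fourier (u - v) k))\<^sup>2)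
     + \<i> * of_real ((cmod (fourier (u + const \<i> * v) k))\<^sup>2) - \<i> * of_real ((cmod (fourier (u - const \<i> * v) k))\<^sup>2)) / 4)
     has_sum inner_L2 u v) UNIV"
    unfolding pol divide_inverse
    by (intro has_sum_cmult_left has_sum_diff_complex has_sum_add has_sum_cmult_right N L2_add L2_diff u v iv)
  then show ?thesis
    by (subst polc) (simp add: fourier_add fourier_diff fourier_const_mult u v iv)
qed

text \<open>The coefficient of index \<open>k\<close> is the inner product of \<open>u\<close> with
  \<open>monomial k * circ_conj v\<close>, whose coefficient of index \<open>l\<close> is the
  conjugate of \<open>fourier v (k - l)\<close>.\<close>

lemma fourier_mult:
  assumes u: "u \<in> L2" and v: "v \<in> L2"
  shows "((\<lambda>l. fourier u l * fourier v (k - l)) has_sum fourier (u * v) k) UNIV"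
proof -
  have w: "monomial k * circ_conj v \<in> L2" by (intro L2_monomial_mult L2_conj v)
  have "inner_L2 u (monomial k * circ_conj v) = fourier (u * v) k"
    by (simp add: fourier_def inner_L2_def circ_conj_mult mult_ac)
  with parseval_inner[OF u w] show ?thesis
    by (simp add: fourier_monomial_mult fourier_conj)
qed

section \<open>The Szego projector in terms of Fourier coefficients\<close>

lemma L2_plus_iff: "u \<in> L2_plus \<longleftrightarrow> u \<in> L2 \<and> (\<forall>k<0. fourier u k = 0)"
  by (auto simp: plus_part_def)

text \<open>Resolves the definite description in \<open>szego\<close>: orthogonality to all of
  \<open>L2_plus\<close> is tested on monomials of nonnegative index, which fixes the coefficients
  of every candidate.\<close>

lemma szego_eqI:
  assumes f: "f \<in> L2" and g: "g \<in> L2_plus" and fg: "\<And>k. k \<ge> 0 \<Longrightarrow> fourier f k = fourier g k"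
  shows "szego f = g"
  unfolding szego_def
proof (rule the_equality)
  have gL: "g \<in> L2" using g by (simp add: L2_plus_iff)
  have "inner_L2 (f - g) h = 0" if h: "h \<in> L2_plus" for h
  proof -
    have hL: "h \<in> L2" using h by (simp add: L2_plus_iff)
    have "fourier (f - g) k * cnj (fourier h k) = 0" for k
      using h fg by (cases "k \<ge> 0") (auto simp: L2_plus_iff fourier_diff f gL)
    then have "((\<lambda>k::int. 0) has_sum inner_L2 (f - g) h) UNIV"
      using parseval_inner[OF L2_diff[OF f gL] hL] by presburger
    then show ?thesis by (rule has_sum_unique) simp
  qed
  with g show "g \<in> L2_plus \<and> (\<forall>h\<in>L2_plus. inner_L2 (f - g) h = 0)" by blast
  fix g' assume g': "g' \<in> L2_plus \<and> (\<forall>h\<in>L2_plus. inner_L2 (f - g') h = 0)"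
  then have g'L: "g' \<in> L2" by (simp add: L2_plus_iff)
  have "fourier f k = fourier g' k" if "k \<ge> 0" for k
  proof -
    have "monomial k \<in> L2_plus" using that by (auto simp: L2_plus_iff L2_monomial fourier_monomial)
    then have "fourier (f - g') k = 0" using g' by (simp add: fourier_def)
    then show ?thesis by (simp add: fourier_diff f g'L)
  qed
  then show "g' = g" using fg g g'
    by (intro fourier_inject g'L gL) (metis L2_plus_iff not_le)
qed

lemma L2_plus_exists:
  assumes "(\<lambda>k. (cmod (a k))\<^sup>2) summable_on (UNIV :: nat set)"
  shows "\<exists>u\<in>L2_plus. \<forall>k. fourier u (int k) = a k"
proof -
  define b where "b k = (if k \<ge> 0 then a (nat k) else 0)" for k :: int
  have "(\<lambda>k. (cmod (b k))\<^sup>2) summable_on (int ` UNIV)"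
    by (subst summable_on_reindex) (use assms in \<open>auto simp: b_def o_def\<close>)
  then have "(\<lambda>k. (cmod (b k))\<^sup>2) summable_on UNIV"
    by (rule summable_on_cong_neutral[THEN iffD1, rotated -1])
       (auto simp: b_def image_iff intro: nonneg_int_cases)
  from riesz_fischer_L2[OF this] obtain u where "u \<in> L2" "\<And>k. fourier u k = b k" by blast
  then show ?thesis by (intro bexI[of _ u]) (auto simp: L2_plus_iff b_def)
qed

lemma fourier_nat_summable:
  assumes "u \<in> L2" shows "(\<lambda>k. (cmod (fourier u (int k)))\<^sup>2) summable_on (UNIV :: nat set)"
proof -
  have "(\<lambda>k. (cmod (fourier u k))\<^sup>2) summable_on (int ` UNIV)"
    by (rule summable_on_subset[OF fourier_summable[OF assms]]) auto
  then show ?thesis by (subst (asm) summable_on_reindex) (auto simp: o_def)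
qed

text \<open>Existence behind the definite description: the coefficients of nonnegative index remain
  square summable, so Riesz-Fischer gives the projection.\<close>

lemma szego_in: "f \<in> L2 \<Longrightarrow> szego f \<in> L2_plus"
  and fourier_szego: "f \<in> L2 \<Longrightarrow> k \<ge> 0 \<Longrightarrow> fourier (szego f) k = fourier f k"
proof -
  assume f: "f \<in> L2"
  obtain g where g: "g \<in> L2_plus" "\<And>k. fourier g (int k) = fourier f (int k)"
    using L2_plus_exists[OF fourier_nat_summable[OF f]] by blast
  have fg: "fourier f k = fourier g k" if "k \<ge> 0" for k
    using g(2)[of "nat k"] that by simp
  have "szego f = g" using f g(1) fg by (rule szego_eqI)
  then show "szego f \<in> L2_plus" "k \<ge> 0 \<Longrightarrow> fourier (szego f) k = fourier f k" using g fg by auto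
qed

section \<open>Ordinary differential equations in Banach spaces\<close>

lemma antiderivative_ex:
  fixes f :: "real \<Rightarrow> 'a::banach"
  assumes f: "continuous_on UNIV f"
  shows "\<exists>\<Phi>. \<Phi> 0 = 0 \<and> (\<forall>t. (\<Phi> has_vector_derivative f t) (at t))"
proof -
  define \<Phi> where "\<Phi> t = (if t \<ge> 0 then integral {0..t} f else - integral {t..0} f)" for t
  have int: "f integrable_on {a..b}" for a b
    by (rule integrable_continuous_interval) (rule continuous_on_subset[OF f], simp)
  \<comment> \<open>On each symmetric interval the two-sided primitive differs by a constant from
    one integral with fixed lower limit, so differentiability at 0 needs no separate
    treatment.\<close>
  have eq: "\<Phi> t = integral {-T..t} f - integral {-T..0} f" if "t \<in> {-T<..<T}" for t T
  proof (cases "t \<ge> 0")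
    case True
    then show ?thesis using that Henstock_Kurzweil_Integration.integral_combine[OF _ _ int, of "-T" 0 t]
      by (auto simp: \<Phi>_def algebra_simps)
  next
    case False
    then show ?thesis using that Henstock_Kurzweil_Integration.integral_combine[OF _ _ int, of "-T" t 0]
      by (auto simp: \<Phi>_def algebra_simps)
  qed
  have "(\<Phi> has_vector_derivative f t) (at t)" for t
  proof -
    define T where "T = \<bar>t\<bar> + 1"
    have t: "t \<in> {-T<..<T}" by (auto simp: T_def)
    have "((\<lambda>u. integral {-T..u} f) has_vector_derivative f t) (at t within {-T..T})"
      by (rule integral_has_vector_derivative) (use t in \<open>auto intro: continuous_on_subset[OF f]\<close>)
    moreover have "at t within {-T..T} = at t"
      using t by (intro at_within_interior) auto
    ultimately have "((\<lambda>u. integral {-T..u} f - integral {-T..0} f) has_vector_derivative f t - 0) (at t)"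
      by (intro has_vector_derivative_diff has_vector_derivative_const) simp
    then have d: "((\<lambda>u. integral {-T..u} f - integral {-T..0} f) has_vector_derivative f t) (at t)" by simp
    show ?thesis
      by (rule has_vector_derivative_transform_within_open[OF d open_greaterThanLessThan t]) (rule eq[symmetric])
  qed
  then show ?thesis by (intro exI[of _ \<Phi>]) (simp add: \<Phi>_def)
qed

lemma has_vector_derivative_affine:
  fixes f :: "real \<Rightarrow> 'a::real_normed_vector"
  assumes "(f has_vector_derivative d) (at (c * s + b))"
  shows "((\<lambda>s. f (c * s + b)) has_vector_derivative c *\<^sub>R d) (at s)"
proof -
  have "((\<lambda>s. c * s + b) has_vector_derivative c) (at s)"
    unfolding has_real_derivative_iff_has_vector_derivative[symmetric]
    by (auto intro!: derivative_eq_intros)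
  from vector_diff_chain_at[OF this assms] show ?thesis by (simp add: o_def)
qed

text \<open>One Picard step: integration raises the power and divides by \<open>k + 1\<close>, which
  is how the factorials arise. Negative times are reduced to positive ones by reflection.\<close>

lemma norm_power_antiderivative_bound:
  fixes \<Phi> :: "real \<Rightarrow> 'a::real_normed_vector"
  assumes der: "\<And>t. (\<Phi> has_vector_derivative f t) (at t)" and z: "\<Phi> 0 = 0"
    and bd: "\<And>s. \<bar>s\<bar> \<le> T \<Longrightarrow> norm (f s) \<le> K * \<bar>s\<bar> ^ k" and t: "\<bar>t\<bar> \<le> T"
  shows "norm (\<Phi> t) \<le> K * \<bar>t\<bar> ^ Suc k / real (Suc k)"
proof -
  have pos: "norm (\<Psi> b) \<le> K * b ^ Suc k / real (Suc k)"
    if der: "\<And>t. (\<Psi> has_vector_derivative g t) (at t)" and z: "\<Psi> 0 = 0"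
      and bd: "\<And>s. 0 \<le> s \<Longrightarrow> s \<le> T \<Longrightarrow> norm (g s) \<le> K * s ^ k" and b: "0 \<le> b" "b \<le> T"
    for \<Psi> :: "real \<Rightarrow> 'a" and g b
  proof (cases "b = 0")
    case False
    have d: "((\<lambda>s. K * s ^ Suc k / real (Suc k)) has_vector_derivative K * s ^ k) (at s)" for s
      using DERIV_cmult[OF DERIV_pow[of "Suc k" s UNIV], of "K / real (Suc k)"]
      unfolding has_real_derivative_iff_has_vector_derivative[symmetric]
      by (simp del: of_nat_Suc)
    have "norm (\<Psi> b - \<Psi> 0) \<le> K * b ^ Suc k / real (Suc k) - K * 0 ^ Suc k / real (Suc k)"
    proof (rule differentiable_bound_general[where f' = g and \<phi>' = "\<lambda>s. K * s ^ k"])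
      show "continuous_on {0..b} \<Psi>"
        by (intro continuous_at_imp_continuous_on ballI has_vector_derivative_continuous[OF der])
      show "continuous_on {0..b} (\<lambda>s. K * s ^ Suc k / real (Suc k))"
        by (intro continuous_intros) auto
    qed (use False b bd der d in auto)
    then show ?thesis by (simp add: z)
  qed (simp add: z)
  show ?thesis
  proof (cases "t \<ge> 0")
    case True
    have "norm (f s) \<le> K * s ^ k" if "0 \<le> s" "s \<le> T" for s using bd[of s] that by simp
    with pos[of \<Phi> f t] True der z t show ?thesis by auto
  next
    case False
    have "((\<lambda>s. \<Phi> (-s)) has_vector_derivative - f (-s)) (at s)" for s
      using has_vector_derivative_affine[of \<Phi> "f (-s)" "-1" s 0] der[of "-s"] by simp
    moreover have "norm (- f (-s)) \<le> K * s ^ k" if "0 \<le> s" "s \<le> T" for s using bd[of "-s"] that by simp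
    ultimately have "norm (\<Phi> (- (- t))) \<le> K * (- t) ^ Suc k / real (Suc k)"
      using False z t by (intro pos[of "\<lambda>s. \<Phi> (-s)" "\<lambda>s. - f (-s)"]) auto
    then show ?thesis using False by simp
  qed
qed

text \<open>The Lipschitz constant may depend on the time interval but not on the state, so the
  Picard iterates converge on the whole line, uniformly on compact intervals, by comparison with the
  exponential series.\<close>

theorem ode_global_solution_0:
  fixes F :: "real \<Rightarrow> 'a::banach \<Rightarrow> 'a"
  assumes cont: "continuous_on UNIV (\<lambda>(t,x). F t x)"
    and lip: "\<And>T. \<exists>L. \<forall>t. \<bar>t\<bar> \<le> T \<longrightarrow> (\<forall>x y. norm (F t x - F t y) \<le> L * norm (x - y))"
  shows "\<exists>u. u 0 = x0 \<and> (\<forall>t. (u has_vector_derivative F t (u t)) (at t))"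
proof -
  have contF: "continuous_on UNIV (\<lambda>s. F s (v s))" if "continuous_on UNIV v" for v
    using continuous_on_compose2[OF cont, of UNIV "\<lambda>s. (s, v s)"] that
    by (simp add: continuous_on_Pair continuous_on_id)
  \<comment> \<open>A chosen primitive makes the integral operator a total function through which
    the iteration can recurse.\<close>
  define AD where "AD f = (SOME \<Phi>. \<Phi> 0 = 0 \<and> (\<forall>t. (\<Phi> has_vector_derivative f t) (at t)))" for f :: "real \<Rightarrow> 'a"
  have AD: "AD f 0 = 0" "\<And>t. (AD f has_vector_derivative f t) (at t)" if "continuous_on UNIV f" for f
  proof -
    have "AD f 0 = 0 \<and> (\<forall>t. (AD f has_vector_derivative f t) (at t))"
      unfolding AD_def by (rule someI_ex[OF antiderivative_ex[OF that]])
    then show "AD f 0 = 0" "\<And>t. (AD f has_vector_derivative f t) (at t)" by auto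
  qed
  define u where "u = rec_nat (\<lambda>t. x0) (\<lambda>k v t. x0 + AD (\<lambda>s. F s (v s)) t)"
  have u0: "u 0 = (\<lambda>t. x0)" and uS: "u (Suc k) = (\<lambda>t. x0 + AD (\<lambda>s. F s (u k s)) t)" for k
    by (simp_all add: u_def)
  have cADx: "continuous_on UNIV (\<lambda>t. x0 + AD f t)" if "continuous_on UNIV f" for f
    by (rule continuous_on_add[OF continuous_on_const],
        intro continuous_at_imp_continuous_on ballI has_vector_derivative_continuous[OF AD(2)[OF that]])
  have uc: "continuous_on UNIV (u k)" for k
  proof (induction k)
    case (Suc k)
    show ?case unfolding uS by (rule cADx[OF contF[OF Suc]])
  qed (simp add: u0)
  have diff_bd: "norm (x0 + AD (\<lambda>s. F s (v s)) t - (x0 + AD (\<lambda>s. F s (w s)) t)) \<le> L * K * \<bar>t\<bar> ^ Suc k / real (Suc k)"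
    if L: "\<And>t x y. \<bar>t\<bar> \<le> T \<Longrightarrow> norm (F t x - F t y) \<le> L * norm (x - y)" "L \<ge> 0"
      and v: "continuous_on UNIV v" and w: "continuous_on UNIV w"
      and vw: "\<And>s. \<bar>s\<bar> \<le> T \<Longrightarrow> norm (v s - w s) \<le> K * \<bar>s\<bar> ^ k" and t: "\<bar>t\<bar> \<le> T"
    for L T v w K k t
  proof -
    have "norm (AD (\<lambda>s. F s (v s)) t - AD (\<lambda>s. F s (w s)) t) \<le> L * K * \<bar>t\<bar> ^ Suc k / real (Suc k)"
    proof (rule norm_power_antiderivative_bound[where f = "\<lambda>s. F s (v s) - F s (w s)" and T = T])
      show "((\<lambda>t. AD (\<lambda>s. F s (v s)) t - AD (\<lambda>s. F s (w s)) t) has_vector_derivative F t (v t) - F t (w t)) (at t)" for t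
        by (intro has_vector_derivative_diff AD(2) contF v w)
      show "norm (F s (v s) - F s (w s)) \<le> L * K * \<bar>s\<bar> ^ k" if s: "\<bar>s\<bar> \<le> T" for s
      proof -
        have "norm (F s (v s) - F s (w s)) \<le> L * norm (v s - w s)" using L(1)[OF s] .
        also have "\<dots> \<le> L * (K * \<bar>s\<bar> ^ k)" by (intro mult_left_mono vw s L)
        finally show ?thesis by simp
      qed
    qed (use t AD(1)[OF contF[OF v]] AD(1)[OF contF[OF w]] in auto)
    then show ?thesis by simp
  qed
  have ulim: "\<exists>B. summable B \<and> (\<forall>k t. \<bar>t\<bar> \<le> T \<longrightarrow> norm (u (Suc k) t - u k t) \<le> B k)" for T
  proof -
    obtain L' where L': "\<And>t x y. \<bar>t\<bar> \<le> T \<Longrightarrow> norm (F t x - F t y) \<le> L' * norm (x - y)"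
      using lip[of T] by blast
    define L where "L = \<bar>L'\<bar>"
    have L: "norm (F t x - F t y) \<le> L * norm (x - y)" if "\<bar>t\<bar> \<le> T" for t x y
      using L'[OF that, of x y] mult_right_mono[OF abs_ge_self[of L'] norm_ge_zero[of "x - y"]]
      unfolding L_def by linarith
    have L0: "L \<ge> 0" by (simp add: L_def)
    have "bounded ((\<lambda>s. F s x0) ` {-T..T})"
      by (intro compact_imp_bounded compact_continuous_image continuous_on_subset[OF contF[of "\<lambda>_. x0"]]) auto
    then obtain M where M: "\<forall>x\<in>(\<lambda>s. F s x0) ` {-T..T}. norm x \<le> M"
      unfolding bounded_iff by blast
    have M: "norm (F s x0) \<le> M" if "\<bar>s\<bar> \<le> T" for s using M that by (simp add: abs_le_iff)
    have bd: "norm (u (Suc k) t - u k t) \<le> M * L ^ k / fact (Suc k) * \<bar>t\<bar> ^ Suc k" if "\<bar>t\<bar> \<le> T" for k t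
      using that
    proof (induction k arbitrary: t)
      case 0
      have c0: "continuous_on UNIV (\<lambda>s. F s x0)" by (intro contF continuous_intros)
      have "norm (AD (\<lambda>s. F s x0) t) \<le> M * \<bar>t\<bar> ^ Suc 0 / real (Suc 0)"
        by (rule norm_power_antiderivative_bound[OF AD(2)[OF c0] AD(1)[OF c0], of T]) (use M 0 in auto)
      then show ?case by (simp add: u0 uS)
    next
      case (Suc k)
      have "norm (u (Suc (Suc k)) t - u (Suc k) t) \<le> L * (M * L ^ k / fact (Suc k)) * \<bar>t\<bar> ^ Suc (Suc k) / real (Suc (Suc k))"
        using diff_bd[OF L L0 uc[of "Suc k"] uc[of k] Suc.IH Suc.prems] unfolding uS[of "Suc k"] uS[of k] by blast
      also have "\<dots> = M * L ^ Suc k / fact (Suc (Suc k)) * \<bar>t\<bar> ^ Suc (Suc k)"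
        by (simp add: field_simps)
      finally show ?case .
    qed
    define B where "B k = \<bar>M\<bar> * L ^ k / fact (Suc k) * \<bar>T\<bar> ^ Suc k" for k
    have "summable (\<lambda>k. (\<bar>M\<bar> * \<bar>T\<bar>) * ((L * \<bar>T\<bar>) ^ k / fact k))"
      by (intro summable_mult) (use summable_exp[of "L * \<bar>T\<bar>"] in \<open>simp add: divide_inverse mult.commute\<close>)
    moreover have "norm (B k) \<le> (\<bar>M\<bar> * \<bar>T\<bar>) * ((L * \<bar>T\<bar>) ^ k / fact k)" for k
    proof -
      have "B k = (\<bar>M\<bar> * \<bar>T\<bar>) * ((L * \<bar>T\<bar>) ^ k / fact (Suc k))"
        by (simp add: B_def power_mult_distrib)
      also have "\<dots> \<le> (\<bar>M\<bar> * \<bar>T\<bar>) * ((L * \<bar>T\<bar>) ^ k / fact k)"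
        using L0 by (intro mult_left_mono divide_left_mono) (auto intro!: fact_mono)
      finally show ?thesis using L0 by (simp add: B_def)
    qed
    ultimately have "summable B" by (intro summable_comparison_test'[of _ 0 B]) auto
    moreover have "norm (u (Suc k) t - u k t) \<le> B k" if t: "\<bar>t\<bar> \<le> T" for k t
    proof -
      have "norm (u (Suc k) t - u k t) \<le> M * L ^ k / fact (Suc k) * \<bar>t\<bar> ^ Suc k" by (rule bd[OF t])
      also have "\<dots> \<le> \<bar>M\<bar> * L ^ k / fact (Suc k) * \<bar>T\<bar> ^ Suc k"
        using L0 t by (intro mult_mono divide_right_mono mult_right_mono power_mono) auto
      finally show ?thesis by (simp add: B_def)
    qed
    ultimately show ?thesis by blast
  qed
  define U where "U t = x0 + (\<Sum>k. u (Suc k) t - u k t)" for t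
  have tele: "u n t = x0 + (\<Sum>k<n. u (Suc k) t - u k t)" for n t
    using sum_lessThan_telescope[of "\<lambda>k. u k t" n] by (simp add: u0)
  have unif: "uniform_limit {-T..T} u U sequentially" for T
  proof -
    obtain B where B: "summable B" "\<And>k t. \<bar>t\<bar> \<le> T \<Longrightarrow> norm (u (Suc k) t - u k t) \<le> B k"
      using ulim[of T] by blast
    have "uniform_limit {-T..T} (\<lambda>n t. \<Sum>k<n. u (Suc k) t - u k t) (\<lambda>t. \<Sum>k. u (Suc k) t - u k t) sequentially"
      by (rule Weierstrass_m_test[OF _ B(1)]) (use B(2) in auto)
    then have "uniform_limit {-T..T} (\<lambda>n t. x0 + (\<Sum>k<n. u (Suc k) t - u k t)) U sequentially"
      unfolding U_def by (intro uniform_limit_intros)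
    then show ?thesis by (simp add: tele[symmetric])
  qed
  have Uc: "continuous_on UNIV U"
  proof (rule continuous_at_imp_continuous_on, rule ballI)
    fix t :: real
    have "continuous_on {-(\<bar>t\<bar>+1)..\<bar>t\<bar>+1} U"
      by (rule uniform_limit_theorem[OF _ unif]) (auto intro!: always_eventually continuous_on_subset[OF uc])
    then have "continuous_on {-(\<bar>t\<bar>+1)<..<\<bar>t\<bar>+1} U"
      by (rule continuous_on_subset) auto
    then show "isCont U t" by (rule continuous_on_interior) auto
  qed
  \<comment> \<open>One more Picard step, applied to the limit. The iterates converge to
    \<open>V\<close> as well as to \<open>U\<close>, so the two agree and \<open>U\<close> inherits
    the derivative of \<open>V\<close>.\<close>
  define V where "V t = x0 + AD (\<lambda>s. F s (U s)) t" for t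
  have "V t = U t" for t
  proof -
    obtain L' where L': "\<And>s x y. \<bar>s\<bar> \<le> \<bar>t\<bar> \<Longrightarrow> norm (F s x - F s y) \<le> L' * norm (x - y)"
      using lip[of "\<bar>t\<bar>"] by blast
    define L where "L = \<bar>L'\<bar>"
    have L: "norm (F s x - F s y) \<le> L * norm (x - y)" if "\<bar>s\<bar> \<le> \<bar>t\<bar>" for s x y
      using L'[OF that, of x y] mult_right_mono[OF abs_ge_self[of L'] norm_ge_zero[of "x - y"]]
      unfolding L_def by linarith
    have L0: "L \<ge> 0" by (simp add: L_def)
    have "(\<lambda>n. u (Suc n) t) \<longlonglongrightarrow> V t"
    proof (rule tendstoI)
      fix e :: real assume e: "e > 0"
      define d where "d = e / (L * \<bar>t\<bar> + 1)"
      have d: "d > 0" using e L0 by (auto simp: d_def intro!: divide_pos_pos add_nonneg_pos)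
      have "\<forall>\<^sub>F n in sequentially. \<forall>s\<in>{-\<bar>t\<bar>..\<bar>t\<bar>}. dist (u n s) (U s) < d"
        using unif[of "\<bar>t\<bar>"] d by (simp add: uniform_limit_iff)
      then show "\<forall>\<^sub>F n in sequentially. dist (u (Suc n) t) (V t) < e"
      proof eventually_elim
        case (elim n)
        have "norm (x0 + AD (\<lambda>s. F s (u n s)) t - (x0 + AD (\<lambda>s. F s (U s)) t)) \<le> L * d * \<bar>t\<bar> ^ Suc 0 / real (Suc 0)"
        proof (rule diff_bd[OF L L0 uc Uc])
          fix s assume "\<bar>s\<bar> \<le> \<bar>t\<bar>"
          then have "s \<in> {-\<bar>t\<bar>..\<bar>t\<bar>}" by auto
          then show "norm (u n s - U s) \<le> d * \<bar>s\<bar> ^ 0" using elim by (auto simp: dist_norm intro: less_imp_le)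
        qed simp_all
        also have "\<dots> < (L * \<bar>t\<bar> + 1) * d" using d by (simp add: algebra_simps)
        also have "\<dots> = e"
        proof -
          have "L * \<bar>t\<bar> + 1 \<noteq> 0" using mult_nonneg_nonneg[OF L0, of "\<bar>t\<bar>"] by auto
          then show ?thesis by (simp add: d_def)
        qed
        finally show ?case by (simp add: dist_norm uS V_def)
      qed
    qed
    moreover have "(\<lambda>n. u (Suc n) t) \<longlonglongrightarrow> U t"
      by (rule LIMSEQ_Suc) (rule tendsto_uniform_limitI[OF unif[of "\<bar>t\<bar>"]], auto)
    ultimately show ?thesis by (rule LIMSEQ_unique)
  qed
  then have VU: "V = U" by blast
  have "(V has_vector_derivative 0 + F t (U t)) (at t)" for t
    unfolding V_def by (intro has_vector_derivative_add has_vector_derivative_const AD(2) contF Uc)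
  moreover have "V 0 = x0" using AD(1)[OF contF[OF Uc]] by (simp add: V_def)
  ultimately show ?thesis unfolding VU by auto
qed

text \<open>Translation in time. The freedom in the initial time matters for the orthonormal
  families, which are prescribed at an arbitrary time and read off at 0.\<close>

theorem ode_global_solution:
  fixes F :: "real \<Rightarrow> 'a::banach \<Rightarrow> 'a"
  assumes cont: "continuous_on UNIV (\<lambda>(t,x). F t x)"
    and lip: "\<And>T. \<exists>L. \<forall>t. \<bar>t\<bar> \<le> T \<longrightarrow> (\<forall>x y. norm (F t x - F t y) \<le> L * norm (x - y))"
  shows "\<exists>u. u t0 = x0 \<and> (\<forall>t. (u has_vector_derivative F t (u t)) (at t))"
proof -
  define G where "G t = F (t + t0)" for t
  have "continuous_on UNIV (\<lambda>p. F (fst p + t0) (snd p))"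
    using continuous_on_compose2[OF cont, of UNIV "\<lambda>p. (fst p + t0, snd p)"]
    by (simp add: continuous_on_Pair continuous_on_fst continuous_on_snd continuous_on_add continuous_on_const)
  then have "continuous_on UNIV (\<lambda>(t,x). G t x)" by (simp add: G_def case_prod_beta)
  moreover have "\<exists>L. \<forall>t. \<bar>t\<bar> \<le> T \<longrightarrow> (\<forall>x y. norm (G t x - G t y) \<le> L * norm (x - y))" for T
  proof -
    obtain L where L: "\<forall>t. \<bar>t\<bar> \<le> T + \<bar>t0\<bar> \<longrightarrow> (\<forall>x y. norm (F t x - F t y) \<le> L * norm (x - y))"
      using lip by blast
    show ?thesis by (intro exI[of _ L] allI impI, unfold G_def, rule L[rule_format]) linarith
  qed
  ultimately obtain v where v: "v 0 = x0" "\<And>t. (v has_vector_derivative G t (v t)) (at t)"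
    using ode_global_solution_0[of G x0] by blast
  have "((\<lambda>t. v (t - t0)) has_vector_derivative F t (v (t - t0))) (at t)" for t
    using has_vector_derivative_affine[of v "G (t - t0) (v (t - t0))" 1 t "- t0"] v(2)[of "t - t0"]
    by (simp add: G_def)
  then show ?thesis using v(1) by (intro exI[of _ "\<lambda>t. v (t - t0)"]) simp
qed

text \<open>For nonnegative times \<open>exp (- 2 * C * t) * (v t \<bullet> v t)\<close> is
  nonincreasing. Working with the squared norm avoids the lack of differentiability of the norm at
  0; negative times follow by reflection.\<close>

lemma gronwall_norm:
  fixes w :: "real \<Rightarrow> 'a::real_inner"
  assumes der: "\<And>t. \<bar>t\<bar> \<le> T \<Longrightarrow> (w has_vector_derivative w' t) (at t)"
    and bd: "\<And>t. \<bar>t\<bar> \<le> T \<Longrightarrow> norm (w' t) \<le> C * norm (w t)" and t: "\<bar>t\<bar> \<le> T"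
  shows "norm (w t) \<le> norm (w 0) * exp (C * \<bar>t\<bar>)"
proof -
  have pos: "norm (v b) \<le> norm (v 0) * exp (C * b)"
    if der: "\<And>t. \<bar>t\<bar> \<le> T \<Longrightarrow> (v has_vector_derivative v' t) (at t)"
      and bd: "\<And>t. \<bar>t\<bar> \<le> T \<Longrightarrow> norm (v' t) \<le> C * norm (v t)" and b: "0 \<le> b" "b \<le> T"
    for v v' :: "real \<Rightarrow> 'a" and b
  proof -
    define g where "g t = exp (- 2 * C * t) * (v t \<bullet> v t)" for t
    have "g b \<le> g 0"
    proof (rule DERIV_nonpos_imp_nonincreasing[OF b(1)])
      fix x assume x: "0 \<le> x" "x \<le> b"
      then have xT: "\<bar>x\<bar> \<le> T" using b by auto
      have "((\<lambda>t. v t \<bullet> v t) has_vector_derivative (v x \<bullet> v' x + v' x \<bullet> v x)) (at x)"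
        by (rule bounded_bilinear.has_vector_derivative[OF bounded_bilinear_inner der[OF xT] der[OF xT]])
      then have "((\<lambda>t. v t \<bullet> v t) has_real_derivative (2 * (v x \<bullet> v' x))) (at x)"
        by (simp add: has_real_derivative_iff_has_vector_derivative inner_commute)
      then have "(g has_real_derivative (exp (- 2 * C * x) * (2 * (v x \<bullet> v' x)) + (- 2 * C) * exp (- 2 * C * x) * (v x \<bullet> v x))) (at x)"
        unfolding g_def by (auto intro!: derivative_eq_intros)
      moreover have "exp (- 2 * C * x) * (2 * (v x \<bullet> v' x)) + (- 2 * C) * exp (- 2 * C * x) * (v x \<bullet> v x) \<le> 0"
      proof -
        have "v x \<bullet> v' x \<le> norm (v x) * norm (v' x)" by (rule norm_cauchy_schwarz)
        also have "\<dots> \<le> norm (v x) * (C * norm (v x))" by (intro mult_left_mono bd xT) auto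
        also have "\<dots> = C * (v x \<bullet> v x)" by (simp add: power2_norm_eq_inner[symmetric] power2_eq_square)
        finally have "exp (- 2 * C * x) * (2 * (v x \<bullet> v' x)) \<le> exp (- 2 * C * x) * (2 * (C * (v x \<bullet> v x)))"
          by (intro mult_left_mono) auto
        then show ?thesis by (simp add: algebra_simps)
      qed
      ultimately show "\<exists>y. (g has_real_derivative y) (at x) \<and> y \<le> 0" by blast
    qed
    then have "exp (- 2 * C * b) * (norm (v b))\<^sup>2 \<le> (norm (v 0))\<^sup>2"
      by (simp add: g_def power2_norm_eq_inner)
    then have "exp (2 * C * b) * (exp (- 2 * C * b) * (norm (v b))\<^sup>2) \<le> exp (2 * C * b) * (norm (v 0))\<^sup>2"
      by (intro mult_left_mono) auto
    then have "(norm (v b))\<^sup>2 \<le> (norm (v 0) * exp (C * b))\<^sup>2"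
      by (simp add: power_mult_distrib exp_minus mult.assoc[symmetric] flip: exp_double exp_add) 
         (simp add: mult_ac)
    then show ?thesis by (rule power2_le_imp_le) simp
  qed
  show ?thesis
  proof (cases "t \<ge> 0")
    case True
    then show ?thesis using pos[OF der bd, of t] t by auto
  next
    case False
    have "((\<lambda>s. w (-s)) has_vector_derivative - w' (-s)) (at s)" if "\<bar>s\<bar> \<le> T" for s
      using has_vector_derivative_affine[of w "w' (-s)" "-1" s 0] der[of "-s"] that by simp
    moreover have "norm (- w' (-s)) \<le> C * norm (w (-s))" if "\<bar>s\<bar> \<le> T" for s using bd[of "-s"] that by simp
    ultimately have "norm (w (- (- t))) \<le> norm (w (- 0)) * exp (C * (- t))"
      using False t by (intro pos[of "\<lambda>s. w (-s)" "\<lambda>s. - w' (-s)"]) auto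
    then show ?thesis using False by simp
  qed
qed

section \<open>The Hilbert space of square summable sequences\<close>

definition l2 :: "(nat \<Rightarrow> complex) \<Rightarrow> bool" where
  "l2 a \<longleftrightarrow> (\<lambda>k. (cmod (a k))\<^sup>2) summable_on UNIV"

lemma l2I: "(\<And>F. finite F \<Longrightarrow> (\<Sum>k\<in>F. (cmod (a k))\<^sup>2) \<le> M) \<Longrightarrow> l2 a"
  unfolding l2_def by (rule nonneg_bdd_above_summable_on) (auto intro!: bdd_aboveI)

lemma l2_0: "l2 (\<lambda>_. 0)" by (simp add: l2_def)

lemma l2_dominated: "l2 b \<Longrightarrow> (\<And>k. cmod (a k) \<le> cmod (b k)) \<Longrightarrow> l2 a"
  unfolding l2_def by (rule summable_on_comparison_test[where g = "\<lambda>k. (cmod (a k))\<^sup>2"]) (auto intro: power_mono)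

lemma l2_mult_abs_summable: "l2 a \<Longrightarrow> l2 b \<Longrightarrow> (\<lambda>k. a k * b k) abs_summable_on UNIV"
  by (rule abs_summable_product) (simp_all add: l2_def norm_mult power2_eq_square)

lemma l2_norm: "l2 a \<Longrightarrow> l2 (\<lambda>k. of_real (cmod (a k)))" by (simp add: l2_def)
lemma l2_cnj: "l2 a \<Longrightarrow> l2 (\<lambda>k. cnj (a k))" by (simp add: l2_def)
lemma l2_cmult: "l2 a \<Longrightarrow> l2 (\<lambda>k. c * a k)"
  unfolding l2_def norm_mult power_mult_distrib by (rule summable_on_cmult_right)

lemma l2_add: assumes "l2 a" "l2 b" shows "l2 (\<lambda>k. a k + b k)"
  unfolding l2_def
proof (rule summable_on_comparison_test)
  show "(\<lambda>k. 2 * (cmod (a k))\<^sup>2 + 2 * (cmod (b k))\<^sup>2) summable_on UNIV"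
    using assms unfolding l2_def by (intro summable_on_add summable_on_cmult_right)
  fix k
  have "(cmod (a k + b k))\<^sup>2 \<le> (cmod (a k) + cmod (b k))\<^sup>2" by (intro power_mono norm_triangle_ineq) auto
  also have "\<dots> \<le> 2 * (cmod (a k))\<^sup>2 + 2 * (cmod (b k))\<^sup>2"
    using zero_le_power2[of "cmod (a k) - cmod (b k)"] by (simp add: power2_eq_square algebra_simps)
  finally show "(cmod (a k + b k))\<^sup>2 \<le> 2 * (cmod (a k))\<^sup>2 + 2 * (cmod (b k))\<^sup>2" .
qed auto

text \<open>A type and not a set of sequences, because the existence theorem for differential
  equations is stated for the class \<open>banach\<close>.\<close>

typedef ell2 = "{a. l2 a}" morphisms cf Ell2 using l2_0 by blast

setup_lifting type_definition_ell2

lemma l2_cf [simp]: "l2 (cf x)" using cf by simp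
lemma cf_Ell2: "l2 a \<Longrightarrow> cf (Ell2 a) = a" by (simp add: Ell2_inverse)
lemma ell2_eqI: "(\<And>k. cf x k = cf y k) \<Longrightarrow> x = y" by (simp add: cf_inject[symmetric] fun_eq_iff)

lift_definition cscale :: "complex \<Rightarrow> ell2 \<Rightarrow> ell2" is "\<lambda>c a k. c * a k" by (rule l2_cmult)

text \<open>Kept beside the class operations: \<open>real_inner\<close> records only the real part,
  while the symplectic form and the antilinearity of Hankel operators need the complex
  value.\<close>

definition cinner :: "ell2 \<Rightarrow> ell2 \<Rightarrow> complex" where
  "cinner x y = (\<Sum>\<^sub>\<infinity>k. cf x k * cnj (cf y k))"

instantiation ell2 :: real_inner
begin
lift_definition zero_ell2 :: ell2 is "\<lambda>_. 0" by (rule l2_0)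
lift_definition plus_ell2 :: "ell2 \<Rightarrow> ell2 \<Rightarrow> ell2" is "\<lambda>a b k. a k + b k" by (rule l2_add)
lift_definition uminus_ell2 :: "ell2 \<Rightarrow> ell2" is "\<lambda>a k. - a k" by (simp add: l2_def)
definition minus_ell2 :: "ell2 \<Rightarrow> ell2 \<Rightarrow> ell2" where "minus_ell2 x y = x + (- y)"
definition scaleR_ell2 :: "real \<Rightarrow> ell2 \<Rightarrow> ell2" where "scaleR_ell2 r x = cscale (of_real r) x"
definition inner_ell2 :: "ell2 \<Rightarrow> ell2 \<Rightarrow> real" where "inner_ell2 x y = Re (cinner x y)"
definition norm_ell2 :: "ell2 \<Rightarrow> real" where "norm_ell2 x = sqrt (Re (cinner x x))"
definition sgn_ell2 :: "ell2 \<Rightarrow> ell2" where "sgn_ell2 x = inverse (norm x) *\<^sub>R x"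
definition dist_ell2 :: "ell2 \<Rightarrow> ell2 \<Rightarrow> real" where "dist_ell2 x y = norm (x - y)"
definition uniformity_ell2 :: "(ell2 \<times> ell2) filter" where
  "uniformity_ell2 = (INF e\<in>{0<..}. principal {(x, y). dist x y < e})"
definition open_ell2 :: "ell2 set \<Rightarrow> bool" where
  "open_ell2 U \<longleftrightarrow> (\<forall>x\<in>U. \<forall>\<^sub>F (x', y) in uniformity. x' = x \<longrightarrow> y \<in> U)"

lemma cf_add [simp]: "cf (x + y) k = cf x k + cf y k" by transfer simp
lemma cf_0 [simp]: "cf 0 k = 0" by transfer simp
lemma cf_uminus [simp]: "cf (- x) k = - cf x k" by transfer simp
lemma cf_diff [simp]: "cf (x - y) k = cf x k - cf y k" by (simp add: minus_ell2_def)
lemma cf_cscale [simp]: "cf (cscale c x) k = c * cf x k" by transfer simp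
lemma cf_scaleR [simp]: "cf (r *\<^sub>R x) k = of_real r * cf x k" by (simp add: scaleR_ell2_def)

lemma cinner_has_sum: "((\<lambda>k. cf x k * cnj (cf y k)) has_sum cinner x y) UNIV"
  unfolding cinner_def
  by (rule has_sum_infsum[OF abs_summable_summable[OF l2_mult_abs_summable[OF l2_cf l2_cnj[OF l2_cf]]]])

lemma cinner_commute: "cinner y x = cnj (cinner x y)"
  using has_sum_unique[OF cinner_has_sum[of y x]] cinner_has_sum[of x y, THEN has_sum_cnj_iff[THEN iffD2]]
  by (simp add: mult.commute)

lemma cinner_add_left: "cinner (x + y) z = cinner x z + cinner y z"
  using has_sum_unique[OF cinner_has_sum[of "x + y" z]] has_sum_add[OF cinner_has_sum[of x z] cinner_has_sum[of y z]]
  by (simp add: algebra_simps)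

lemma cinner_cscale_left: "cinner (cscale c x) z = c * cinner x z"
  using has_sum_unique[OF cinner_has_sum[of "cscale c x" z]] has_sum_cmult_right[OF cinner_has_sum[of x z], of c]
  by (simp add: mult.assoc)

lemma cinner_self_has_sum: "((\<lambda>k. (cmod (cf x k))\<^sup>2) has_sum Re (cinner x x)) UNIV"
  using has_sum_Re[OF cinner_has_sum[of x x]] by (simp add: complex_norm_square[symmetric] del: of_real_power)

lemma cinner_self: "cinner x x = of_real (Re (cinner x x))"
proof -
  have "((\<lambda>k. complex_of_real ((cmod (cf x k))\<^sup>2)) has_sum cinner x x) UNIV"
    unfolding complex_norm_square by (rule cinner_has_sum)
  then show ?thesis by (rule has_sum_unique[OF _ has_sum_of_real[OF cinner_self_has_sum]])
qed

instance
proof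
  fix x y z :: ell2 and a b r :: real
  show "x + y + z = x + (y + z)" "x + y = y + x" "0 + x = x" "- x + x = 0" "x - y = x + - y"
    "a *\<^sub>R (x + y) = a *\<^sub>R x + a *\<^sub>R y" "(a + b) *\<^sub>R x = a *\<^sub>R x + b *\<^sub>R x" "a *\<^sub>R b *\<^sub>R x = (a * b) *\<^sub>R x" "1 *\<^sub>R x = x"
    by (auto intro!: ell2_eqI simp: algebra_simps)
  show "dist x y = norm (x - y)" "sgn x = inverse (norm x) *\<^sub>R x" by (simp_all add: dist_ell2_def sgn_ell2_def)
  show "(uniformity :: (ell2 \<times> ell2) filter) = (INF e\<in>{0<..}. principal {(x, y). dist x y < e})"
    by (rule uniformity_ell2_def)
  show "open U \<longleftrightarrow> (\<forall>x\<in>U. \<forall>\<^sub>F (x', y) in uniformity. x' = x \<longrightarrow> y \<in> U)" for U :: "ell2 set"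
    by (rule open_ell2_def)
  show "x \<bullet> y = y \<bullet> x" unfolding inner_ell2_def by (subst cinner_commute) simp
  show "(x + y) \<bullet> z = x \<bullet> z + y \<bullet> z" by (simp add: inner_ell2_def cinner_add_left)
  show "r *\<^sub>R x \<bullet> y = r * (x \<bullet> y)" by (simp add: inner_ell2_def scaleR_ell2_def cinner_cscale_left)
  show nn: "0 \<le> x \<bullet> x" unfolding inner_ell2_def by (rule has_sum_nonneg[OF cinner_self_has_sum]) simp
  show "norm x = sqrt (x \<bullet> x)" by (simp add: norm_ell2_def inner_ell2_def)
  show "x \<bullet> x = 0 \<longleftrightarrow> x = 0"
  proof
    assume "x \<bullet> x = 0"
    then have "((\<lambda>k. (cmod (cf x k))\<^sup>2) has_sum 0) UNIV" using cinner_self_has_sum[of x] by (simp add: inner_ell2_def)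
    from finite_sum_le_has_sum[OF this, of "{_}"] have "(cmod (cf x k))\<^sup>2 \<le> 0" for k by simp
    then show "x = 0" by (intro ell2_eqI) simp
  qed (simp add: inner_ell2_def cinner_def)
qed
end

lemma norm_ell2_has_sum: "((\<lambda>k. (cmod (cf x k))\<^sup>2) has_sum (norm x)\<^sup>2) UNIV"
  using cinner_self_has_sum[of x] by (simp add: power2_norm_eq_inner inner_ell2_def)

lemma cinner_self_norm: "cinner x x = of_real ((norm x)\<^sup>2)"
  using cinner_self[of x] by (simp add: power2_norm_eq_inner inner_ell2_def)

lemma sum_sq_le_norm: "finite F \<Longrightarrow> (\<Sum>k\<in>F. (cmod (cf x k))\<^sup>2) \<le> (norm x)\<^sup>2"
  using finite_sum_le_has_sum[OF norm_ell2_has_sum[of x], of F] by simp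

lemma cf_le_norm: "cmod (cf x k) \<le> norm x"
  using sum_sq_le_norm[of "{k}" x] by (auto intro: power2_le_imp_le)

lemma norm_ell2_leI:
  assumes "\<And>F. finite F \<Longrightarrow> (\<Sum>k\<in>F. (cmod (cf x k))\<^sup>2) \<le> M\<^sup>2" "M \<ge> 0"
  shows "norm x \<le> M"
proof -
  have "(norm x)\<^sup>2 \<le> M\<^sup>2" by (rule has_sum_le_finite_sums[OF norm_ell2_has_sum]) (use assms in auto)
  then show ?thesis using assms(2) by (rule power2_le_imp_le)
qed

lemma norm_ell2_mono: "(\<And>k. cmod (cf x k) \<le> cmod (cf y k)) \<Longrightarrow> norm x \<le> norm y"
  by (rule norm_ell2_leI) (auto intro: order_trans[OF sum_mono sum_sq_le_norm] power_mono)

lemma norm_cscale [simp]: "norm (cscale c x) = cmod c * norm x"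
proof -
  have "((\<lambda>k. (cmod c)\<^sup>2 * (cmod (cf x k))\<^sup>2) has_sum (norm (cscale c x))\<^sup>2) UNIV"
    using norm_ell2_has_sum[of "cscale c x"] by (simp add: norm_mult power_mult_distrib)
  from has_sum_unique[OF this has_sum_cmult_right[OF norm_ell2_has_sum[of x]]]
  have "(norm (cscale c x))\<^sup>2 = (cmod c * norm x)\<^sup>2" by (simp add: power_mult_distrib)
  then show ?thesis by (simp add: power2_eq_iff_nonneg)
qed

lemma cscale_add_right: "cscale c (x + y) = cscale c x + cscale c y"
  and cscale_add_left: "cscale (c + d) x = cscale c x + cscale d x"
  and cscale_cscale [simp]: "cscale c (cscale d x) = cscale (c * d) x"
  and cscale_1 [simp]: "cscale 1 x = x" and cscale_0 [simp]: "cscale 0 x = 0" and cscale_0_right [simp]: "cscale c 0 = 0"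
  and cscale_diff_right: "cscale c (x - y) = cscale c x - cscale c y"
  and cscale_diff_left: "cscale (c - d) x = cscale c x - cscale d x"
  and cscale_minus_left: "cscale (- c) x = - cscale c x"
  and scaleR_cscale: "r *\<^sub>R x = cscale (of_real r) x"
  by (auto intro!: ell2_eqI simp: algebra_simps)

lemma bounded_bilinear_cscale: "bounded_bilinear cscale"
  by (rule bounded_bilinear.intro)
     (auto simp: cscale_add_left cscale_add_right scaleR_cscale scaleR_conv_of_real mult_ac intro!: exI[of _ 1])

lemma bounded_linear_cscale: "bounded_linear (cscale c)"
  using bounded_bilinear.bounded_linear_right[OF bounded_bilinear_cscale] .

lemma cinner_cscale_right: "cinner x (cscale c y) = cnj c * cinner x y"
  using cinner_cscale_left[of c y x] cinner_commute by (metis complex_cnj_mult)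
lemma cinner_add_right: "cinner x (y + z) = cinner x y + cinner x z"
  using cinner_add_left[of y z x] cinner_commute by (metis complex_cnj_add)
lemma cinner_minus_left: "cinner (- x) y = - cinner x y" and cinner_minus_right: "cinner x (- y) = - cinner x y"
  using cinner_cscale_left[of "-1" x y] cinner_cscale_right[of x "-1" y] by (simp_all add: cscale_minus_left)
lemma cinner_diff_left: "cinner (x - y) z = cinner x z - cinner y z"
  using cinner_add_left[of x "-y" z] by (simp add: cinner_minus_left)
lemma cinner_diff_right: "cinner z (x - y) = cinner z x - cinner z y"
  using cinner_add_right[of z x "-y"] by (simp add: cinner_minus_right)
lemma cinner_0_left [simp]: "cinner 0 x = 0" and cinner_0_right [simp]: "cinner x 0 = 0"
  by (simp_all add: cinner_def)
lemma cinner_sum_left: "cinner (sum f A) y = (\<Sum>i\<in>A. cinner (f i) y)"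
  by (induction A rule: infinite_finite_induct) (auto simp: cinner_add_left)
lemma cinner_sum_right: "cinner y (sum f A) = (\<Sum>i\<in>A. cinner y (f i))"
  by (induction A rule: infinite_finite_induct) (auto simp: cinner_add_right)

text \<open>A unimodular factor makes the inner product real and nonnegative, which reduces the
  claim to the real Cauchy-Schwarz inequality.\<close>

lemma cinner_bound: "cmod (cinner x y) \<le> norm x * norm y"
proof (cases "cinner x y = 0")
  case False
  define c where "c = cnj (cinner x y) / of_real (cmod (cinner x y))"
  have c: "cmod c = 1" using False by (simp add: c_def norm_divide)
  have "c * cinner x y = of_real (cmod (cinner x y))"
    using False by (simp add: c_def complex_norm_square[symmetric] power2_eq_square mult.commute)
  then have "cmod (cinner x y) = cscale c x \<bullet> y" by (simp add: inner_ell2_def cinner_cscale_left)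
  also have "\<dots> \<le> norm (cscale c x) * norm y" by (rule norm_cauchy_schwarz)
  finally show ?thesis by (simp add: c)
qed simp

lemma bounded_bilinear_cinner: "bounded_bilinear cinner"
  by (rule bounded_bilinear.intro)
     (auto simp: cinner_add_left cinner_add_right scaleR_cscale cinner_cscale_left cinner_cscale_right scaleR_conv_of_real
       intro!: exI[of _ 1] cinner_bound)

lemma bounded_linear_cf: "bounded_linear (\<lambda>x. cf x k)"
  by (rule bounded_linear_intro[of _ 1]) (auto simp: scaleR_conv_of_real intro: cf_le_norm)

text \<open>Coordinatewise limits exist; the Cauchy bound is kept on finite index sets, where it
  passes to the limit, and only then turned into a norm bound.\<close>

instance ell2 :: banach
proof
  fix X :: "nat \<Rightarrow> ell2" assume X: "Cauchy X"
  have "Cauchy (\<lambda>n. cf (X n) k)" for k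
    by (rule bounded_linear.Cauchy[OF bounded_linear_cf X])
  then have "\<forall>k. \<exists>l. (\<lambda>n. cf (X n) k) \<longlonglongrightarrow> l"
    by (simp add: Cauchy_convergent_iff convergent_def)
  then obtain a where a: "\<And>k. (\<lambda>n. cf (X n) k) \<longlonglongrightarrow> a k" by metis
  have tail: "\<exists>N. \<forall>n\<ge>N. \<forall>F. finite F \<longrightarrow> (\<Sum>k\<in>F. (cmod (cf (X n) k - a k))\<^sup>2) \<le> e\<^sup>2" if e: "e > 0" for e
  proof -
    obtain N where N: "\<And>m n. m \<ge> N \<Longrightarrow> n \<ge> N \<Longrightarrow> norm (X m - X n) < e"
      using X e unfolding Cauchy_iff by blast
    have "(\<Sum>k\<in>F. (cmod (cf (X n) k - a k))\<^sup>2) \<le> e\<^sup>2" if n: "n \<ge> N" and F: "finite F" for n F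
    proof (rule tendsto_upperbound)
      show "(\<lambda>m. \<Sum>k\<in>F. (cmod (cf (X n) k - cf (X m) k))\<^sup>2) \<longlonglongrightarrow> (\<Sum>k\<in>F. (cmod (cf (X n) k - a k))\<^sup>2)"
        by (intro tendsto_sum tendsto_power tendsto_norm tendsto_diff tendsto_const a)
      have "(\<Sum>k\<in>F. (cmod (cf (X n) k - cf (X m) k))\<^sup>2) \<le> e\<^sup>2" if "m \<ge> N" for m
      proof -
        have "(\<Sum>k\<in>F. (cmod (cf (X n) k - cf (X m) k))\<^sup>2) \<le> (norm (X n - X m))\<^sup>2"
          using sum_sq_le_norm[OF F, of "X n - X m"] by simp
        also have "\<dots> \<le> e\<^sup>2" using N[OF n that] by (intro power_mono) auto
        finally show ?thesis .
      qed
      then show "\<forall>\<^sub>F m in sequentially. (\<Sum>k\<in>F. (cmod (cf (X n) k - cf (X m) k))\<^sup>2) \<le> e\<^sup>2"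
        by (auto simp: eventually_sequentially)
    qed simp
    then show ?thesis by blast
  qed
  obtain N where N: "\<And>F. finite F \<Longrightarrow> (\<Sum>k\<in>F. (cmod (cf (X N) k - a k))\<^sup>2) \<le> 1\<^sup>2"
    using tail[of 1] by auto
  have "l2 (\<lambda>k. cf (X N) k - a k)" by (rule l2I[OF N])
  from l2_add[OF l2_cf[of "X N"] l2_cmult[OF this, of "-1"]] have l2a: "l2 a" by simp
  have "X \<longlonglongrightarrow> Ell2 a"
  proof (rule LIMSEQ_I)
    fix r :: real assume r: "r > 0"
    obtain N where N: "\<And>n F. n \<ge> N \<Longrightarrow> finite F \<Longrightarrow> (\<Sum>k\<in>F. (cmod (cf (X n) k - a k))\<^sup>2) \<le> (r/2)\<^sup>2"
      using tail[of "r/2"] r by auto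
    have "norm (X n - Ell2 a) \<le> r/2" if "n \<ge> N" for n
      by (rule norm_ell2_leI) (use N[OF that] r in \<open>auto simp: cf_Ell2[OF l2a]\<close>)
    then show "\<exists>N. \<forall>n\<ge>N. norm (X n - Ell2 a) < r" using r by (intro exI[of _ N]) fastforce
  qed
  then show "convergent X" by (auto simp: convergent_def)
qed

lift_definition eps :: "nat \<Rightarrow> ell2" is "\<lambda>m k. if k = m then 1 else 0"
proof -
  fix m show "l2 (\<lambda>k. if k = m then 1 else 0)"
  proof (rule l2I[of _ 1])
    fix F :: "nat set" assume "finite F"
    have "(\<Sum>k\<in>F. (cmod (if k = m then 1 else 0))\<^sup>2) = (\<Sum>k\<in>F. if k = m then 1 else 0)" by (intro sum.cong) auto
    also have "\<dots> \<le> (1::real)" using \<open>finite F\<close> by simp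
    finally show "(\<Sum>k\<in>F. (cmod (if k = m then 1 else 0))\<^sup>2) \<le> 1" .
  qed
qed

lemma cf_eps [simp]: "cf (eps m) k = (if k = m then 1 else 0)" by transfer simp

lemma cinner_eps_right: "cinner x (eps m) = cf x m"
proof -
  have "((\<lambda>k. cf x k * cnj (cf (eps m) k)) has_sum (\<Sum>k\<in>{m}. cf x k * cnj (cf (eps m) k))) UNIV"
    by (rule has_sum_finite_neutralI[of "{m}"]) auto
  from has_sum_unique[OF cinner_has_sum this] show ?thesis by simp
qed

lemma cinner_eps: "cinner (eps i) (eps j) = (if i = j then 1 else 0)"
  by (auto simp: cinner_eps_right)

text \<open>The squared norm of \<open>x - p\<close>, with \<open>p\<close> the projection of
  \<open>x\<close>, is the difference of the two sides. The inequality will be applied to families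
  transported by a linear flow.\<close>

lemma bessel_ell2:
  assumes F: "finite F" and on: "\<And>i j. i \<in> F \<Longrightarrow> j \<in> F \<Longrightarrow> cinner (f i) (f j) = (if i = j then 1 else 0)"
  shows "(\<Sum>j\<in>F. (cmod (cinner x (f j)))\<^sup>2) \<le> (norm x)\<^sup>2"
proof -
  define p where "p = (\<Sum>j\<in>F. cscale (cinner x (f j)) (f j))"
  have xp: "cinner x p = of_real (\<Sum>j\<in>F. (cmod (cinner x (f j)))\<^sup>2)"
    unfolding p_def by (simp add: cinner_sum_right cinner_cscale_right mult.commute flip: complex_norm_square)
  have pf: "cinner p (f j) = cinner x (f j)" if "j \<in> F" for j
  proof -
    have "cinner p (f j) = (\<Sum>i\<in>F. cinner x (f i) * (if i = j then 1 else 0))"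
      unfolding p_def using that by (simp add: cinner_sum_left cinner_cscale_left on cong: sum.cong)
    also have "\<dots> = cinner x (f j)" using F that by (simp add: if_distrib sum.delta cong: if_cong)
    finally show ?thesis .
  qed
  have "cinner p p = (\<Sum>j\<in>F. cnj (cinner x (f j)) * cinner p (f j))"
    by (subst (2) p_def) (simp add: cinner_sum_right cinner_cscale_right)
  also have "\<dots> = of_real (\<Sum>j\<in>F. (cmod (cinner x (f j)))\<^sup>2)"
    by (simp add: pf mult.commute flip: complex_norm_square)
  finally have pp: "cinner p p = of_real (\<Sum>j\<in>F. (cmod (cinner x (f j)))\<^sup>2)" .
  have px: "cinner p x = of_real (\<Sum>j\<in>F. (cmod (cinner x (f j)))\<^sup>2)"
    unfolding cinner_commute[of p x] xp by (simp del: of_real_sum)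
  have "0 \<le> (x - p) \<bullet> (x - p)" by simp
  also have "\<dots> = Re (cinner x x - cinner x p - (cinner p x - cinner p p))"
    unfolding inner_ell2_def by (simp add: cinner_diff_left cinner_diff_right)
  also have "\<dots> = (norm x)\<^sup>2 - (\<Sum>j\<in>F. (cmod (cinner x (f j)))\<^sup>2)"
    unfolding xp pp px cinner_self_norm[of x] by (simp del: of_real_sum of_real_power)
  finally show ?thesis by simp
qed

section \<open>Convolution and correlation of sequences\<close>

definition l1 :: "(nat \<Rightarrow> complex) \<Rightarrow> bool" where
  "l1 a \<longleftrightarrow> (\<lambda>k. cmod (a k)) summable_on UNIV"

definition n1 :: "(nat \<Rightarrow> complex) \<Rightarrow> real" where
  "n1 a = (\<Sum>\<^sub>\<infinity>k. cmod (a k))"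

text \<open>In terms of Fourier coefficients \<open>corr u h\<close> is \<open>\<Pi>(u h\<^sup>*)\<close>, where \<open>h\<^sup>*\<close> is the complex conjugate,
  and \<open>conv u h\<close> is the product \<open>u h\<close>.\<close>

definition corr :: "(nat \<Rightarrow> complex) \<Rightarrow> (nat \<Rightarrow> complex) \<Rightarrow> nat \<Rightarrow> complex" where
  "corr a b k = (\<Sum>\<^sub>\<infinity>l. a (k + l) * cnj (b l))"

definition conv :: "(nat \<Rightarrow> complex) \<Rightarrow> (nat \<Rightarrow> complex) \<Rightarrow> nat \<Rightarrow> complex" where
  "conv a b k = (\<Sum>i\<le>k. a i * b (k - i))"

abbreviation (input) cabs :: "(nat \<Rightarrow> complex) \<Rightarrow> nat \<Rightarrow> complex" where
  "cabs a \<equiv> \<lambda>k. of_real (cmod (a k))"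

lemma n1_nonneg: "n1 a \<ge> 0" unfolding n1_def by (rule infsum_nonneg) simp

lemma l1_sum_le: "l1 a \<Longrightarrow> finite F \<Longrightarrow> (\<Sum>k\<in>F. cmod (a k)) \<le> n1 a"
  unfolding l1_def n1_def by (rule finite_sum_le_infsum) auto

lemma l1_le: "l1 a \<Longrightarrow> cmod (a k) \<le> n1 a"
  using l1_sum_le[of a "{k}"] by simp

lemma l1_boundI:
  assumes "\<And>F. finite F \<Longrightarrow> (\<Sum>k\<in>F. cmod (a k)) \<le> M"
  shows "l1 a" "n1 a \<le> M"
proof -
  show "l1 a" unfolding l1_def by (rule nonneg_bdd_above_summable_on) (auto intro!: bdd_aboveI assms)
  then show "n1 a \<le> M" unfolding n1_def l1_def
    by (rule infsum_le_finite_sums) (use assms in auto)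
qed

lemma l1_cabs: "l1 a \<Longrightarrow> l1 (cabs a)" and n1_cabs [simp]: "n1 (cabs a) = n1 a"
  by (simp_all add: l1_def n1_def)

lemma l1_imp_l2: assumes "l1 a" shows "l2 a"
  unfolding l2_def
proof (rule summable_on_comparison_test)
  show "(\<lambda>k. n1 a * cmod (a k)) summable_on UNIV"
    using assms unfolding l1_def by (rule summable_on_cmult_right)
  show "(cmod (a k))\<^sup>2 \<le> n1 a * cmod (a k)" for k
    unfolding power2_eq_square by (intro mult_right_mono l1_le assms) simp
qed auto

lemma l2_shift: assumes "l2 a" shows "l2 (\<lambda>l. a (k + l))"
proof -
  have "(\<lambda>j. (cmod (a j))\<^sup>2) summable_on ((+) k ` UNIV)"
    using assms unfolding l2_def by (rule summable_on_subset) auto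
  then show ?thesis unfolding l2_def by (subst (asm) summable_on_reindex) (auto simp: o_def)
qed

lemma corr_summable: "l2 a \<Longrightarrow> l2 b \<Longrightarrow> (\<lambda>l. a (k + l) * cnj (b l)) abs_summable_on UNIV"
  by (rule l2_mult_abs_summable[OF l2_shift l2_cnj])

lemma corr_has_sum: "l2 a \<Longrightarrow> l2 b \<Longrightarrow> ((\<lambda>l. a (k + l) * cnj (b l)) has_sum corr a b k) UNIV"
  unfolding corr_def by (rule has_sum_infsum[OF abs_summable_summable[OF corr_summable]])

lemma corrI: "l2 a \<Longrightarrow> l2 b \<Longrightarrow> ((\<lambda>l. a (k + l) * cnj (b l)) has_sum S) UNIV \<Longrightarrow> corr a b k = S"
  using has_sum_unique[OF corr_has_sum] .

section \<open>Young's inequalities for convolution and correlation\<close>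

lemma young_aux:
  fixes c :: "'b \<Rightarrow> real"
  assumes c: "c summable_on UNIV" "\<And>l. c l \<ge> 0" and f: "\<And>k l. f k l \<ge> 0" "\<And>k l. f k l \<le> M" and M: "M \<ge> 0"
  shows "(\<lambda>l. c l * f k l) summable_on UNIV"
    "((\<lambda>G. \<Sum>l\<in>G. c l * f k l) \<longlongrightarrow> (\<Sum>\<^sub>\<infinity>l. c l * f k l)) (finite_subsets_at_top UNIV)"
    "finite G \<Longrightarrow> (\<Sum>l\<in>G. c l * M) \<le> infsum c UNIV * M"
proof -
  show s: "(\<lambda>l. c l * f k l) summable_on UNIV"
    by (rule summable_on_comparison_test[OF summable_on_cmult_left[OF c(1), of M]])
       (use c f in \<open>auto intro: mult_left_mono\<close>)
  show "((\<lambda>G. \<Sum>l\<in>G. c l * f k l) \<longlongrightarrow> (\<Sum>\<^sub>\<infinity>l. c l * f k l)) (finite_subsets_at_top UNIV)"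
    using has_sum_infsum[OF s] by (simp add: has_sum_def)
  show "finite G \<Longrightarrow> (\<Sum>l\<in>G. c l * M) \<le> infsum c UNIV * M"
    unfolding sum_distrib_right[symmetric]
    by (intro mult_right_mono M finite_sum_le_infsum) (use c in auto)
qed

text \<open>Minkowski's inequality for a superposition with weights \<open>c\<close>: the triangle
  inequality is used for finitely many \<open>l\<close>, then the limit is taken. Arbitrary index
  types serve both natural and integer frequencies.\<close>

lemma young2:
  fixes c :: "'b \<Rightarrow> real" and f :: "'a \<Rightarrow> 'b \<Rightarrow> real"
  assumes c: "c summable_on UNIV" "\<And>l. c l \<ge> 0" and f: "\<And>k l. f k l \<ge> 0" and M: "M \<ge> 0"
    and f2: "\<And>l F. finite F \<Longrightarrow> (\<Sum>k\<in>F. (f k l)\<^sup>2) \<le> M\<^sup>2" and F: "finite F"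
  shows "(\<Sum>k\<in>F. (\<Sum>\<^sub>\<infinity>l. c l * f k l)\<^sup>2) \<le> (infsum c UNIV * M)\<^sup>2"
proof -
  have fM: "f k l \<le> M" for k l using f2[of "{k}" l] M by (auto intro: power2_le_imp_le)
  note y = young_aux[where c = c and f = f and M = M, OF c f fM M]
  have L: "L2_set (\<lambda>k. \<Sum>l\<in>G. c l * f k l) F \<le> (\<Sum>l\<in>G. c l * M)" if "finite G" for G
    using that
  proof induction
    case (insert l G)
    have "L2_set (\<lambda>k. \<Sum>l\<in>insert l G. c l * f k l) F = L2_set (\<lambda>k. c l * f k l + (\<Sum>l\<in>G. c l * f k l)) F"
      using insert by simp
    also have "\<dots> \<le> L2_set (\<lambda>k. c l * f k l) F + L2_set (\<lambda>k. \<Sum>l\<in>G. c l * f k l) F"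
      by (rule L2_set_triangle_ineq)
    also have "L2_set (\<lambda>k. c l * f k l) F = c l * L2_set (\<lambda>k. f k l) F"
      using c by (simp add: L2_set_right_distrib)
    also have "\<dots> \<le> c l * M"
      using f2[OF F, of l] M by (intro mult_left_mono c) (simp add: L2_set_def real_le_lsqrt)
    finally show ?case using insert by simp
  qed (simp add: L2_set_def)
  show ?thesis
  proof (rule tendsto_upperbound)
    show "((\<lambda>G. \<Sum>k\<in>F. (\<Sum>l\<in>G. c l * f k l)\<^sup>2) \<longlongrightarrow> (\<Sum>k\<in>F. (\<Sum>\<^sub>\<infinity>l. c l * f k l)\<^sup>2)) (finite_subsets_at_top UNIV)"
      by (intro tendsto_sum tendsto_power y(2))
    have "(\<Sum>k\<in>F. (\<Sum>l\<in>G. c l * f k l)\<^sup>2) \<le> (infsum c UNIV * M)\<^sup>2" if "finite G" for G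
    proof -
      have "L2_set (\<lambda>k. \<Sum>l\<in>G. c l * f k l) F \<le> infsum c UNIV * M"
        using L[OF that] y(3)[OF that] by linarith
      then show ?thesis unfolding L2_set_def by (rule sqrt_le_D)
    qed
    then show "\<forall>\<^sub>F G in finite_subsets_at_top UNIV. (\<Sum>k\<in>F. (\<Sum>l\<in>G. c l * f k l)\<^sup>2) \<le> (infsum c UNIV * M)\<^sup>2"
      by (rule eventually_finite_subsets_at_top_weakI)
  qed simp
qed

lemma young1:
  fixes c :: "'b \<Rightarrow> real" and f :: "'a \<Rightarrow> 'b \<Rightarrow> real"
  assumes c: "c summable_on UNIV" "\<And>l. c l \<ge> 0" and f: "\<And>k l. f k l \<ge> 0" and M: "M \<ge> 0"
    and f1: "\<And>l F. finite F \<Longrightarrow> (\<Sum>k\<in>F. f k l) \<le> M" and F: "finite F"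
  shows "(\<Sum>k\<in>F. \<Sum>\<^sub>\<infinity>l. c l * f k l) \<le> infsum c UNIV * M"
proof -
  have fM: "f k l \<le> M" for k l using f1[of "{k}" l] by simp
  note y = young_aux[where c = c and f = f and M = M, OF c f fM M]
  show ?thesis
  proof (rule tendsto_upperbound)
    show "((\<lambda>G. \<Sum>k\<in>F. \<Sum>l\<in>G. c l * f k l) \<longlongrightarrow> (\<Sum>k\<in>F. \<Sum>\<^sub>\<infinity>l. c l * f k l)) (finite_subsets_at_top UNIV)"
      by (intro tendsto_sum y(2))
    have "(\<Sum>k\<in>F. \<Sum>l\<in>G. c l * f k l) \<le> infsum c UNIV * M" if "finite G" for G
    proof -
      have "(\<Sum>k\<in>F. \<Sum>l\<in>G. c l * f k l) = (\<Sum>l\<in>G. c l * (\<Sum>k\<in>F. f k l))"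
        by (subst sum.swap) (simp add: sum_distrib_left)
      also have "\<dots> \<le> (\<Sum>l\<in>G. c l * M)" by (intro sum_mono mult_left_mono c f1 F)
      finally show ?thesis using y(3)[OF that] by linarith
    qed
    then show "\<forall>\<^sub>F G in finite_subsets_at_top UNIV. (\<Sum>k\<in>F. \<Sum>l\<in>G. c l * f k l) \<le> infsum c UNIV * M"
      by (rule eventually_finite_subsets_at_top_weakI)
  qed simp
qed

lemma cmod_corr_le:
  assumes "l2 a" "l2 b"
  shows "cmod (corr a b k) \<le> (\<Sum>\<^sub>\<infinity>l. cmod (b l) * cmod (a (k + l)))"
proof -
  have "cmod (corr a b k) \<le> (\<Sum>\<^sub>\<infinity>l. cmod (a (k + l) * cnj (b l)))"
    unfolding corr_def by (rule norm_infsum_bound[OF corr_summable[OF assms]])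
  then show ?thesis by (simp add: norm_mult mult.commute)
qed

lemma sum_sq_shift_le:
  assumes "finite F" shows "(\<Sum>k\<in>F. (cmod (cf h (k + l)))\<^sup>2) \<le> (norm h)\<^sup>2"
proof -
  have "(\<Sum>k\<in>F. (cmod (cf h (k + l)))\<^sup>2) = (\<Sum>j\<in>(\<lambda>k. k + l) ` F. (cmod (cf h j))\<^sup>2)"
    by (subst sum.reindex) (auto simp: inj_on_def)
  also have "\<dots> \<le> (norm h)\<^sup>2" using assms by (intro sum_sq_le_norm) auto
  finally show ?thesis .
qed

lemma sum_sq_back_le:
  assumes "finite F"
  shows "(\<Sum>k\<in>F. (if l \<le> k then cmod (cf h (k - l)) else 0)\<^sup>2) \<le> (norm h)\<^sup>2"
    "(\<Sum>k\<in>F. (if k \<le> l then cmod (cf h (l - k)) else 0)\<^sup>2) \<le> (norm h)\<^sup>2"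
proof -
  have "(\<Sum>k\<in>F. (if l \<le> k then cmod (cf h (k - l)) else 0)\<^sup>2) = (\<Sum>k\<in>{k\<in>F. l \<le> k}. (cmod (cf h (k - l)))\<^sup>2)"
    using assms by (intro sum.mono_neutral_cong_right) auto
  also have "\<dots> = (\<Sum>j\<in>(\<lambda>k. k - l) ` {k\<in>F. l \<le> k}. (cmod (cf h j))\<^sup>2)"
    by (subst sum.reindex) (auto simp: inj_on_def)
  also have "\<dots> \<le> (norm h)\<^sup>2" using assms by (intro sum_sq_le_norm) auto
  finally show "(\<Sum>k\<in>F. (if l \<le> k then cmod (cf h (k - l)) else 0)\<^sup>2) \<le> (norm h)\<^sup>2" .
  have "(\<Sum>k\<in>F. (if k \<le> l then cmod (cf h (l - k)) else 0)\<^sup>2) = (\<Sum>k\<in>{k\<in>F. k \<le> l}. (cmod (cf h (l - k)))\<^sup>2)"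
    using assms by (intro sum.mono_neutral_cong_right) auto
  also have "\<dots> = (\<Sum>j\<in>(\<lambda>k. l - k) ` {k\<in>F. k \<le> l}. (cmod (cf h j))\<^sup>2)"
    by (subst sum.reindex) (auto simp: inj_on_def)
  also have "\<dots> \<le> (norm h)\<^sup>2" using assms by (intro sum_sq_le_norm) auto
  finally show "(\<Sum>k\<in>F. (if k \<le> l then cmod (cf h (l - k)) else 0)\<^sup>2) \<le> (norm h)\<^sup>2" .
qed

lemma l2_norm_dominated:
  assumes y: "\<And>F. finite F \<Longrightarrow> (\<Sum>k\<in>F. (y k)\<^sup>2) \<le> M\<^sup>2" "M \<ge> 0" and a: "\<And>k. cmod (a k) \<le> y k"
  shows "l2 a" "norm (Ell2 a) \<le> M"
proof -
  have bd: "(\<Sum>k\<in>F. (cmod (a k))\<^sup>2) \<le> M\<^sup>2" if "finite F" for F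
    using y(1)[OF that] by (rule order_trans[rotated]) (intro sum_mono power_mono a norm_ge_zero)
  show l: "l2 a" by (rule l2I[OF bd])
  show "norm (Ell2 a) \<le> M" by (rule norm_ell2_leI) (use bd y(2) in \<open>auto simp: cf_Ell2[OF l]\<close>)
qed

lemma l2_corr_right:
  assumes "l1 b"
  shows "l2 (corr (cf h) b)" "norm (Ell2 (corr (cf h) b)) \<le> n1 b * norm h"
proof -
  have *: "(\<Sum>k\<in>F. (\<Sum>\<^sub>\<infinity>l. cmod (b l) * cmod (cf h (k + l)))\<^sup>2) \<le> (n1 b * norm h)\<^sup>2" if "finite F" for F
    unfolding n1_def by (rule young2) (use assms that in \<open>auto simp: l1_def sum_sq_shift_le\<close>)
  show "l2 (corr (cf h) b)" "norm (Ell2 (corr (cf h) b)) \<le> n1 b * norm h"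
    using l2_norm_dominated[where M = "n1 b * norm h", OF * _ cmod_corr_le[OF l2_cf l1_imp_l2[OF assms]]]
    by (simp_all add: n1_nonneg)
qed

lemma l2_corr_left:
  assumes "l1 b"
  shows "l2 (corr b (cf h))" "norm (Ell2 (corr b (cf h))) \<le> n1 b * norm h"
proof -
  have *: "(\<Sum>k\<in>F. (\<Sum>\<^sub>\<infinity>l. cmod (b l) * (if k \<le> l then cmod (cf h (l - k)) else 0))\<^sup>2) \<le> (n1 b * norm h)\<^sup>2" if "finite F" for F
    unfolding n1_def by (rule young2) (use assms that in \<open>auto simp: l1_def sum_sq_back_le simp del: if_distrib\<close>)
  have **: "cmod (corr b (cf h) k) \<le> (\<Sum>\<^sub>\<infinity>l. cmod (b l) * (if k \<le> l then cmod (cf h (l - k)) else 0))" for k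
  proof -
    have "cmod (corr b (cf h) k) \<le> (\<Sum>\<^sub>\<infinity>l. cmod (cf h l) * cmod (b (k + l)))"
      by (rule cmod_corr_le[OF l1_imp_l2[OF assms] l2_cf])
    \<comment> \<open>Substituting \<open>k + l\<close> for \<open>l\<close> makes the summable
      sequence \<open>b\<close> the weight of the superposition; its columns are then reversed
      pieces of \<open>h\<close>.\<close>
    also have "\<dots> = (\<Sum>\<^sub>\<infinity>l\<in>(+) k ` UNIV. cmod (b l) * (if k \<le> l then cmod (cf h (l - k)) else 0))"
      by (subst infsum_reindex) (auto simp: o_def mult.commute)
    also have "\<dots> = (\<Sum>\<^sub>\<infinity>l. cmod (b l) * (if k \<le> l then cmod (cf h (l - k)) else 0))"
      by (rule infsum_cong_neutral) (auto simp: image_iff le_iff_add)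
    finally show ?thesis .
  qed
  show "l2 (corr b (cf h))" "norm (Ell2 (corr b (cf h))) \<le> n1 b * norm h"
    using l2_norm_dominated[where M = "n1 b * norm h", OF * _ **] by (simp_all add: n1_nonneg)
qed

lemma l2_conv:
  assumes "l1 a"
  shows "l2 (conv a (cf h))" "norm (Ell2 (conv a (cf h))) \<le> n1 a * norm h"
proof -
  have *: "(\<Sum>k\<in>F. (\<Sum>\<^sub>\<infinity>l. cmod (a l) * (if l \<le> k then cmod (cf h (k - l)) else 0))\<^sup>2) \<le> (n1 a * norm h)\<^sup>2" if "finite F" for F
    unfolding n1_def by (rule young2) (use assms that in \<open>auto simp: l1_def sum_sq_back_le simp del: if_distrib\<close>)
  have **: "cmod (conv a (cf h) k) \<le> (\<Sum>\<^sub>\<infinity>l. cmod (a l) * (if l \<le> k then cmod (cf h (k - l)) else 0))" for k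
  proof -
    have "((\<lambda>l. cmod (a l) * (if l \<le> k then cmod (cf h (k - l)) else 0)) has_sum (\<Sum>l\<le>k. cmod (a l) * cmod (cf h (k - l)))) UNIV"
      by (rule has_sum_finite_neutralI[of "{..k}"]) auto
    then have "(\<Sum>\<^sub>\<infinity>l. cmod (a l) * (if l \<le> k then cmod (cf h (k - l)) else 0)) = (\<Sum>l\<le>k. cmod (a l) * cmod (cf h (k - l)))"
      by (rule infsumI)
    moreover have "cmod (conv a (cf h) k) \<le> (\<Sum>l\<le>k. cmod (a l * cf h (k - l)))"
      unfolding conv_def by (rule norm_sum)
    ultimately show ?thesis by (simp add: norm_mult)
  qed
  show "l2 (conv a (cf h))" "norm (Ell2 (conv a (cf h))) \<le> n1 a * norm h"
    using l2_norm_dominated[where M = "n1 a * norm h", OF * _ **] by (simp_all add: n1_nonneg)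
qed

lemma l1_corr:
  assumes "l1 a" "l1 b"
  shows "l1 (corr a b)" "n1 (corr a b) \<le> n1 b * n1 a"
proof -
  have *: "(\<Sum>k\<in>F. \<Sum>\<^sub>\<infinity>l. cmod (b l) * cmod (a (k + l))) \<le> n1 b * n1 a" if "finite F" for F
    unfolding n1_def[of b]
  proof (rule young1)
    fix l and F :: "nat set" assume F: "finite F"
    have "(\<Sum>k\<in>F. cmod (a (k + l))) = (\<Sum>j\<in>(\<lambda>k. k + l) ` F. cmod (a j))"
      by (subst sum.reindex) (auto simp: inj_on_def)
    also have "\<dots> \<le> n1 a" using F assms by (intro l1_sum_le) auto
    finally show "(\<Sum>k\<in>F. cmod (a (k + l))) \<le> n1 a" .
  qed (use assms that in \<open>auto simp: l1_def n1_nonneg\<close>)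
  have "(\<Sum>k\<in>F. cmod (corr a b k)) \<le> n1 b * n1 a" if "finite F" for F
    using *[OF that] by (rule order_trans[rotated]) (intro sum_mono cmod_corr_le l1_imp_l2 assms)
  then show "l1 (corr a b)" "n1 (corr a b) \<le> n1 b * n1 a"
    using l1_boundI[of "corr a b" "n1 b * n1 a"] by simp_all
qed

section \<open>Rearrangement of double sums and the algebra of Hankel operators\<close>

lemma conv_commute: "conv a b k = conv b a k"
  unfolding conv_def by (rule sum.reindex_bij_witness[of _ "\<lambda>i. k - i" "\<lambda>i. k - i"]) auto

text \<open>Fubini for an absolutely summable double array, read by rows, by columns and by
  antidiagonals. Antidiagonals are the convolution sums, and the identities below compare several
  readings of one array.\<close>

lemma abs_iterated:
  fixes G :: "nat \<Rightarrow> nat \<Rightarrow> complex"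
  assumes 1: "\<And>p. (\<lambda>j. G p j) abs_summable_on UNIV" and 2: "(\<lambda>p. \<Sum>\<^sub>\<infinity>j. cmod (G p j)) summable_on UNIV"
  obtains S where "((\<lambda>p. \<Sum>\<^sub>\<infinity>j. G p j) has_sum S) UNIV" "((\<lambda>j. \<Sum>\<^sub>\<infinity>p. G p j) has_sum S) UNIV"
    "((\<lambda>l. \<Sum>p\<le>l. G p (l - p)) has_sum S) UNIV"
proof -
  have abs: "(\<lambda>(p,j). G p j) abs_summable_on UNIV \<times> UNIV"
    unfolding Infinite_Sum.abs_summable_on_Sigma_iff using 1 2 by (simp add: abs_of_nonneg infsum_nonneg)
  then obtain S where S: "((\<lambda>(p,j). G p j) has_sum S) (UNIV \<times> UNIV)"
    using abs_summable_summable has_sum_infsum by blast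
  have a: "((\<lambda>p. \<Sum>\<^sub>\<infinity>j. G p j) has_sum S) UNIV"
    by (rule has_sum_SigmaD[OF S]) (simp add: has_sum_infsum[OF abs_summable_summable[OF 1]])
  have S': "((\<lambda>(j,p). G p j) has_sum S) (UNIV \<times> UNIV)"
    using has_sum_swap S by fastforce
  have "(\<lambda>(j,p). G p j) abs_summable_on UNIV \<times> UNIV"
    using abs summable_on_swap[of "\<lambda>(p,j). cmod (G p j)" UNIV UNIV] by (simp add: case_prod_unfold)
  then have swp: "(\<lambda>p. G p j) abs_summable_on UNIV" for j
    by (subst (asm) Infinite_Sum.abs_summable_on_Sigma_iff) auto
  have b: "((\<lambda>j. \<Sum>\<^sub>\<infinity>p. G p j) has_sum S) UNIV"
    by (rule has_sum_SigmaD[OF S']) (simp add: has_sum_infsum[OF abs_summable_summable[OF swp]])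
  have bij: "bij_betw (\<lambda>(l,p). (p, l - p)) (SIGMA l:UNIV. {..l}) (UNIV \<times> (UNIV::nat set))"
    by (rule bij_betw_byWitness[where f' = "\<lambda>(p,j). (p + j, p)"]) auto
  have S'': "((\<lambda>(l,p). G p (l - p)) has_sum S) (SIGMA l:UNIV. {..l})"
    using has_sum_reindex_bij_betw[OF bij, of "\<lambda>(p,j). G p j" S] S by (simp add: case_prod_unfold)
  have c: "((\<lambda>l. \<Sum>p\<le>l. G p (l - p)) has_sum S) UNIV"
    by (rule has_sum_SigmaD[OF S'']) auto
  show ?thesis by (rule that[OF a b c])
qed

lemma cabs_corr:
  assumes a: "l2 a" and b: "l2 b"
  shows "corr (cabs a) (cabs b) k = of_real (\<Sum>\<^sub>\<infinity>l. cmod (a (k + l)) * cmod (b l))"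
proof (rule corrI[OF l2_norm[OF a] l2_norm[OF b]])
  have "((\<lambda>l. cmod (a (k + l)) * cmod (b l)) has_sum (\<Sum>\<^sub>\<infinity>l. cmod (a (k + l)) * cmod (b l))) UNIV"
    using corr_summable[OF a b, of k] by (intro has_sum_infsum) (simp add: norm_mult)
  from has_sum_of_real[OF this, where 'a = complex]
  show "((\<lambda>l. of_real (cmod (a (k + l))) * cnj (of_real (cmod (b l)))) has_sum
      of_real (\<Sum>\<^sub>\<infinity>l. cmod (a (k + l)) * cmod (b l))) UNIV" by simp
qed

text \<open>The absolute convergence that licenses rearrangement is obtained by applying the norm
  bound to the sequences of moduli.\<close>

lemma l2_abs_corr_left:
  assumes "l1 b" "l2 h" shows "l2 (\<lambda>k. of_real (\<Sum>\<^sub>\<infinity>l. cmod (b (k + l)) * cmod (h l)))"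
proof -
  have "l2 (corr (cabs b) (cf (Ell2 (cabs h))))" by (rule l2_corr_left[OF l1_cabs[OF assms(1)]])
  then have "l2 (\<lambda>k. corr (cabs b) (cabs h) k)" by (simp add: cf_Ell2 l2_norm assms)
  then show ?thesis by (simp add: cabs_corr l1_imp_l2 assms)
qed

lemma l2_abs_corr_right:
  assumes "l1 b" "l2 h" shows "l2 (\<lambda>k. of_real (\<Sum>\<^sub>\<infinity>l. cmod (h (k + l)) * cmod (b l)))"
proof -
  have "l2 (corr (cf (Ell2 (cabs h))) (cabs b))" by (rule l2_corr_right[OF l1_cabs[OF assms(1)]])
  then have "l2 (\<lambda>k. corr (cabs h) (cabs b) k)" by (simp add: cf_Ell2 l2_norm assms)
  then show ?thesis by (simp add: cabs_corr l1_imp_l2 assms)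
qed

lemma l2_mult_real_summable:
  assumes "l2 a" "l2 (\<lambda>k. complex_of_real (r k))"
  shows "(\<lambda>k. cmod (a k) * \<bar>r k\<bar>) summable_on UNIV"
  using l2_mult_abs_summable[OF assms] by (simp add: norm_mult)

lemma abs_infsum_nonneg: "\<bar>\<Sum>\<^sub>\<infinity>l\<in>A. cmod (f l) * cmod (g l)\<bar> = (\<Sum>\<^sub>\<infinity>l\<in>A. cmod (f l) * cmod (g l))"
  by (intro abs_of_nonneg infsum_nonneg) simp

text \<open>All three expressions are readings of the array
  \<open>u (k + l + m) * cnj (b m) * cnj (h l)\<close>. In operator form, the Hankel operator with
  symbol \<open>H_u(b)\<close> is \<open>H_u\<close> after multiplication by \<open>b\<close>, and
  also the adjoint of that multiplication after \<open>H_u\<close>.\<close>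

lemma corr_corr:
  assumes u: "l1 u" and b: "l1 b" and h: "l2 h"
  shows "corr (corr u b) h k = corr u (conv b h) k" "corr (corr u h) b k = corr u (conv b h) k"
proof -
  define G where "G l m = u (k + l + m) * cnj (b m) * cnj (h l)" for l m
  have cs: "(\<lambda>m. u (k + l + m) * cnj (b m)) abs_summable_on UNIV" for l
    by (rule corr_summable[OF l1_imp_l2[OF u] l1_imp_l2[OF b]])
  have 1: "(\<lambda>m. G l m) abs_summable_on UNIV" for l
    using summable_on_cmult_left[OF cs[of l], of "cmod (h l)"] by (simp add: G_def norm_mult)
  have "(\<lambda>l. cmod (h l) * \<bar>\<Sum>\<^sub>\<infinity>m. cmod (u (k + l + m)) * cmod (b m)\<bar>) summable_on UNIV"
    by (rule l2_mult_real_summable[OF h l2_shift[OF l2_abs_corr_left[OF u l1_imp_l2[OF b]], of k]])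
  moreover have "(\<Sum>\<^sub>\<infinity>m. cmod (G l m)) = cmod (h l) * \<bar>\<Sum>\<^sub>\<infinity>m. cmod (u (k + l + m)) * cmod (b m)\<bar>" for l
    unfolding abs_infsum_nonneg by (simp add: G_def norm_mult infsum_cmult_right'[symmetric] ac_simps)
  ultimately have 2: "(\<lambda>l. \<Sum>\<^sub>\<infinity>m. cmod (G l m)) summable_on UNIV" by simp
  obtain S where S: "((\<lambda>l. \<Sum>\<^sub>\<infinity>m. G l m) has_sum S) UNIV" "((\<lambda>m. \<Sum>\<^sub>\<infinity>l. G l m) has_sum S) UNIV"
    "((\<lambda>p. \<Sum>l\<le>p. G l (p - l)) has_sum S) UNIV"
    using abs_iterated[OF 1 2] by blast
  have lcub: "l2 (corr u b)" by (rule l1_imp_l2[OF l1_corr(1)[OF u b]])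
  have lcuh: "l2 (corr u h)" using l2_corr_left(1)[OF u, of "Ell2 h"] by (simp add: cf_Ell2 h)
  have lcbh: "l2 (conv b h)" using l2_conv(1)[OF b, of "Ell2 h"] by (simp add: cf_Ell2 h)
  have A: "corr (corr u b) h k = S"
  proof (rule corrI[OF lcub h])
    have "(\<Sum>\<^sub>\<infinity>m. G l m) = corr u b (k + l) * cnj (h l)" for l
      unfolding G_def corr_def by (rule infsum_cmult_left')
    with S(1) show "((\<lambda>l. corr u b (k + l) * cnj (h l)) has_sum S) UNIV" by simp
  qed
  have B: "corr (corr u h) b k = S"
  proof (rule corrI[OF lcuh l1_imp_l2[OF b]])
    have "(\<Sum>\<^sub>\<infinity>l. G l m) = corr u h (k + m) * cnj (b m)" for m
      unfolding G_def corr_def by (simp add: infsum_cmult_right'[symmetric] ac_simps)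
    with S(2) show "((\<lambda>m. corr u h (k + m) * cnj (b m)) has_sum S) UNIV" by simp
  qed
  have C: "corr u (conv b h) k = S"
  proof (rule corrI[OF l1_imp_l2[OF u] lcbh])
    have "(\<Sum>l\<le>p. G l (p - l)) = u (k + p) * cnj (conv b h p)" for p
    proof -
      have "(\<Sum>l\<le>p. G l (p - l)) = (\<Sum>l\<le>p. u (k + p) * (cnj (h l) * cnj (b (p - l))))"
        by (intro sum.cong) (auto simp: G_def mult_ac)
      also have "\<dots> = u (k + p) * cnj (conv h b p)" by (simp add: conv_def sum_distrib_left)
      finally show ?thesis by (simp only: conv_commute)
    qed
    with S(3) show "((\<lambda>p. u (k + p) * cnj (conv b h p)) has_sum S) UNIV" by simp
  qed
  show "corr (corr u b) h k = corr u (conv b h) k" "corr (corr u h) b k = corr u (conv b h) k"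
    using A B C by simp_all
qed

lemma has_sum_finite_sum:
  fixes f :: "'i \<Rightarrow> 'a \<Rightarrow> 'b::real_normed_vector"
  assumes "finite I" "\<And>i. i \<in> I \<Longrightarrow> (f i has_sum s i) A"
  shows "((\<lambda>x. \<Sum>i\<in>I. f i x) has_sum sum s I) A"
  using assms by (induction I rule: finite_induct) (auto intro: has_sum_add)

text \<open>The convolution index is split at \<open>k\<close>: the part up to \<open>k\<close>
  gives \<open>a\<close> times a correlation of \<open>c\<close>, the part from \<open>k\<close> on
  a correlation of \<open>a\<close> with \<open>corr h c\<close>. The index \<open>k\<close> itself
  is counted in both, hence the rank one correction.\<close>

lemma corr_conv:
  assumes a: "l1 a" and c: "l1 c" and h: "l2 h" and ac: "l2 (conv a c)"
  shows "corr (conv a c) h k = conv a (corr c h) k + corr a (corr h c) k - (\<Sum>\<^sub>\<infinity>l. c l * cnj (h l)) * a k"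
proof -
  have l: "l2 a" "l2 c" using a c by (auto intro: l1_imp_l2)
  have lhc: "l2 (corr h c)" using l2_corr_right(1)[OF c, of "Ell2 h"] by (simp add: cf_Ell2 h)
  define G where "G p j = a (k + p) * (c j * cnj (h (p + j)))" for p j
  have cs: "(\<lambda>j. h (p + j) * cnj (c j)) abs_summable_on UNIV" for p
    by (rule corr_summable[OF h l(2)])
  have 1: "(\<lambda>j. G p j) abs_summable_on UNIV" for p
    using summable_on_cmult_right[OF cs[of p], of "cmod (a (k + p))"] by (simp add: G_def norm_mult mult_ac)
  have "(\<lambda>p. cmod (a (k + p)) * \<bar>\<Sum>\<^sub>\<infinity>j. cmod (h (p + j)) * cmod (c j)\<bar>) summable_on UNIV"
    by (rule l2_mult_real_summable[OF l2_shift[OF l(1)] l2_abs_corr_right[OF c h]])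
  moreover have "(\<Sum>\<^sub>\<infinity>j. cmod (G p j)) = cmod (a (k + p)) * \<bar>\<Sum>\<^sub>\<infinity>j. cmod (h (p + j)) * cmod (c j)\<bar>" for p
    unfolding abs_infsum_nonneg by (simp add: G_def norm_mult infsum_cmult_right'[symmetric] ac_simps)
  ultimately have 2: "(\<lambda>p. \<Sum>\<^sub>\<infinity>j. cmod (G p j)) summable_on UNIV" by simp
  obtain S where S: "((\<lambda>p. \<Sum>\<^sub>\<infinity>j. G p j) has_sum S) UNIV" "((\<lambda>l. \<Sum>p\<le>l. G p (l - p)) has_sum S) UNIV"
    using abs_iterated[OF 1 2] by blast
  have S1: "corr a (corr h c) k = S"
  proof (rule corrI[OF l(1) lhc])
    have "(\<Sum>\<^sub>\<infinity>j. G p j) = a (k + p) * cnj (corr h c p)" for p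
      unfolding G_def corr_def by (simp add: infsum_cmult_right' infsum_cnj[symmetric] mult.commute del: infsum_cnj)
    with S(1) show "((\<lambda>p. a (k + p) * cnj (corr h c p)) has_sum S) UNIV" by simp
  qed
  have S2: "((\<lambda>l. \<Sum>i\<le>k. a i * (c (k - i + l) * cnj (h l))) has_sum conv a (corr c h) k) UNIV"
    unfolding conv_def
    by (intro has_sum_finite_sum has_sum_cmult_right corr_has_sum l(2) h finite_atMost)
  have S3: "((\<lambda>l. c l * cnj (h l)) has_sum (\<Sum>\<^sub>\<infinity>l. c l * cnj (h l))) UNIV"
    using corr_has_sum[OF l(2) h, of 0] by (simp add: corr_def)
  show ?thesis unfolding S1
  proof (rule corrI[OF ac h])
    have "conv a c (k + l) * cnj (h l) = (\<Sum>i\<le>k. a i * (c (k - i + l) * cnj (h l)))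
        + (\<Sum>p\<le>l. G p (l - p)) - c l * cnj (h l) * a k" for l
    proof -
      have "conv a c (k + l) = (\<Sum>i\<le>k. a i * c (k + l - i)) + (\<Sum>i\<in>{k<..k+l}. a i * c (k + l - i))"
        unfolding conv_def
        by (subst sum.union_disjoint[symmetric]) (auto intro!: sum.cong)
      also have "(\<Sum>i\<le>k. a i * c (k + l - i)) = (\<Sum>i\<le>k. a i * c (k - i + l))"
        by (intro sum.cong) auto
      also have "(\<Sum>i\<in>{k<..k+l}. a i * c (k + l - i)) = (\<Sum>p\<in>{0<..l}. a (k + p) * c (l - p))"
        by (rule sum.reindex_bij_witness[of _ "\<lambda>p. k + p" "\<lambda>i. i - k"]) (auto simp: add.commute)
      \<comment> \<open>The term with \<open>p = 0\<close> is added and subtracted to complete the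
        antidiagonal sum; it is the source of the rank one correction.\<close>
      also have "\<dots> = (\<Sum>p\<le>l. a (k + p) * c (l - p)) - a k * c l"
      proof -
        have "{..l} = insert 0 {0<..l}" by auto
        then show ?thesis by simp
      qed
      finally have e: "conv a c (k + l) = (\<Sum>i\<le>k. a i * c (k - i + l)) + ((\<Sum>p\<le>l. a (k + p) * c (l - p)) - a k * c l)" .
      have "(\<Sum>p\<le>l. G p (l - p)) = (\<Sum>p\<le>l. a (k + p) * c (l - p)) * cnj (h l)"
        unfolding sum_distrib_right by (intro sum.cong) (auto simp: G_def)
      moreover have "(\<Sum>i\<le>k. a i * (c (k - i + l) * cnj (h l))) = (\<Sum>i\<le>k. a i * c (k - i + l)) * cnj (h l)"
        by (simp add: sum_distrib_right mult.assoc)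
      ultimately show ?thesis unfolding e by (simp add: algebra_simps)
    qed
    then show "((\<lambda>l. conv a c (k + l) * cnj (h l)) has_sum
      (conv a (corr c h) k + S - (\<Sum>\<^sub>\<infinity>l. c l * cnj (h l)) * a k)) UNIV"
      using has_sum_add[OF has_sum_add[OF S2 S(2)] has_sum_uminusI[OF has_sum_cmult_left[OF S3, of "a k"]]]
      by simp
  qed
qed

text \<open>In operator form: the adjoint of multiplication by \<open>a\<close> is the Toeplitz
  operator with conjugate symbol. The array is read by antidiagonals and by rows.\<close>

lemma conv_adjoint:
  assumes a: "l1 a" and x: "l2 x" and y: "l2 y"
  shows "(\<Sum>\<^sub>\<infinity>k. conv a x k * cnj (y k)) = (\<Sum>\<^sub>\<infinity>k. x k * cnj (corr y a k))"
proof -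
  define G where "G j i = x j * (a i * cnj (y (j + i)))" for i j
  have cs: "(\<lambda>i. y (j + i) * cnj (a i)) abs_summable_on UNIV" for j
    by (rule corr_summable[OF y l1_imp_l2[OF a]])
  have 1: "(\<lambda>i. G j i) abs_summable_on UNIV" for j
    using summable_on_cmult_right[OF cs[of j], of "cmod (x j)"] by (simp add: G_def norm_mult mult_ac)
  have "(\<lambda>j. cmod (x j) * \<bar>\<Sum>\<^sub>\<infinity>i. cmod (y (j + i)) * cmod (a i)\<bar>) summable_on UNIV"
    by (rule l2_mult_real_summable[OF x l2_abs_corr_right[OF a y]])
  moreover have "(\<Sum>\<^sub>\<infinity>i. cmod (G j i)) = cmod (x j) * \<bar>\<Sum>\<^sub>\<infinity>i. cmod (y (j + i)) * cmod (a i)\<bar>" for j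
    unfolding abs_infsum_nonneg by (simp add: G_def norm_mult infsum_cmult_right'[symmetric] ac_simps)
  ultimately have 2: "(\<lambda>j. \<Sum>\<^sub>\<infinity>i. cmod (G j i)) summable_on UNIV" by simp
  obtain S where S: "((\<lambda>j. \<Sum>\<^sub>\<infinity>i. G j i) has_sum S) UNIV" "((\<lambda>l. \<Sum>j\<le>l. G j (l - j)) has_sum S) UNIV"
    using abs_iterated[OF 1 2] by blast
  have "(\<Sum>\<^sub>\<infinity>i. G j i) = x j * cnj (corr y a j)" for j
    unfolding G_def corr_def by (simp add: infsum_cmult_right' infsum_cnj[symmetric] mult.commute del: infsum_cnj)
  with S(1) have A: "(\<Sum>\<^sub>\<infinity>k. x k * cnj (corr y a k)) = S" by (simp add: infsumI)
  have "(\<Sum>j\<le>l. G j (l - j)) = conv a x l * cnj (y l)" for l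
    unfolding conv_commute[of a x] unfolding conv_def sum_distrib_right
    by (intro sum.cong) (auto simp: G_def)
  with S(2) have B: "(\<Sum>\<^sub>\<infinity>k. conv a x k * cnj (y k)) = S" by (simp add: infsumI)
  from A B show ?thesis by simp
qed

text \<open>The matrix \<open>u (k + l)\<close> is symmetric, so rows and columns of the array give
  the two sides; for an antilinear operator this reads \<open>(H x|y) = (H y|x)\<close>.\<close>

lemma corr_symmetric:
  assumes u: "l1 u" and x: "l2 x" and y: "l2 y"
  shows "(\<Sum>\<^sub>\<infinity>k. corr u x k * cnj (y k)) = (\<Sum>\<^sub>\<infinity>k. corr u y k * cnj (x k))"
proof -
  define G where "G k l = cnj (y k) * (u (k + l) * cnj (x l))" for k l
  have cs: "(\<lambda>l. u (k + l) * cnj (x l)) abs_summable_on UNIV" for k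
    by (rule corr_summable[OF l1_imp_l2[OF u] x])
  have 1: "(\<lambda>l. G k l) abs_summable_on UNIV" for k
    using summable_on_cmult_right[OF cs[of k], of "cmod (y k)"] by (simp add: G_def norm_mult mult_ac)
  have "(\<lambda>k. cmod (y k) * \<bar>\<Sum>\<^sub>\<infinity>l. cmod (u (k + l)) * cmod (x l)\<bar>) summable_on UNIV"
    by (rule l2_mult_real_summable[OF y l2_abs_corr_left[OF u x]])
  moreover have "(\<Sum>\<^sub>\<infinity>l. cmod (G k l)) = cmod (y k) * \<bar>\<Sum>\<^sub>\<infinity>l. cmod (u (k + l)) * cmod (x l)\<bar>" for k
    unfolding abs_infsum_nonneg by (simp add: G_def norm_mult infsum_cmult_right'[symmetric] ac_simps)
  ultimately have 2: "(\<lambda>k. \<Sum>\<^sub>\<infinity>l. cmod (G k l)) summable_on UNIV" by simp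
  obtain S where S: "((\<lambda>k. \<Sum>\<^sub>\<infinity>l. G k l) has_sum S) UNIV" "((\<lambda>l. \<Sum>\<^sub>\<infinity>k. G k l) has_sum S) UNIV"
    using abs_iterated[OF 1 2] by blast
  have "(\<Sum>\<^sub>\<infinity>l. G k l) = corr u x k * cnj (y k)" for k
    unfolding G_def corr_def by (simp add: infsum_cmult_right' mult.commute)
  with S(1) have A: "(\<Sum>\<^sub>\<infinity>k. corr u x k * cnj (y k)) = S" by (simp add: infsumI)
  have "(\<Sum>\<^sub>\<infinity>k. G k l) = corr u y l * cnj (x l)" for l
    unfolding G_def corr_def by (simp add: infsum_cmult_right'[symmetric] ac_simps)
  with S(2) have B: "(\<Sum>\<^sub>\<infinity>k. corr u y k * cnj (x k)) = S" by (simp add: infsumI)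
  from A B show ?thesis by simp
qed

lemma corr_add_left: "l2 a \<Longrightarrow> l2 b \<Longrightarrow> l2 h \<Longrightarrow> corr (\<lambda>k. a k + b k) h k = corr a h k + corr b h k"
  by (rule corrI[OF l2_add]) (auto simp: distrib_right intro!: has_sum_add corr_has_sum)
lemma corr_add_right: "l2 a \<Longrightarrow> l2 b \<Longrightarrow> l2 h \<Longrightarrow> corr h (\<lambda>k. a k + b k) k = corr h a k + corr h b k"
  by (rule corrI[OF _ l2_add]) (auto simp: distrib_left intro!: has_sum_add corr_has_sum)
lemma corr_cmult_left: "corr (\<lambda>k. c * a k) h k = c * corr a h k"
  by (simp add: corr_def mult.assoc infsum_cmult_right')
lemma corr_cmult_right: "corr h (\<lambda>k. c * a k) k = cnj c * corr h a k"
  by (simp add: corr_def infsum_cmult_right'[symmetric] mult_ac)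
lemma conv_add_right: "conv a (\<lambda>k. b k + c k) k = conv a b k + conv a c k"
  by (simp add: conv_def distrib_left sum.distrib)
lemma conv_add_left: "conv (\<lambda>k. b k + c k) a k = conv b a k + conv c a k"
  by (simp add: conv_def distrib_right sum.distrib)
lemma conv_cmult_right: "conv a (\<lambda>k. c * b k) k = c * conv a b k"
  by (simp add: conv_def sum_distrib_left mult_ac)
lemma conv_cmult_left: "conv (\<lambda>k. c * b k) a k = c * conv b a k"
  by (simp add: conv_def sum_distrib_left mult_ac)

section \<open>Hankel operators in the Sobolev scale\<close>

lemma cf_add_fun: "cf (x + y) = (\<lambda>k. cf x k + cf y k)" and cf_scaleR_fun: "cf (r *\<^sub>R x) = (\<lambda>k. of_real r * cf x k)"
  and cf_cscale_fun: "cf (cscale c x) = (\<lambda>k. c * cf x k)"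
  by (auto simp: fun_eq_iff)

locale sobolev =
  fixes s :: real
  assumes s: "s > 1"
begin

text \<open>The square root of the Sobolev weight, so that multiplying coefficients by
  \<open>w\<close> turns the \<open>H\<^sup>s\<close> norm into the plain l^2 norm.\<close>

definition w :: "nat \<Rightarrow> real" where "w k = (1 + (real k)\<^sup>2) powr (s / 2)"

lemma w_ge_1: "w k \<ge> 1" unfolding w_def using s by (intro ge_one_powr_ge_zero) auto
lemma w_pos [simp]: "w k > 0" using w_ge_1[of k] by linarith
lemma w_nonneg [simp]: "w k \<ge> 0" using w_pos[of k] by linarith
lemma w_nonzero [simp]: "w k \<noteq> 0" using w_pos[of k] by linarith
lemma w_0 [simp]: "w 0 = 1" by (simp add: w_def)
lemma w_mono: "i \<le> j \<Longrightarrow> w i \<le> w j"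
  unfolding w_def using s by (intro powr_mono2 add_left_mono power_mono) auto

text \<open>With \<open>m\<close> the larger index, \<open>1 + (i + j)^2\<close> is at most
  \<open>4 * (1 + m^2)\<close>, and 4 to the power \<open>s / 2\<close> is
  \<open>2 powr s\<close>.\<close>

lemma w_add: "w (i + j) \<le> 2 powr s * (w i + w j)"
proof -
  have *: "w (i + j) \<le> 2 powr s * w m" if m: "i \<le> m" "j \<le> m" for m
  proof -
    have "1 + (real (i + j))\<^sup>2 \<le> 2\<^sup>2 * (1 + (real m)\<^sup>2)"
    proof -
      have "(real (i + j))\<^sup>2 \<le> (2 * real m)\<^sup>2" using m by (intro power_mono) auto
      then show ?thesis by (simp add: power_mult_distrib)
    qed
    then have "w (i + j) \<le> (2\<^sup>2 * (1 + (real m)\<^sup>2)) powr (s / 2)"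
      unfolding w_def using s by (intro powr_mono2) auto
    also have "\<dots> = (2 powr 2) powr (s/2) * w m"
      unfolding w_def by (subst powr_mult) auto
    finally show ?thesis by (simp add: powr_powr)
  qed
  have "w (max i j) \<le> w i + w j" using w_pos[of i] w_pos[of j] by (auto simp: max_def)
  then have "2 powr s * w (max i j) \<le> 2 powr s * (w i + w j)" by (intro mult_left_mono) auto
  moreover have "w (i + j) \<le> 2 powr s * w (max i j)" by (rule *) auto
  ultimately show ?thesis by (rule order_trans[rotated])
qed

text \<open>Here the threshold 1 for \<open>s\<close> enters, through comparison with the series of
  \<open>k powr (- s)\<close>. Both the Wiener bound and the trace bound rest on this sum.\<close>

lemma w_summable: "(\<lambda>k. 1 / w k) summable_on UNIV"
proof -
  have "summable (\<lambda>k. real k powr (- s))" using s by (simp add: summable_real_powr_iff)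
  then have "summable (\<lambda>k. 1 / w k)"
  proof (rule summable_comparison_test'[where N = 1])
    fix k :: nat assume k: "k \<ge> 1"
    have "real k powr s = (real k)\<^sup>2 powr (s / 2)"
      using k by (simp add: powr_numeral[symmetric] powr_powr del: powr_numeral)
    also have "\<dots> \<le> w k" unfolding w_def using s by (intro powr_mono2) auto
    finally have "1 / w k \<le> 1 / real k powr s" using k by (intro divide_left_mono) auto
    then show "norm (1 / w k) \<le> real k powr (- s)" by (simp add: powr_minus inverse_eq_divide less_imp_le)
  qed
  then show ?thesis by (subst summable_on_UNIV_nonneg_real_iff) (auto simp: less_imp_le)
qed

definition K where "K = (\<Sum>\<^sub>\<infinity>k. 1 / w k)"

lemma K_nonneg: "K \<ge> 0" unfolding K_def by (rule infsum_nonneg) (simp add: less_imp_le)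

text \<open>A vector \<open>x\<close> of \<open>ell2\<close> encodes the function of \<open>H\<^sup>s\<^sub>+\<close> with Fourier coefficients \<open>U x k = x\<^sub>k / w k\<close>,
  so that the norm of \<open>x\<close> is its Sobolev norm; \<open>V x\<close> is the same function as a vector of \<open>L\<^sup>2\<^sub>+\<close>.
  \<open>Hk\<close>, \<open>Tp\<close> and \<open>Cv\<close> are the Hankel operator, \<open>h \<mapsto> \<Pi>(a\<^sup>* h)\<close> and multiplication by \<open>a\<close> on \<open>L\<^sup>2\<^sub>+\<close>,
  with the symbol in the Sobolev encoding; in \<open>Hw\<close> and \<open>Cw\<close> both arguments and the value are in that encoding.\<close>

definition U :: "ell2 \<Rightarrow> nat \<Rightarrow> complex" where "U x k = cf x k / of_real (w k)"

lemma U_add: "U (x + y) = (\<lambda>k. U x k + U y k)" and U_scaleR: "U (r *\<^sub>R x) = (\<lambda>k. of_real r * U x k)"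
  and U_cscale: "U (cscale c x) = (\<lambda>k. c * U x k)"
  by (auto simp: U_def fun_eq_iff add_divide_distrib)

lemma l1_U: "l1 (U x)" and n1_U_le: "n1 (U x) \<le> K * norm x"
proof -
  have "(\<Sum>k\<in>F. cmod (U x k)) \<le> K * norm x" if "finite F" for F
  proof -
    have "(\<Sum>k\<in>F. cmod (U x k)) \<le> (\<Sum>k\<in>F. (1 / w k) * norm x)"
      by (intro sum_mono) (auto simp: U_def norm_divide divide_right_mono cf_le_norm less_imp_le)
    also have "\<dots> \<le> K * norm x"
      unfolding sum_distrib_right[symmetric] K_def
      by (intro mult_right_mono finite_sum_le_infsum w_summable that) (auto simp: less_imp_le)
    finally show ?thesis .
  qed
  then show "l1 (U x)" "n1 (U x) \<le> K * norm x" using l1_boundI[of "U x" "K * norm x"] by simp_all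
qed

lemma l2_U [simp]: "l2 (U x)" by (rule l1_imp_l2[OF l1_U])

definition V :: "ell2 \<Rightarrow> ell2" where "V x = Ell2 (U x)"
definition Hk :: "ell2 \<Rightarrow> ell2 \<Rightarrow> ell2" where "Hk x h = Ell2 (corr (U x) (cf h))"
definition Tp :: "ell2 \<Rightarrow> ell2 \<Rightarrow> ell2" where "Tp a h = Ell2 (corr (cf h) (U a))"
definition Cv :: "ell2 \<Rightarrow> ell2 \<Rightarrow> ell2" where "Cv a h = Ell2 (conv (U a) (cf h))"
definition Hw :: "ell2 \<Rightarrow> ell2 \<Rightarrow> ell2" where "Hw x y = Ell2 (\<lambda>k. of_real (w k) * corr (U x) (U y) k)"
definition Cw :: "ell2 \<Rightarrow> ell2 \<Rightarrow> ell2" where "Cw x y = Ell2 (\<lambda>k. of_real (w k) * conv (U x) (U y) k)"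

lemma cf_V: "cf (V x) = U x" by (simp add: V_def cf_Ell2)
lemma cf_Hk: "cf (Hk x h) = corr (U x) (cf h)" by (simp add: Hk_def cf_Ell2 l2_corr_left l1_U)
lemma cf_Tp: "cf (Tp a h) = corr (cf h) (U a)" by (simp add: Tp_def cf_Ell2 l2_corr_right l1_U)
lemma cf_Cv: "cf (Cv a h) = conv (U a) (cf h)" by (simp add: Cv_def cf_Ell2 l2_conv l1_U)

lemma norm_Hk: "norm (Hk x h) \<le> n1 (U x) * norm h" unfolding Hk_def by (rule l2_corr_left(2)[OF l1_U])
lemma norm_Tp: "norm (Tp x h) \<le> n1 (U x) * norm h" unfolding Tp_def by (rule l2_corr_right(2)[OF l1_U])
lemma norm_Cv: "norm (Cv x h) \<le> n1 (U x) * norm h" unfolding Cv_def by (rule l2_conv(2)[OF l1_U])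
lemma norm_V: "norm (V x) \<le> norm x"
  by (rule norm_ell2_mono) (simp add: cf_V U_def norm_divide divide_le_eq mult_le_cancel_left1 w_ge_1 abs_of_pos)

text \<open>Since \<open>w k \<le> w (k + l)\<close>, the whole weight falls on the symbol
  \<open>x\<close>, and \<open>y\<close> is measured only in the Wiener norm. This one-sidedness
  keeps later estimates linear in the Sobolev norm.\<close>

lemma l2_Hw: "l2 (\<lambda>k. of_real (w k) * corr (U x) (U y) k)"
  and norm_Hw: "norm (Hw x y) \<le> n1 (U y) * norm x"
proof -
  have *: "(\<Sum>k\<in>F. (\<Sum>\<^sub>\<infinity>l. cmod (U y l) * cmod (cf x (k + l)))\<^sup>2) \<le> (n1 (U y) * norm x)\<^sup>2" if "finite F" for F
    unfolding n1_def by (rule young2) (use l1_U that in \<open>auto simp: l1_def sum_sq_shift_le\<close>)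
  have **: "cmod (of_real (w k) * corr (U x) (U y) k) \<le> (\<Sum>\<^sub>\<infinity>l. cmod (U y l) * cmod (cf x (k + l)))" for k
  proof -
    have s1: "(\<lambda>l. cmod (U y l) * cmod (U x (k + l))) summable_on UNIV"
      using l2_mult_abs_summable[OF l2_U[of y] l2_shift[OF l2_U[of x], of k]] by (simp add: norm_mult)
    have s2: "(\<lambda>l. cmod (U y l) * cmod (cf x (k + l))) summable_on UNIV"
      using l2_mult_abs_summable[OF l2_U[of y] l2_shift[OF l2_cf[of x], of k]] by (simp add: norm_mult)
    have "cmod (of_real (w k) * corr (U x) (U y) k) = w k * cmod (corr (U x) (U y) k)"
      by (simp add: norm_mult less_imp_le)
    also have "\<dots> \<le> w k * (\<Sum>\<^sub>\<infinity>l. cmod (U y l) * cmod (U x (k + l)))"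
      by (intro mult_left_mono cmod_corr_le l2_U) (simp add: less_imp_le)
    also have "\<dots> = (\<Sum>\<^sub>\<infinity>l. w k * (cmod (U y l) * cmod (U x (k + l))))" by (simp add: infsum_cmult_right')
    also have "\<dots> \<le> (\<Sum>\<^sub>\<infinity>l. cmod (U y l) * cmod (cf x (k + l)))"
    proof (rule infsum_mono[OF summable_on_cmult_right[OF s1] s2])
      fix l
      have "w k * cmod (U x (k + l)) \<le> w (k + l) * cmod (U x (k + l))"
        by (intro mult_right_mono w_mono) auto
      also have "\<dots> = cmod (cf x (k + l))" by (simp add: U_def norm_divide less_imp_le)
      finally have "cmod (U y l) * (w k * cmod (U x (k + l))) \<le> cmod (U y l) * cmod (cf x (k + l))"
        by (intro mult_left_mono) auto
      then show "w k * (cmod (U y l) * cmod (U x (k + l))) \<le> cmod (U y l) * cmod (cf x (k + l))"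
        by (simp add: mult.left_commute)
    qed
    finally show ?thesis .
  qed
  show "l2 (\<lambda>k. of_real (w k) * corr (U x) (U y) k)" "norm (Hw x y) \<le> n1 (U y) * norm x"
    unfolding Hw_def using l2_norm_dominated[where M = "n1 (U y) * norm x", OF * _ **] by (simp_all add: n1_nonneg)
qed

lemma cf_Hw: "cf (Hw x y) k = of_real (w k) * corr (U x) (U y) k" by (simp add: Hw_def cf_Ell2[OF l2_Hw])

lemma U_Hw: "U (Hw x y) = corr (U x) (U y)"
  by (rule ext) (simp add: U_def[of "Hw x y"] cf_Hw)

lemma n1_Hw: "n1 (U (Hw x y)) \<le> n1 (U y) * n1 (U x)"
  unfolding U_Hw by (rule l1_corr(2)[OF l1_U l1_U])

text \<open>The weight of a sum of indices is split by \<open>w_add\<close>, so the product is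
  dominated coefficientwise by \<open>2 powr s\<close> times the sum of two convolutions of moduli,
  \<open>z1\<close> and \<open>z2\<close>, in each of which one factor carries the weight.\<close>

lemma l2_Cw: "l2 (\<lambda>k. of_real (w k) * conv (U x) (U y) k)"
  and norm_Cw: "norm (Cw x y) \<le> 2 powr s * (n1 (U y) * norm x + n1 (U x) * norm y)"
proof -
  define A where "A v = Ell2 (cabs (cf v))" for v
  have cA: "cf (A v) = cabs (cf v)" for v unfolding A_def by (simp add: cf_Ell2 l2_norm)
  have nA: "norm (A v) \<le> norm v" for v by (rule norm_ell2_mono) (simp add: cA)
  define z1 where "z1 = Ell2 (conv (cabs (U y)) (cf (A x)))"
  define z2 where "z2 = Ell2 (conv (cabs (U x)) (cf (A y)))"
  define z where "z = (2 powr s) *\<^sub>R (z1 + z2)"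
  have cz1: "cf z1 k = of_real (\<Sum>i\<le>k. cmod (cf x i) * cmod (U y (k - i)))" for k
  proof -
    have "cf z1 k = conv (cabs (U y)) (cf (A x)) k"
      unfolding z1_def by (simp only: cf_Ell2[OF l2_conv(1)[OF l1_cabs[OF l1_U]]])
    then show ?thesis unfolding conv_commute[of "cabs (U y)"] by (simp add: conv_def cA)
  qed
  have cz2: "cf z2 k = of_real (\<Sum>i\<le>k. cmod (U x i) * cmod (cf y (k - i)))" for k
  proof -
    have "cf z2 k = conv (cabs (U x)) (cf (A y)) k"
      unfolding z2_def by (simp only: cf_Ell2[OF l2_conv(1)[OF l1_cabs[OF l1_U]]])
    then show ?thesis by (simp add: conv_def cA)
  qed
  have nz1: "norm z1 \<le> n1 (U y) * norm x"
    using l2_conv(2)[OF l1_cabs[OF l1_U[of y]], where h = "A x"] mult_left_mono[OF nA[of x] n1_nonneg[of "U y"]]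
    unfolding z1_def by simp
  have nz2: "norm z2 \<le> n1 (U x) * norm y"
    using l2_conv(2)[OF l1_cabs[OF l1_U[of x]], where h = "A y"] mult_left_mono[OF nA[of y] n1_nonneg[of "U x"]]
    unfolding z2_def by simp
  have nz: "norm z \<le> 2 powr s * (n1 (U y) * norm x + n1 (U x) * norm y)"
    unfolding z_def norm_scaleR using norm_triangle_ineq[of z1 z2] nz1 nz2 by (simp add: mult_left_mono)
  have dom: "cmod (of_real (w k) * conv (U x) (U y) k) \<le> cmod (cf z k)" for k
  proof -
    have "cmod (of_real (w k) * conv (U x) (U y) k) = w k * cmod (conv (U x) (U y) k)"
      by (simp add: norm_mult less_imp_le)
    also have "\<dots> \<le> w k * (\<Sum>i\<le>k. cmod (U x i) * cmod (U y (k - i)))"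
      unfolding conv_def by (intro mult_left_mono order_trans[OF norm_sum]) (auto simp: norm_mult less_imp_le)
    also have "\<dots> = (\<Sum>i\<le>k. w k * (cmod (U x i) * cmod (U y (k - i))))" by (simp add: sum_distrib_left)
    also have "\<dots> \<le> (\<Sum>i\<le>k. 2 powr s * (cmod (cf x i) * cmod (U y (k - i)) + cmod (U x i) * cmod (cf y (k - i))))"
    proof (rule sum_mono)
      fix i assume "i \<in> {..k}"
      then have "w k \<le> 2 powr s * (w i + w (k - i))" using w_add[of i "k - i"] by simp
      then have "w k * (cmod (U x i) * cmod (U y (k - i))) \<le> 2 powr s * (w i + w (k - i)) * (cmod (U x i) * cmod (U y (k - i)))"
        by (intro mult_right_mono) auto
      also have "\<dots> = 2 powr s * ((w i * cmod (U x i)) * cmod (U y (k - i)) + cmod (U x i) * (w (k - i) * cmod (U y (k - i))))"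
        by (simp add: algebra_simps)
      also have "w i * cmod (U x i) = cmod (cf x i)" by (simp add: U_def norm_divide less_imp_le)
      also have "w (k - i) * cmod (U y (k - i)) = cmod (cf y (k - i))" by (simp add: U_def norm_divide less_imp_le)
      finally show "w k * (cmod (U x i) * cmod (U y (k - i))) \<le> 2 powr s * (cmod (cf x i) * cmod (U y (k - i)) + cmod (U x i) * cmod (cf y (k - i)))" .
    qed
    also have "\<dots> = 2 powr s * ((\<Sum>i\<le>k. cmod (cf x i) * cmod (U y (k - i))) + (\<Sum>i\<le>k. cmod (U x i) * cmod (cf y (k - i))))"
      by (simp only: sum_distrib_left[symmetric] sum.distrib)
    also have "\<dots> = cmod (cf z k)"
    proof -
      have "cf z k = of_real (2 powr s * ((\<Sum>i\<le>k. cmod (cf x i) * cmod (U y (k - i))) + (\<Sum>i\<le>k. cmod (U x i) * cmod (cf y (k - i)))))"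
        unfolding z_def cf_scaleR cf_add cz1 cz2 by simp
      then show ?thesis by (simp add: sum_nonneg del: of_real_mult of_real_add of_real_sum)
    qed
    finally show ?thesis .
  qed
  show l: "l2 (\<lambda>k. of_real (w k) * conv (U x) (U y) k)" by (rule l2_dominated[OF l2_cf dom])
  have "norm (Cw x y) \<le> norm z" unfolding Cw_def by (rule norm_ell2_mono) (simp only: cf_Ell2[OF l] dom)
  with nz show "norm (Cw x y) \<le> 2 powr s * (n1 (U y) * norm x + n1 (U x) * norm y)" by linarith
qed

lemma cf_Cw: "cf (Cw x y) k = of_real (w k) * conv (U x) (U y) k" by (simp add: Cw_def cf_Ell2[OF l2_Cw])
lemma U_Cw: "U (Cw x y) = conv (U x) (U y)"
  by (rule ext) (simp add: U_def[of "Cw x y"] cf_Cw)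

section \<open>Bilinearity and operator identities\<close>

lemma K_bound: "n1 (U x) * norm h \<le> norm x * norm h * K"
  using mult_right_mono[OF n1_U_le[of x] norm_ge_zero[of h]] by (simp add: mult_ac)

lemma bounded_bilinear_Hk: "bounded_bilinear Hk"
  by (rule bounded_bilinear.intro)
     (auto intro!: ell2_eqI exI[of _ K] order_trans[OF norm_Hk K_bound]
       simp: cf_Hk U_add U_scaleR cf_add_fun cf_scaleR_fun corr_add_left corr_add_right corr_cmult_left corr_cmult_right)
lemma bounded_bilinear_Tp: "bounded_bilinear Tp"
  by (rule bounded_bilinear.intro)
     (auto intro!: ell2_eqI exI[of _ K] order_trans[OF norm_Tp K_bound]
       simp: cf_Tp U_add U_scaleR cf_add_fun cf_scaleR_fun corr_add_left corr_add_right corr_cmult_left corr_cmult_right)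
lemma bounded_bilinear_Cv: "bounded_bilinear Cv"
  by (rule bounded_bilinear.intro)
     (auto intro!: ell2_eqI exI[of _ K] order_trans[OF norm_Cv K_bound]
       simp: cf_Cv U_add U_scaleR cf_add_fun cf_scaleR_fun conv_add_left conv_add_right conv_cmult_left conv_cmult_right)
lemma bounded_bilinear_Hw: "bounded_bilinear Hw"
proof (rule bounded_bilinear.intro)
  show "\<exists>K. \<forall>a b. norm (Hw a b) \<le> norm a * norm b * K"
    using order_trans[OF norm_Hw K_bound] by (intro exI[of _ K]) (simp add: mult_ac)
qed (auto intro!: ell2_eqI simp: cf_Hw U_add U_scaleR corr_add_left corr_add_right corr_cmult_left corr_cmult_right algebra_simps)
lemma bounded_bilinear_Cw: "bounded_bilinear Cw"
proof (rule bounded_bilinear.intro)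
  have "norm (Cw x y) \<le> norm x * norm y * (2 powr s * (2 * K))" for x y
  proof -
    have "2 powr s * (n1 (U y) * norm x + n1 (U x) * norm y) \<le> 2 powr s * (norm y * norm x * K + norm x * norm y * K)"
      by (intro mult_left_mono add_mono K_bound) auto
    with norm_Cw[of x y] show ?thesis by (simp add: algebra_simps)
  qed
  then show "\<exists>K. \<forall>a b. norm (Cw a b) \<le> norm a * norm b * K" by blast
qed (auto intro!: ell2_eqI simp: cf_Cw U_add U_scaleR conv_add_left conv_add_right conv_cmult_left conv_cmult_right algebra_simps)

lemma bounded_linear_V: "bounded_linear V"
  by (rule bounded_linear_intro[of _ 1])
     (auto intro!: ell2_eqI simp: cf_V U_add U_scaleR norm_V)

lemma Hk_cscale_left: "Hk (cscale c x) h = cscale c (Hk x h)"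
  and Hk_cscale_right: "Hk x (cscale c h) = cscale (cnj c) (Hk x h)"
  and Cv_cscale_right: "Cv x (cscale c h) = cscale c (Cv x h)"
  and V_cscale: "V (cscale c x) = cscale c (V x)"
  by (auto intro!: ell2_eqI simp: cf_Hk cf_Cv cf_V U_cscale cf_cscale_fun corr_cmult_left corr_cmult_right
      conv_cmult_right)

lemma Hk_Hw: "Hk (Hw x y) h = Hk x (Cv y h)" and Hk_Hw': "Hk (Hw x y) h = Tp y (Hk x h)"
  by (auto intro!: ell2_eqI simp: cf_Hk cf_Cv cf_Tp U_Hw corr_corr l1_U)

lemma V_Hw: "V (Hw x y) = Hk x (V y)"
  by (rule ell2_eqI) (simp add: cf_V cf_Hk U_Hw)

text \<open>Operator form of \<open>corr_conv\<close>; the square summability of the product that it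
  asks for is automatic, because \<open>Cw\<close> takes values in the Sobolev encoding.\<close>

lemma Hk_Cw: "Hk (Cw a c) h = Cv a (Hk c h) + Hk a (Tp c h) - cscale (cinner (V c) h) (V a)"
proof (rule ell2_eqI)
  fix k
  have "l2 (conv (U a) (U c))" using l2_U[of "Cw a c"] by (simp add: U_Cw)
  then show "cf (Hk (Cw a c) h) k = cf (Cv a (Hk c h) + Hk a (Tp c h) - cscale (cinner (V c) h) (V a)) k"
    by (simp add: cf_Hk cf_Cv cf_Tp cf_V U_Cw cinner_def corr_conv l1_U)
qed

lemma cinner_Cv: "cinner (Cv a x) y = cinner x (Tp a y)"
  unfolding cinner_def cf_Cv cf_Tp by (rule conv_adjoint[OF l1_U]) simp_all

lemma cinner_Hk: "cinner (Hk u x) y = cinner (Hk u y) x"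
  unfolding cinner_def cf_Hk by (rule corr_symmetric[OF l1_U]) simp_all

lemma inner_Hk: "Hk u x \<bullet> y = x \<bullet> Hk u y"
  unfolding inner_ell2_def by (subst cinner_Hk, subst cinner_commute) simp

lemma Cw_commute: "Cw x y = Cw y x"
  by (rule ell2_eqI) (simp add: cf_Cw conv_commute)

lemma U_eps0: "U (eps 0) = cf (eps 0)" by (auto simp: U_def fun_eq_iff)

lemma V_eps0 [simp]: "V (eps 0) = eps 0" by (rule ell2_eqI) (simp add: cf_V U_eps0)

lemma corr_eps0_right: "corr a (cf (eps 0)) k = a k"
proof -
  have "((\<lambda>l. a (k + l) * cnj (cf (eps 0) l)) has_sum a k) UNIV"
    by (rule has_sum_finite_neutralI[of "{0}"]) auto
  then show ?thesis unfolding corr_def by (rule infsumI)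
qed

lemma corr_eps0_left: "corr (cf (eps 0)) a k = cnj (a 0) * cf (eps 0) k"
proof -
  have "((\<lambda>l. cf (eps 0) (k + l) * cnj (a l)) has_sum cnj (a 0) * cf (eps 0) k) UNIV"
    by (rule has_sum_finite_neutralI[of "{0}"]) auto
  then show ?thesis unfolding corr_def by (rule infsumI)
qed

lemma conv_eps0_right: "conv a (cf (eps 0)) k = a k"
proof -
  have "conv a (cf (eps 0)) k = (\<Sum>i\<in>{k}. a i * cf (eps 0) (k - i))"
    unfolding conv_def by (rule sum.mono_neutral_right) auto
  then show ?thesis by simp
qed

lemma Tp_eps0 [simp]: "Tp (eps 0) h = h" and Hk_eps0: "Hk (eps 0) g = cscale (cnj (cf g 0)) (eps 0)"
  and Cw_eps0 [simp]: "Cw a (eps 0) = a" and Cv_eps0: "Cv a (eps 0) = V a"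
  by (auto intro!: ell2_eqI simp: cf_Tp cf_Hk cf_Cw cf_Cv cf_V U_eps0 corr_eps0_right corr_eps0_left conv_eps0_right U_def)

lemma cf_Tp_0: "cf (Tp a h) 0 = cinner h (V a)"
  by (simp add: cf_Tp corr_def cinner_def cf_V)

lemma Tp_eps0_right: "Tp a (eps 0) = cscale (cinner (eps 0) (V a)) (eps 0)"
  by (rule ell2_eqI) (simp add: cf_Tp corr_eps0_left cinner_commute[of "eps 0"] cinner_eps_right cf_V)

end

section \<open>The Lax pair\<close>

context sobolev begin

definition aw :: "ell2 \<Rightarrow> nat \<Rightarrow> ell2" where "aw x j = (Hw x ^^ j) (eps 0)"

lemma aw_0 [simp]: "aw x 0 = eps 0" and aw_Suc: "aw x (Suc j) = Hw x (aw x j)"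
  by (simp_all add: aw_def)

lemma V_aw: "V (aw x j) = (Hk x ^^ j) (eps 0)"
  by (induction j) (simp_all add: aw_Suc V_Hw)

lemma V_aw_Suc: "V (aw x (Suc j)) = Hk x (V (aw x j))" by (simp add: V_aw)

text \<open>\<open>V (aw x j)\<close> is \<open>H\<^sub>u\<^sup>j(1)\<close>, and \<open>Se\<close> and \<open>So\<close> collect the terms of \<open>B\<^sub>u\<^sub>,\<^sub>n\<close> with even and with odd \<open>j\<close>,
  the rank one terms being attached to the latter.\<close>

definition P :: "nat \<Rightarrow> nat \<Rightarrow> ell2 \<Rightarrow> ell2 \<Rightarrow> ell2" where
  "P j m x h = Cv (aw x j) (Tp (aw x m) h)"

definition Se :: "nat \<Rightarrow> ell2 \<Rightarrow> ell2 \<Rightarrow> ell2" where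
  "Se n x h = (\<Sum>l<n. P (2*l) (2*n-2-2*l) x h)"
definition So :: "nat \<Rightarrow> ell2 \<Rightarrow> ell2 \<Rightarrow> ell2" where
  "So n x h = (\<Sum>l=1..<n. P (2*l-1) (2*n-1-2*l) x h - cscale (cinner h (V (aw x (2*n-2*l-1)))) (V (aw x (2*l-1))))"
definition B :: "nat \<Rightarrow> ell2 \<Rightarrow> ell2 \<Rightarrow> ell2" where
  "B n x h = cscale (- \<i> / 4) (Se n x h + So n x h)"
definition Y :: "nat \<Rightarrow> ell2 \<Rightarrow> ell2" where
  "Y n x = (\<Sum>l<n. Cw (aw x (2*l)) (aw x (2*n-2*l-1)))"
text \<open>The factor \<open>- \<i> / 2\<close> is \<open>1 / (2 \<i>)\<close>: this is the
  Hamiltonian vector field in Sobolev coordinates.\<close>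

definition X :: "nat \<Rightarrow> ell2 \<Rightarrow> ell2" where
  "X n x = cscale (- \<i> / 2) (Y n x)"

lemmas Hk_add_right = bounded_bilinear.add_right[OF bounded_bilinear_Hk]
  and Hk_diff_right = bounded_bilinear.diff_right[OF bounded_bilinear_Hk]
  and Hk_sum_left = bounded_bilinear.sum_left[OF bounded_bilinear_Hk]
  and Hk_sum_right = bounded_bilinear.sum_right[OF bounded_bilinear_Hk]

text \<open>For \<open>j = 0\<close> the first factor is the constant 1 and the rank one term
  cancels against the term with \<open>Hk (eps 0)\<close>. For positive \<open>j\<close> the first
  factor is itself a Hankel image, so both remaining terms can be pulled inside \<open>Hk x\<close>,
  which conjugates the scalar.\<close>

lemma Hk_Cw_aw:
  "Hk (Cw (aw x j) (aw x (Suc m))) h = P j m x (Hk x h)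
     + (if j = 0 then 0 else Hk x (P (j-1) (Suc m) x h - cscale (cinner h (V (aw x (Suc m)))) (V (aw x (j-1)))))"
proof (cases j)
  case 0
  show ?thesis
    unfolding Hk_Cw using 0
    by (simp add: P_def aw_Suc Hk_Hw' Hk_eps0 cf_Tp_0 cinner_commute[of h])
next
  case (Suc i)
  have "cscale (cinner (V (aw x (Suc m))) h) (V (aw x (Suc i)))
      = Hk x (cscale (cinner h (V (aw x (Suc m)))) (V (aw x i)))"
    by (simp add: Hk_cscale_right V_aw_Suc cinner_commute[of _ h])
  moreover have "Hk (aw x (Suc m)) h = Tp (aw x m) (Hk x h)" by (simp add: aw_Suc Hk_Hw')
  moreover have "Hk (aw x (Suc i)) g = Hk x (Cv (aw x i) g)" for g by (simp add: aw_Suc Hk_Hw)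
  ultimately show ?thesis
    unfolding Hk_Cw Suc by (simp add: P_def Hk_diff_right)
qed

text \<open>The even iterate is taken as the first factor of each product: even pairs end up outside
  \<open>Hk x\<close>, odd pairs inside.\<close>

lemma Hk_Y_even: "Hk (Y n x) h = Se n x (Hk x h) + Hk x (So n x h)"
proof -
  have "Hk (Y n x) h = (\<Sum>l<n. Hk (Cw (aw x (2*l)) (aw x (Suc (2*n-2-2*l)))) h)"
    unfolding Y_def Hk_sum_left by (intro sum.cong refl) (simp add: Suc_diff_Suc)
  also have "\<dots> = (\<Sum>l<n. P (2*l) (2*n-2-2*l) x (Hk x h)) +
     (\<Sum>l<n. if l = 0 then 0 else Hk x (P (2*l-1) (2*n-1-2*l) x h - cscale (cinner h (V (aw x (2*n-2*l-1)))) (V (aw x (2*l-1)))))"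
    unfolding sum.distrib[symmetric]
  proof (intro sum.cong refl)
    fix l assume "l \<in> {..<n}"
    then have e: "Suc (2*n-2-2*l) = 2*n-1-2*l" "2*n-2*l-1 = 2*n-1-2*l" by auto
    show "Hk (Cw (aw x (2*l)) (aw x (Suc (2*n-2-2*l)))) h = P (2*l) (2*n-2-2*l) x (Hk x h) +
       (if l = 0 then 0 else Hk x (P (2*l-1) (2*n-1-2*l) x h - cscale (cinner h (V (aw x (2*n-2*l-1)))) (V (aw x (2*l-1)))))"
      unfolding Hk_Cw_aw by (simp only: e) simp
  qed
  also have "(\<Sum>l<n. if l = 0 then 0 else Hk x (P (2*l-1) (2*n-1-2*l) x h - cscale (cinner h (V (aw x (2*n-2*l-1)))) (V (aw x (2*l-1)))))
    = (\<Sum>l=1..<n. Hk x (P (2*l-1) (2*n-1-2*l) x h - cscale (cinner h (V (aw x (2*n-2*l-1)))) (V (aw x (2*l-1)))))"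
    by (rule sum.mono_neutral_cong_right) auto
  finally show ?thesis unfolding Se_def So_def Hk_sum_right .
qed

text \<open>With the factors exchanged, which commutativity of the product allows, odd pairs end up
  outside and even pairs inside. Reflecting the summation index restores the form of
  \<open>Se\<close> and \<open>So\<close>.\<close>

lemma Hk_Y_odd: "Hk (Y n x) h = So n x (Hk x h) + Hk x (Se n x h)"
proof -
  have "Hk (Y n x) h = (\<Sum>l<n. Hk x (P (2*n-2-2*l) (2*l) x h) +
     (if l = 0 then 0 else P (2*n-2*l-1) (2*l-1) x (Hk x h) - cscale (cinner (Hk x h) (V (aw x (2*l-1)))) (V (aw x (2*n-2*l-1)))))"
    unfolding Y_def Hk_sum_left
  proof (intro sum.cong refl)
    fix l assume "l \<in> {..<n}"
    then have l: "l < n" by simp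
    show "Hk (Cw (aw x (2*l)) (aw x (2*n-2*l-1))) h = Hk x (P (2*n-2-2*l) (2*l) x h) +
     (if l = 0 then 0 else P (2*n-2*l-1) (2*l-1) x (Hk x h) - cscale (cinner (Hk x h) (V (aw x (2*l-1)))) (V (aw x (2*n-2*l-1))))"
    proof (cases l)
      \<comment> \<open>The product is then the odd iterate \<open>aw x (2*n-1)\<close> alone, and
        after the exchange no second factor of positive index is available; \<open>Hk_Hw\<close>
        gives the term directly.\<close>
      case 0
      have "2*n-1 = Suc (2*n-2)" using l by simp
      then show ?thesis unfolding 0 using Hk_Hw[of x "aw x (2*n-2)" h]
        by (simp add: Cw_commute[of "eps 0"] P_def aw_Suc)
    next
      case (Suc l')
      define i where "i = 2*n-2-2*l"
      have i: "2*n-2*l-1 = Suc i" "2*n-2-2*l = i" using l by (auto simp: i_def)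
      have l2: "2*l = Suc (2*l-1)" using Suc by simp
      have c: "Hk x (cscale (cinner h (V (aw x (Suc (2*l-1))))) (V (aw x i)))
          = cscale (cinner (Hk x h) (V (aw x (2*l-1)))) (V (aw x (Suc i)))"
        using cinner_commute[of "Hk x (V (aw x (2*l-1)))" h]
        by (simp add: Hk_cscale_right V_aw_Suc cinner_Hk[of x h])
      have "Hk (Cw (aw x (2*l)) (aw x (Suc i))) h = Hk (Cw (aw x (Suc i)) (aw x (Suc (2*l-1)))) h"
        using l2 by (simp add: Cw_commute)
      also have "\<dots> = P (Suc i) (2*l-1) x (Hk x h) + Hk x (P i (Suc (2*l-1)) x h)
         - cscale (cinner (Hk x h) (V (aw x (2*l-1)))) (V (aw x (Suc i)))"
        unfolding Hk_Cw_aw by (simp only: nat.distinct if_False diff_Suc_1 Hk_diff_right c) (simp add: algebra_simps)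
      finally show ?thesis unfolding i using l2 Suc by (simp add: algebra_simps)
    qed
  qed
  also have "\<dots> = (\<Sum>l<n. Hk x (P (2*n-2-2*l) (2*l) x h)) +
     (\<Sum>l=1..<n. P (2*n-2*l-1) (2*l-1) x (Hk x h) - cscale (cinner (Hk x h) (V (aw x (2*l-1)))) (V (aw x (2*n-2*l-1))))"
  proof -
    have "(\<Sum>l<n. if l = 0 then 0 else P (2*n-2*l-1) (2*l-1) x (Hk x h) - cscale (cinner (Hk x h) (V (aw x (2*l-1)))) (V (aw x (2*n-2*l-1))))
      = (\<Sum>l=1..<n. P (2*n-2*l-1) (2*l-1) x (Hk x h) - cscale (cinner (Hk x h) (V (aw x (2*l-1)))) (V (aw x (2*n-2*l-1))))"
      by (rule sum.mono_neutral_cong_right) auto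
    then show ?thesis by (simp only: sum.distrib)
  qed
  also have "(\<Sum>l<n. Hk x (P (2*n-2-2*l) (2*l) x h)) = Hk x (Se n x h)"
    unfolding Se_def Hk_sum_right
  proof (rule sum.reindex_bij_witness[of _ "\<lambda>l. n - 1 - l" "\<lambda>l. n - 1 - l"])
    fix l assume "l \<in> {..<n}"
    then have "2 * (n - 1 - l) = 2*n-2-2*l" "2*n-2-2*(n - 1 - l) = 2*l" by auto
    then show "Hk x (P (2 * (n - 1 - l)) (2 * n - 2 - 2 * (n - 1 - l)) x h) = Hk x (P (2 * n - 2 - 2 * l) (2 * l) x h)"
      by simp
  qed auto
  also have "(\<Sum>l=1..<n. P (2*n-2*l-1) (2*l-1) x (Hk x h) - cscale (cinner (Hk x h) (V (aw x (2*l-1)))) (V (aw x (2*n-2*l-1))))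
    = So n x (Hk x h)"
    unfolding So_def
  proof (rule sum.reindex_bij_witness[of _ "\<lambda>l. n - l" "\<lambda>l. n - l"])
    fix l assume "l \<in> {1..<n}"
    then have "2 * (n - l) - 1 = 2*n-2*l-1" "2*n-1-2*(n - l) = 2*l-1" "2*n-2*(n-l)-1 = 2*l-1" by auto
    then show "P (2 * (n - l) - 1) (2 * n - 1 - 2 * (n - l)) x (Hk x h) - cscale (cinner (Hk x h) (V (aw x (2 * n - 2 * (n - l) - 1)))) (V (aw x (2 * (n - l) - 1)))
      = P (2*n-2*l-1) (2*l-1) x (Hk x h) - cscale (cinner (Hk x h) (V (aw x (2*l-1)))) (V (aw x (2*n-2*l-1)))"
      by simp
  qed auto
  finally show ?thesis by (simp add: add.commute)
qed

text \<open>The even and the odd way of factoring the products in \<open>Y\<close> give two expressions of \<open>Hk (Y n x)\<close>;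
  the commutator is their mean.\<close>

theorem lax_identity: "Hk (X n x) h = B n x (Hk x h) - Hk x (B n x h)"
proof -
  have "Hk (Y n x) h = cscale (1/2) (Hk (Y n x) h + Hk (Y n x) h)"
    unfolding cscale_add_right by (simp add: cscale_add_left[symmetric])
  also have "\<dots> = cscale (1/2) ((Se n x (Hk x h) + So n x (Hk x h)) + Hk x (Se n x h + So n x h))"
    by (subst (1) Hk_Y_even, subst Hk_Y_odd) (simp add: Hk_add_right algebra_simps)
  finally have e: "Hk (Y n x) h = \<dots>" .
  \<comment> \<open>Pulling \<open>- \<i> / 4\<close> through the antilinear \<open>Hk x\<close>
    conjugates it and so changes its sign; this turns a mean of sums into a commutator.\<close>
  show ?thesis
    unfolding X_def B_def Hk_cscale_left Hk_cscale_right e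
    by (simp add: cscale_add_right cscale_minus_left)
qed

section \<open>Skew-adjointness of B and its value at the constant 1\<close>

lemma cinner_P: "cinner (P j m x h) g = cinner h (P m j x g)"
proof -
  have "cinner (P j m x h) g = cinner (Tp (aw x m) h) (Tp (aw x j) g)" by (simp add: P_def cinner_Cv)
  also have "\<dots> = cnj (cinner (Tp (aw x j) g) (Tp (aw x m) h))" by (rule cinner_commute)
  also have "\<dots> = cnj (cinner (P m j x g) h)" by (simp add: P_def cinner_Cv)
  also have "\<dots> = cinner h (P m j x g)" by (rule cinner_commute[symmetric])
  finally show ?thesis .
qed

text \<open>Taking adjoints swaps the two indices of \<open>P\<close>; as these add up to
  \<open>2*n-2\<close>, the reflection of \<open>l\<close> maps the sum to itself.\<close>

lemma cinner_Se: "cinner (Se n x h) g = cinner h (Se n x g)"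
  unfolding Se_def cinner_sum_left cinner_sum_right cinner_P
proof (rule sum.reindex_bij_witness[of _ "\<lambda>l. n - 1 - l" "\<lambda>l. n - 1 - l"])
  fix l assume "l \<in> {..<n}"
  then have "2 * (n - 1 - l) = 2*n-2-2*l" "2*n-2-2*(n - 1 - l) = 2*l" by auto
  then show "cinner h (P (2 * (n - 1 - l)) (2 * n - 2 - 2 * (n - 1 - l)) x g) = cinner h (P (2 * n - 2 - 2 * l) (2 * l) x g)"
    by simp
qed auto

lemma cinner_So: "cinner (So n x h) g = cinner h (So n x g)"
  unfolding So_def cinner_sum_left cinner_sum_right cinner_diff_left cinner_diff_right cinner_P cinner_cscale_left cinner_cscale_right
proof (rule sum.reindex_bij_witness[of _ "\<lambda>l. n - l" "\<lambda>l. n - l"])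
  fix l assume "l \<in> {1..<n}"
  then have "2 * (n - l) - 1 = 2*n-2*l-1" "2*n-1-2*(n - l) = 2*l-1" "2*n-2*(n-l)-1 = 2*l-1" "2*n-1-2*l = 2*n-2*l-1" by auto
  then show "cinner h (P (2 * (n - l) - 1) (2 * n - 1 - 2 * (n - l)) x g) - cnj (cinner g (V (aw x (2 * n - 2 * (n - l) - 1)))) * cinner h (V (aw x (2 * (n - l) - 1)))
    = cinner h (P (2 * n - 1 - 2 * l) (2 * l - 1) x g) - cinner h (V (aw x (2 * n - 2 * l - 1))) * cinner (V (aw x (2 * l - 1))) g"
    by (simp add: cinner_commute[of g] mult.commute)
qed auto

lemma cinner_B: "cinner (B n x h) g = - cinner h (B n x g)"
  by (simp add: B_def cinner_cscale_left cinner_cscale_right cinner_add_left cinner_add_right cinner_Se cinner_So)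

lemma inner_B: "B n x h \<bullet> g = - (h \<bullet> B n x g)"
  by (simp add: inner_ell2_def cinner_B)

lemma V_linear: "V (x + y) = V x + V y" "V 0 = 0"
  using bounded_linear.linear[OF bounded_linear_V] by (simp_all add: linear_add linear_0)

text \<open>On the constant 1 the Toeplitz operator returns a constant, so \<open>P\<close> reduces
  to a rank one term. In \<open>So\<close> it cancels the subtracted term exactly, and only even
  iterates remain.\<close>

lemma B_eps0: "B n x (eps 0) = cscale (- \<i> / 4) (\<Sum>l<n. cscale (cinner (eps 0) (V (aw x (2*n-2-2*l)))) (V (aw x (2*l))))"
proof -
  have "P j m x (eps 0) = cscale (cinner (eps 0) (V (aw x m))) (V (aw x j))" for j m
    by (simp add: P_def Tp_eps0_right Cv_cscale_right Cv_eps0)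
  moreover have "2*n-1-2*l = 2*n-2*l-1" for l by simp
  ultimately have "So n x (eps 0) = 0" "Se n x (eps 0) = (\<Sum>l<n. cscale (cinner (eps 0) (V (aw x (2*n-2-2*l)))) (V (aw x (2*l))))"
    by (simp_all only: So_def Se_def diff_self sum.neutral_const)
  then show ?thesis by (simp add: B_def)
qed

lemma cinner_aw_swap: "cinner (V (aw x (Suc i))) (V (aw x j)) = cnj (cinner (V (aw x i)) (V (aw x (Suc j))))"
  by (simp add: V_aw_Suc cinner_Hk[of x "V (aw x i)"] cinner_commute[of "Hk x (V (aw x j))"])

text \<open>Two applications of the antilinear symmetry conjugate twice, so the square of
  \<open>Hk x\<close> is self-adjoint.\<close>

lemma cinner_aw_shift2: "cinner (V (aw x (i + 2*k))) (V (aw x j)) = cinner (V (aw x i)) (V (aw x (j + 2*k)))"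
proof (induction k arbitrary: j)
  case (Suc k)
  have "cinner (V (aw x (i + 2 * Suc k))) (V (aw x j)) = cinner (V (aw x (i + 2*k))) (V (aw x (Suc (Suc j))))"
    using cinner_aw_swap[of x "Suc (i+2*k)" j] cinner_aw_swap[of x "i+2*k" "Suc j"] by simp
  then show ?case using Suc[of "Suc (Suc j)"] by simp
qed simp

text \<open>All even powers can be moved to either side of the constant 1, which makes the value
  equal to its own conjugate.\<close>

lemma cinner_aw_even_real: "Im (cinner (V (aw x (2*p))) (V (aw x (2*l)))) = 0"
proof -
  have "cinner (V (aw x (2*p))) (V (aw x (2*l))) = cinner (V (aw x (0 + 2*p))) (V (aw x (2*l)))" by simp
  also have "\<dots> = cinner (V (aw x 0)) (V (aw x (2*l + 2*p)))" by (rule cinner_aw_shift2)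
  also have "\<dots> = cinner (V (aw x (0 + 2*(l+p)))) (V (aw x 0))" unfolding cinner_aw_shift2 by simp
  also have "\<dots> = cnj (cinner (V (aw x 0)) (V (aw x (2*l + 2*p))))"
    by (subst cinner_commute) (simp add: algebra_simps)
  finally have "cinner (V (aw x 0)) (V (aw x (2*l + 2*p))) = cnj (cinner (V (aw x 0)) (V (aw x (2*l + 2*p))))"
    using cinner_aw_shift2[of x 0 p "2*l"] by simp
  then have "Im (cinner (V (aw x 0)) (V (aw x (2*l + 2*p)))) = 0"
    by (simp add: complex_eq_iff)
  then show ?thesis using cinner_aw_shift2[of x 0 p "2*l"] by simp
qed

section \<open>Derivatives of the Hamiltonians and their commutation\<close>

primrec daw :: "ell2 \<Rightarrow> ell2 \<Rightarrow> nat \<Rightarrow> ell2" where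
  "daw x h 0 = 0"
| "daw x h (Suc j) = Hw x (daw x h j) + Hw h (aw x j)"

lemma aw_has_derivative:
  assumes "(\<gamma> has_vector_derivative h) (at t within T)"
  shows "((\<lambda>t. aw (\<gamma> t) j) has_vector_derivative daw (\<gamma> t) h j) (at t within T)"
proof (induction j)
  case (Suc j)
  show ?case unfolding aw_Suc daw.simps
    by (rule bounded_bilinear.has_vector_derivative[OF bounded_bilinear_Hw assms Suc])
qed simp

lemma V_daw_Suc: "V (daw x h (Suc j)) = Hk x (V (daw x h j)) + Hk h (V (aw x j))"
  by (simp add: V_linear V_Hw)

text \<open>Each term of the product rule has one \<open>Hk h\<close> between powers of
  \<open>Hk x\<close>. Symmetry for the real inner product moves the outer powers to the other side,
  and \<open>Hk h a\<close> paired with \<open>b\<close> becomes \<open>h\<close> paired with the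
  product of \<open>a\<close> and \<open>b\<close>.\<close>

lemma inner_V_daw:
  "inner (V (daw x h j)) (V (aw x i)) = (\<Sum>k<j. inner (V h) (V (Cw (aw x (j - 1 - k)) (aw x (i + k)))))"
proof (induction j arbitrary: i)
  case (Suc j)
  have "Hk h (V a) \<bullet> V b = V h \<bullet> V (Cw a b)" for a b
  proof -
    have "V (Cw a b) = Cv a (V b)" by (rule ell2_eqI) (simp add: cf_V U_Cw cf_Cv)
    moreover have "Hk h (V a) = Tp a (V h)" by (rule ell2_eqI) (simp add: cf_Hk cf_Tp cf_V)
    ultimately show ?thesis
      using cinner_Cv[of a "V b" "V h"] cinner_commute[of "V h"] unfolding inner_ell2_def
      by (metis complex_cnj_cnj complex_cnj_cancel_iff cinner_commute)
  qed
  then have "inner (V (daw x h (Suc j))) (V (aw x i)) = inner (V (daw x h j)) (V (aw x (Suc i))) + inner (V h) (V (Cw (aw x j) (aw x i)))"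
    unfolding V_daw_Suc by (simp add: inner_add_left inner_Hk V_aw_Suc)
  also have "\<dots> = (\<Sum>k<Suc j. inner (V h) (V (Cw (aw x (Suc j - 1 - k)) (aw x (i + k)))))"
    unfolding Suc by (subst sum.lessThan_Suc_shift) (simp add: diff_diff_add)
  finally show ?case .
qed (simp add: V_linear)

lemma sum_pairs: "(\<Sum>k<2*n. f k) = (\<Sum>l<n. f (2*l)) + (\<Sum>l<n. f (2*l+1))" for f :: "nat \<Rightarrow> real"
  by (induction n) simp_all

text \<open>This is the derivative of \<open>J (2*n)\<close> in the direction \<open>h\<close>. Even
  and odd summation indices contribute equally, each the pairing of \<open>h\<close> with
  \<open>Y\<close>, and \<open>Y = 2 \<i> X\<close> turns the real part into an imaginary
  part.\<close>

lemma inner_V_daw_eps0: "inner (V (daw x h (2*n))) (eps 0) = 4 * Im (cinner (V h) (V (X n x)))"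
proof -
  have lV: "V (sum f I) = (\<Sum>i\<in>I. V (f i))" for f :: "nat \<Rightarrow> ell2" and I
    by (rule linear_sum[OF bounded_linear.linear[OF bounded_linear_V]])
  have "inner (V (daw x h (2*n))) (eps 0) = (\<Sum>k<2*n. inner (V h) (V (Cw (aw x (2*n - 1 - k)) (aw x k))))"
    using inner_V_daw[of x h "2*n" 0] by simp
  also have "\<dots> = (\<Sum>l<n. inner (V h) (V (Cw (aw x (2*n - 1 - 2*l)) (aw x (2*l)))))
      + (\<Sum>l<n. inner (V h) (V (Cw (aw x (2*n - 1 - (2*l+1))) (aw x (2*l+1)))))"
    by (rule sum_pairs)
  also have "(\<Sum>l<n. inner (V h) (V (Cw (aw x (2*n - 1 - 2*l)) (aw x (2*l))))) = inner (V h) (V (Y n x))"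
    unfolding Y_def lV inner_sum_right by (intro sum.cong refl) (simp add: Cw_commute diff_diff_add add.commute)
  also have "(\<Sum>l<n. inner (V h) (V (Cw (aw x (2*n - 1 - (2*l+1))) (aw x (2*l+1))))) = inner (V h) (V (Y n x))"
    unfolding Y_def lV inner_sum_right
  proof (rule sum.reindex_bij_witness[of _ "\<lambda>l. n - 1 - l" "\<lambda>l. n - 1 - l"])
    fix l assume "l \<in> {..<n}"
    then have "2 * (n - 1 - l) = 2*n - 1 - (2*l+1)" "2*n - 2*(n - 1 - l) - 1 = 2*l+1" by auto
    then show "V h \<bullet> V (Cw (aw x (2 * (n - 1 - l))) (aw x (2 * n - 2 * (n - 1 - l) - 1)))
      = V h \<bullet> V (Cw (aw x (2 * n - 1 - (2 * l + 1))) (aw x (2 * l + 1)))" by simp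
  qed auto
  also have "V (Y n x) = cscale (2 * \<i>) (V (X n x))"
    by (simp add: X_def V_cscale)
  finally show ?thesis by (simp add: inner_ell2_def cinner_cscale_right)
qed

text \<open>Along the Hamiltonian direction the Lax identity telescopes: differentiating a power of
  the Hankel operator gives its commutator with \<open>B\<close>, here applied to the constant
  1.\<close>

lemma V_daw_X: "V (daw x (X n x) j) = B n x (V (aw x j)) - (Hk x ^^ j) (B n x (eps 0))"
proof (induction j)
  case (Suc j)
  show ?case unfolding V_daw_Suc Suc lax_identity by (simp add: Hk_diff_right V_aw_Suc)
qed (simp add: V_linear)

lemma inner_Hk_pow: "(Hk x ^^ j) v \<bullet> b = v \<bullet> (Hk x ^^ j) b"
proof (induction j arbitrary: b)
  case (Suc j)
  then show ?case by (simp add: inner_Hk) (metis funpow_swap1)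
qed simp

theorem poisson_commute_V: "Im (cinner (V (X n x)) (V (X p x))) = 0"
proof -
  \<comment> \<open>The direction \<open>h = X n x\<close> makes the bracket the derivative of
    \<open>J (2*p)\<close> along the field of \<open>J (2*n)\<close>.\<close>
  have "4 * Im (cinner (V (X n x)) (V (X p x))) = inner (V (daw x (X n x) (2*p))) (eps 0)"
    by (simp add: inner_V_daw_eps0)
  also have "\<dots> = B n x (V (aw x (2*p))) \<bullet> eps 0 - B n x (eps 0) \<bullet> V (aw x (2*p))"
    unfolding V_daw_X inner_diff_left inner_Hk_pow by (simp add: V_aw)
  also have "\<dots> = - 2 * (V (aw x (2*p)) \<bullet> B n x (eps 0))"
    by (simp add: inner_B inner_commute)
  also have "V (aw x (2*p)) \<bullet> B n x (eps 0) = 0"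
  proof -
    have "Re (\<i> * (cnj (cinner (eps 0) (V (aw x (2*n-2-2*l)))) * cinner (V (aw x (2*p))) (V (aw x (2*l))))) = 0" if "l < n" for l
    proof -
      have "2*n-2-2*l = 2*(n-1-l)" using that by simp
      then have "Im (cinner (eps 0) (V (aw x (2*n-2-2*l)))) = 0"
        using cinner_aw_even_real[of x 0 "n-1-l"] by simp
      then show ?thesis using cinner_aw_even_real[of x p l] by simp
    qed
    then show ?thesis unfolding B_eps0 inner_ell2_def cinner_cscale_right cinner_sum_right
      by (simp add: sum_distrib_left[symmetric] Re_sum)
  qed
  finally show ?thesis by simp
qed

end

section \<open>Global solutions\<close>

text \<open>Chosen because it is stable under sums and bounded bilinear maps, hence holds for
  polynomial fields, and because it yields continuity and boundedness on balls.\<close>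

definition lipschitz_on_balls :: "('a::real_normed_vector \<Rightarrow> 'b::real_normed_vector) \<Rightarrow> bool" where
  "lipschitz_on_balls F \<longleftrightarrow> (\<forall>R. \<exists>L\<ge>0. \<forall>x y. norm x \<le> R \<longrightarrow> norm y \<le> R \<longrightarrow> norm (F x - F y) \<le> L * norm (x - y))"

lemma lipschitz_on_ballsE:
  assumes "lipschitz_on_balls F"
  obtains L where "L \<ge> 0" "\<And>x y. norm x \<le> R \<Longrightarrow> norm y \<le> R \<Longrightarrow> norm (F x - F y) \<le> L * norm (x - y)"
  using assms unfolding lipschitz_on_balls_def by blast

lemma lipschitz_on_balls_bounded:
  assumes "lipschitz_on_balls F"
  obtains M where "M \<ge> 0" "\<And>x. norm x \<le> R \<Longrightarrow> norm (F x) \<le> M"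
proof -
  obtain L where L: "L \<ge> 0" "\<And>x y. norm x \<le> \<bar>R\<bar> \<Longrightarrow> norm y \<le> \<bar>R\<bar> \<Longrightarrow> norm (F x - F y) \<le> L * norm (x - y)"
    using lipschitz_on_ballsE[OF assms] by blast
  have "norm (F x) \<le> norm (F 0) + L * \<bar>R\<bar>" if "norm x \<le> R" for x
  proof -
    have "norm (F x - F 0) \<le> L * norm x" using L(2)[of x 0] that by simp
    also have "\<dots> \<le> L * \<bar>R\<bar>" using that L(1) by (intro mult_left_mono) auto
    finally have "norm (F x - F 0) \<le> L * \<bar>R\<bar>" .
    then show ?thesis using norm_triangle_ineq2[of "F x" "F 0"] by linarith
  qed
  then show ?thesis using that[of "norm (F 0) + L * \<bar>R\<bar>"] L(1) by simp
qed

lemma lipschitz_on_balls_const: "lipschitz_on_balls (\<lambda>x. c)"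
  and lipschitz_on_balls_id: "lipschitz_on_balls (\<lambda>x. x)"
  unfolding lipschitz_on_balls_def by (auto intro: exI[of _ 0] exI[of _ 1])

lemma lipschitz_on_balls_add:
  assumes "lipschitz_on_balls F" "lipschitz_on_balls G" shows "lipschitz_on_balls (\<lambda>x. F x + G x)"
  unfolding lipschitz_on_balls_def
proof
  fix R
  obtain L where L: "L \<ge> 0" "\<And>x y. norm x \<le> R \<Longrightarrow> norm y \<le> R \<Longrightarrow> norm (F x - F y) \<le> L * norm (x - y)"
    using lipschitz_on_ballsE[OF assms(1)] by blast
  obtain L' where L': "L' \<ge> 0" "\<And>x y. norm x \<le> R \<Longrightarrow> norm y \<le> R \<Longrightarrow> norm (G x - G y) \<le> L' * norm (x - y)"
    using lipschitz_on_ballsE[OF assms(2)] by blast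
  have "norm (F x + G x - (F y + G y)) \<le> (L + L') * norm (x - y)" if "norm x \<le> R" "norm y \<le> R" for x y
    using norm_triangle_ineq[of "F x - F y" "G x - G y"] L(2)[OF that] L'(2)[OF that]
    by (simp add: algebra_simps)
  then show "\<exists>L\<ge>0. \<forall>x y. norm x \<le> R \<longrightarrow> norm y \<le> R \<longrightarrow> norm (F x + G x - (F y + G y)) \<le> L * norm (x - y)"
    using L(1) L'(1) by (intro exI[of _ "L + L'"]) auto
qed

lemma lipschitz_on_balls_sum:
  "(\<And>i. i \<in> I \<Longrightarrow> lipschitz_on_balls (F i)) \<Longrightarrow> lipschitz_on_balls (\<lambda>x. \<Sum>i\<in>I. F i x)"
  by (induction I rule: infinite_finite_induct) (auto intro: lipschitz_on_balls_add lipschitz_on_balls_const)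

lemma lipschitz_on_balls_bilinear:
  assumes p: "bounded_bilinear p" and F: "lipschitz_on_balls F" and G: "lipschitz_on_balls G"
  shows "lipschitz_on_balls (\<lambda>x. p (F x) (G x))"
  unfolding lipschitz_on_balls_def
proof
  fix R
  interpret p: bounded_bilinear p by (rule p)
  obtain L where L: "L \<ge> 0" "\<And>x y. norm x \<le> R \<Longrightarrow> norm y \<le> R \<Longrightarrow> norm (F x - F y) \<le> L * norm (x - y)"
    using lipschitz_on_ballsE[OF F] by blast
  obtain L' where L': "L' \<ge> 0" "\<And>x y. norm x \<le> R \<Longrightarrow> norm y \<le> R \<Longrightarrow> norm (G x - G y) \<le> L' * norm (x - y)"
    using lipschitz_on_ballsE[OF G] by blast
  obtain M where M: "M \<ge> 0" "\<And>x. norm x \<le> R \<Longrightarrow> norm (F x) \<le> M" using lipschitz_on_balls_bounded[OF F] by blast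
  obtain M' where M': "M' \<ge> 0" "\<And>x. norm x \<le> R \<Longrightarrow> norm (G x) \<le> M'" using lipschitz_on_balls_bounded[OF G] by blast
  obtain C where C: "C > 0" "\<And>a b. norm (p a b) \<le> norm a * norm b * C" using p.pos_bounded by blast
  have "norm (p (F x) (G x) - p (F y) (G y)) \<le> ((L * M' + M * L') * C) * norm (x - y)"
    if xy: "norm x \<le> R" "norm y \<le> R" for x y
  proof -
    have "p (F x) (G x) - p (F y) (G y) = p (F x - F y) (G x) + p (F y) (G x - G y)"
      by (simp add: p.diff_left p.diff_right)
    also have "norm \<dots> \<le> norm (F x - F y) * norm (G x) * C + norm (F y) * norm (G x - G y) * C"
      by (intro order_trans[OF norm_triangle_ineq] add_mono C)
    also have "\<dots> \<le> (L * norm (x - y)) * M' * C + M * (L' * norm (x - y)) * C"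
      using xy L L' M M' C by (intro add_mono mult_right_mono mult_mono) auto
    finally show ?thesis by (simp add: algebra_simps)
  qed
  then show "\<exists>L\<ge>0. \<forall>x y. norm x \<le> R \<longrightarrow> norm y \<le> R \<longrightarrow> norm (p (F x) (G x) - p (F y) (G y)) \<le> L * norm (x - y)"
    using L(1) L'(1) M(1) M'(1) C(1) by (intro exI[of _ "(L * M' + M * L') * C"]) auto
qed

lemma lipschitz_on_balls_continuous:
  fixes F :: "'a::real_normed_vector \<Rightarrow> 'b::real_normed_vector"
  assumes "lipschitz_on_balls F" shows "continuous_on UNIV F"
proof (rule continuous_at_imp_continuous_on, rule ballI)
  fix x :: 'a
  obtain L where L: "L \<ge> 0" "\<And>y z. norm y \<le> norm x + 1 \<Longrightarrow> norm z \<le> norm x + 1 \<Longrightarrow> norm (F y - F z) \<le> L * norm (y - z)"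
    using lipschitz_on_ballsE[OF assms] by blast
  have "\<forall>\<^sub>F y in at x. norm (F y - F x) \<le> L * norm (y - x)"
    unfolding eventually_at
  proof (intro exI[of _ 1] conjI ballI impI)
    fix y assume "y \<noteq> x \<and> dist y x < 1"
    then have "norm y \<le> norm x + 1" using norm_triangle_ineq2[of y x] by (simp add: dist_norm)
    then show "norm (F y - F x) \<le> L * norm (y - x)" by (intro L(2)) auto
  qed simp
  moreover have "((\<lambda>y. L * norm (y - x)) \<longlongrightarrow> 0) (at x)"
    by (auto intro!: tendsto_eq_intros)
  ultimately have "((\<lambda>y. F y - F x) \<longlongrightarrow> 0) (at x)" by (rule Lim_null_comparison)
  then show "isCont F x" unfolding isCont_def by (simp add: LIM_zero_iff)
qed

context sobolev begin

lemma lipschitz_aw: "lipschitz_on_balls (\<lambda>x. aw x j)"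
  by (induction j)
     (auto simp: aw_Suc intro: lipschitz_on_balls_const lipschitz_on_balls_id lipschitz_on_balls_bilinear[OF bounded_bilinear_Hw])

lemma lipschitz_X: "lipschitz_on_balls (X n)"
  unfolding X_def[abs_def] Y_def
  by (intro lipschitz_on_balls_bilinear[OF bounded_bilinear_cscale] lipschitz_on_balls_const lipschitz_on_balls_sum
      lipschitz_on_balls_bilinear[OF bounded_bilinear_Cw] lipschitz_aw)

lemma continuous_on_aw: "continuous_on T f \<Longrightarrow> continuous_on T (\<lambda>t. aw (f t) j)"
  using continuous_on_compose2[OF lipschitz_on_balls_continuous[OF lipschitz_aw]] by blast

lemma continuous_on_B:
  assumes f: "continuous_on T f" and g: "continuous_on T g"
  shows "continuous_on T (\<lambda>t. B n (f t) (g t))"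
  unfolding B_def Se_def So_def P_def
  by (intro bounded_linear.continuous_on[OF bounded_linear_cscale] continuous_on_add continuous_on_sum continuous_on_diff
     bounded_bilinear.continuous_on[OF bounded_bilinear_Cv] bounded_bilinear.continuous_on[OF bounded_bilinear_Tp]
     bounded_bilinear.continuous_on[OF bounded_bilinear_cscale] bounded_bilinear.continuous_on[OF bounded_bilinear_cinner]
     bounded_linear.continuous_on[OF bounded_linear_V] continuous_on_aw f g)

section \<open>Bounds by powers of the Wiener norm\<close>

lemma norm_eps [simp]: "norm (eps m) = 1"
proof -
  have "complex_of_real ((norm (eps m))\<^sup>2) = of_real 1"
    by (simp only: cinner_self_norm[symmetric] cinner_eps) simp
  then have "(norm (eps m))\<^sup>2 = 1" by (simp only: of_real_eq_iff)
  then show ?thesis using norm_ge_zero[of "eps m"] by (auto simp: power2_eq_1_iff)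
qed

lemma n1_aw: "n1 (U (aw x j)) \<le> n1 (U x) ^ j"
proof (induction j)
  case 0
  have "((\<lambda>k. cmod (cf (eps 0) k)) has_sum 1) UNIV"
    by (rule has_sum_finite_neutralI[of "{0}"]) auto
  then show ?case by (simp add: n1_def U_eps0 infsumI)
next
  case (Suc j)
  have "n1 (U (aw x (Suc j))) \<le> n1 (U (aw x j)) * n1 (U x)" unfolding aw_Suc by (rule n1_Hw)
  also have "\<dots> \<le> n1 (U x) ^ j * n1 (U x)" by (intro mult_right_mono Suc n1_nonneg)
  finally show ?case by (simp add: mult.commute)
qed

lemma norm_V_aw: "norm (V (aw x j)) \<le> n1 (U x) ^ j"
proof (induction j)
  case (Suc j)
  have "norm (V (aw x (Suc j))) \<le> n1 (U x) * norm (V (aw x j))" unfolding V_aw_Suc by (rule norm_Hk)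
  also have "\<dots> \<le> n1 (U x) * n1 (U x) ^ j" by (intro mult_left_mono Suc n1_nonneg)
  finally show ?case by simp
qed simp

lemma norm_P: "norm (P j m x h) \<le> n1 (U x) ^ (j + m) * norm h"
proof -
  have "norm (P j m x h) \<le> n1 (U (aw x j)) * norm (Tp (aw x m) h)" unfolding P_def by (rule norm_Cv)
  also have "\<dots> \<le> n1 (U (aw x j)) * (n1 (U (aw x m)) * norm h)" by (intro mult_left_mono norm_Tp n1_nonneg)
  also have "\<dots> \<le> n1 (U x) ^ j * (n1 (U x) ^ m * norm h)"
    by (intro mult_mono n1_aw mult_right_mono mult_nonneg_nonneg n1_nonneg zero_le_power norm_ge_zero)
  finally show ?thesis by (simp add: power_add mult.assoc)
qed

text \<open>Linearity in \<open>h\<close> is what the transport of orthonormal families needs. There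
  are \<open>n\<close> even terms and \<open>n - 1\<close> odd ones, the latter counted twice for
  their rank one parts; the constant comes from \<open>3 * n / 4 \<le> n\<close>.\<close>

lemma norm_B: "norm (B n x h) \<le> real n * n1 (U x) ^ (2*n-2) * norm h"
proof -
  let ?q = "n1 (U x) ^ (2*n-2) * norm h"
  have q0: "?q \<ge> 0" by (simp add: n1_nonneg)
  have "norm (Se n x h) \<le> (\<Sum>l<n. ?q)"
    unfolding Se_def
  proof (rule sum_norm_le)
    fix l assume "l \<in> {..<n}"
    then have e: "2*l + (2*n-2-2*l) = 2*n-2" by auto
    show "norm (P (2*l) (2*n-2-2*l) x h) \<le> ?q" using norm_P[of "2*l" "2*n-2-2*l" x h] unfolding e .
  qed
  moreover have "norm (So n x h) \<le> (\<Sum>l=1..<n. 2 * ?q)"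
    unfolding So_def
  proof (rule sum_norm_le)
    fix l assume l: "l \<in> {1..<n}"
    then have e: "2*l-1 + (2*n-1-2*l) = 2*n-2" "2*n-2*l-1 = 2*n-1-2*l" by auto
    have "norm (cscale (cinner h (V (aw x (2*n-2*l-1)))) (V (aw x (2*l-1)))) \<le> (norm h * norm (V (aw x (2*n-2*l-1)))) * norm (V (aw x (2*l-1)))"
      unfolding norm_cscale by (intro mult_right_mono cinner_bound) auto
    also have "\<dots> \<le> (norm h * n1 (U x) ^ (2*n-2*l-1)) * n1 (U x) ^ (2*l-1)"
      by (intro mult_mono mult_left_mono norm_V_aw mult_nonneg_nonneg zero_le_power n1_nonneg norm_ge_zero)
    also have "\<dots> = ?q" unfolding e(1)[symmetric] power_add e(2) by (simp add: mult_ac)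
    finally have "norm (cscale (cinner h (V (aw x (2*n-2*l-1)))) (V (aw x (2*l-1)))) \<le> ?q" .
    moreover have "norm (P (2*l-1) (2*n-1-2*l) x h) \<le> ?q" using norm_P[of "2*l-1" "2*n-1-2*l" x h] unfolding e .
    ultimately show "norm (P (2*l-1) (2*n-1-2*l) x h - cscale (cinner h (V (aw x (2*n-2*l-1)))) (V (aw x (2*l-1)))) \<le> 2 * ?q"
      using norm_triangle_ineq4[of "P (2*l-1) (2*n-1-2*l) x h" "cscale (cinner h (V (aw x (2*n-2*l-1)))) (V (aw x (2*l-1)))"] by linarith
  qed
  moreover have "norm (B n x h) \<le> (norm (Se n x h) + norm (So n x h)) / 4"
    unfolding B_def norm_cscale using norm_triangle_ineq[of "Se n x h" "So n x h"] by (simp add: norm_divide)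
  ultimately have "norm (B n x h) \<le> (real n * ?q + real (n - 1) * (2 * ?q)) / 4" by simp
  also have "\<dots> \<le> (real n * ?q + real n * (2 * ?q)) / 4"
    using q0 by (intro divide_right_mono add_left_mono mult_right_mono) auto
  also have "real n * (2 * ?q) = 2 * (real n * ?q)" by simp
  also have "(real n * ?q + 2 * (real n * ?q)) / 4 \<le> real n * ?q"
    using mult_nonneg_nonneg[OF of_nat_0_le_iff[of n] q0] by argo
  finally show ?thesis by (simp add: mult.assoc)
qed

lemma B_diff: "B n x h - B n x h' = B n x (h - h')"
  unfolding B_def Se_def So_def P_def
  by (simp add: bounded_bilinear.diff_right[OF bounded_bilinear_Tp] bounded_bilinear.diff_right[OF bounded_bilinear_Cv]
     cinner_diff_left cscale_diff_left cscale_diff_right[symmetric] sum_subtractf[symmetric])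
     (simp add: cscale_diff_right[symmetric] sum_subtractf sum.distrib algebra_simps)

lemma norm_aw_Suc: "norm (aw x (Suc j)) \<le> n1 (U x) ^ j * norm x"
proof -
  have "norm (aw x (Suc j)) \<le> n1 (U (aw x j)) * norm x" unfolding aw_Suc by (rule norm_Hw)
  also have "\<dots> \<le> n1 (U x) ^ j * norm x" by (intro mult_right_mono n1_aw) auto
  finally show ?thesis .
qed

text \<open>One term of the product estimate contains the Sobolev norm of the first iterate. For
  \<open>j = 0\<close> this is the constant 1, whose norm carries no factor \<open>norm x\<close>;
  one Wiener factor is then traded for \<open>K * norm x\<close>, which explains
  \<open>1 + K\<close>.\<close>

lemma norm_Cw_aw: "norm (Cw (aw x j) (aw x (Suc m))) \<le> 2 powr s * ((2 + K) * (n1 (U x) ^ (j + m) * norm x))"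
proof -
  let ?q = "n1 (U x) ^ (j + m) * norm x"
  have a: "n1 (U (aw x (Suc m))) * norm (aw x j) \<le> (1 + K) * ?q"
  proof (cases j)
    case 0
    have "n1 (U (aw x (Suc m))) \<le> n1 (U x) ^ m * n1 (U x)" using n1_aw[of x "Suc m"] by (simp add: mult.commute)
    also have "\<dots> \<le> n1 (U x) ^ m * (K * norm x)" by (intro mult_left_mono n1_U_le zero_le_power n1_nonneg)
    also have "\<dots> \<le> (1 + K) * ?q"
      using 0 mult_nonneg_nonneg[OF zero_le_power[OF n1_nonneg[of "U x"]] norm_ge_zero[of x], of m] by (simp add: algebra_simps)
    finally show ?thesis using 0 by simp
  next
    case (Suc i)
    have "n1 (U (aw x (Suc m))) * norm (aw x j) \<le> n1 (U x) ^ Suc m * (n1 (U x) ^ i * norm x)"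
      unfolding Suc by (intro mult_mono n1_aw norm_aw_Suc zero_le_power n1_nonneg norm_ge_zero)
    also have "\<dots> = ?q" using Suc by (simp add: power_add mult_ac)
    also have "\<dots> \<le> (1 + K) * ?q"
      using mult_right_mono[of 1 "1 + K" ?q] K_nonneg by (simp add: n1_nonneg)
    finally show ?thesis .
  qed
  have b: "n1 (U (aw x j)) * norm (aw x (Suc m)) \<le> ?q"
  proof -
    have "n1 (U (aw x j)) * norm (aw x (Suc m)) \<le> n1 (U x) ^ j * (n1 (U x) ^ m * norm x)"
      by (intro mult_mono n1_aw norm_aw_Suc zero_le_power n1_nonneg norm_ge_zero)
    then show ?thesis by (simp add: power_add mult.assoc)
  qed
  have "norm (Cw (aw x j) (aw x (Suc m))) \<le> 2 powr s * ((1 + K) * ?q + ?q)"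
    using a b by (intro order_trans[OF norm_Cw] mult_left_mono add_mono) auto
  also have "(1 + K) * ?q + ?q = (2 + K) * ?q" by (simp add: algebra_simps)
  finally show ?thesis .
qed

text \<open>The tame estimate: linear in the Sobolev norm once the Wiener norm is controlled.\<close>

lemma norm_X: "norm (X n x) \<le> (real n * (2 powr s * (2 + K))) * n1 (U x) ^ (2*n-2) * norm x"
proof -
  let ?c = "2 powr s * ((2 + K) * (n1 (U x) ^ (2*n-2) * norm x))"
  have c0: "?c \<ge> 0" using K_nonneg by (simp add: n1_nonneg)
  have "norm (Y n x) \<le> (\<Sum>l<n. ?c)"
    unfolding Y_def
  proof (rule sum_norm_le)
    fix l assume "l \<in> {..<n}"
    then have e: "2*n-2*l-1 = Suc (2*n-2-2*l)" "2*l + (2*n-2-2*l) = 2*n-2" by auto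
    show "norm (Cw (aw x (2*l)) (aw x (2*n-2*l-1))) \<le> ?c"
      using norm_Cw_aw[of x "2*l" "2*n-2-2*l"] unfolding e .
  qed
  moreover have "norm (X n x) = norm (Y n x) / 2" by (simp add: X_def norm_divide)
  ultimately have "norm (X n x) \<le> real n * ?c" using mult_nonneg_nonneg[OF of_nat_0_le_iff[of n] c0] by simp
  then show ?thesis by (simp add: mult_ac)
qed

section \<open>Trace norm and the a priori bound\<close>

lemma cf_Hk_eps: "cf (Hk x (eps m)) k = U x (k + m)"
proof -
  have "((\<lambda>l. U x (k + l) * cnj (cf (eps m) l)) has_sum U x (k + m)) UNIV"
    by (rule has_sum_finite_neutralI[of "{m}"]) auto
  then show ?thesis unfolding cf_Hk corr_def by (rule infsumI)
qed

text \<open>Column \<open>m\<close> of the Hankel matrix is the coefficient sequence shifted by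
  \<open>m\<close>, and monotonicity of \<open>w\<close> leaves the factor \<open>1 / w m\<close>,
  which is summable.\<close>

lemma norm_Hk_eps: "norm (Hk x (eps m)) \<le> (1 / w m) * norm x"
proof (rule norm_ell2_leI)
  fix F :: "nat set" assume F: "finite F"
  have "(\<Sum>k\<in>F. (cmod (cf (Hk x (eps m)) k))\<^sup>2) \<le> (\<Sum>k\<in>F. (1 / w m)\<^sup>2 * (cmod (cf x (k + m)))\<^sup>2)"
  proof (rule sum_mono)
    fix k
    have "cmod (cf (Hk x (eps m)) k) \<le> (1 / w m) * cmod (cf x (k + m))"
      unfolding cf_Hk_eps U_def norm_divide using w_mono[of m "k + m"]
      by (auto intro!: mult_right_mono frac_le simp: divide_inverse mult.commute)
    then show "(cmod (cf (Hk x (eps m)) k))\<^sup>2 \<le> (1 / w m)\<^sup>2 * (cmod (cf x (k + m)))\<^sup>2"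
      unfolding power_mult_distrib[symmetric] by (intro power_mono) auto
  qed
  also have "\<dots> \<le> (1 / w m)\<^sup>2 * (norm x)\<^sup>2"
    unfolding sum_distrib_left[symmetric] by (intro mult_left_mono sum_sq_shift_le F) auto
  finally show "(\<Sum>k\<in>F. (cmod (cf (Hk x (eps m)) k))\<^sup>2) \<le> ((1 / w m) * norm x)\<^sup>2"
    by (simp only: power_mult_distrib)
qed simp

text \<open>An upper bound for the trace norm of the Hankel operator.\<close>

definition tr :: "ell2 \<Rightarrow> real" where "tr x = (\<Sum>\<^sub>\<infinity>m. norm (Hk x (eps m)))"

lemma tr_summable: "(\<lambda>m. norm (Hk x (eps m))) summable_on UNIV"
  by (rule summable_on_comparison_test[OF summable_on_cmult_left[OF w_summable, of "norm x"]]) (use norm_Hk_eps[of x] in auto)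

text \<open>Each \<open>e j\<close> is expanded in the standard basis; Cauchy-Schwarz over
  \<open>j\<close> and Bessel for both families bound the contribution of \<open>eps m\<close> by
  \<open>norm (Hk x (eps m))\<close>, whatever the families are.\<close>

lemma trace_bound:
  assumes F: "finite F"
    and e: "\<And>i j. i \<in> F \<Longrightarrow> j \<in> F \<Longrightarrow> cinner (e i) (e j) = (if i = j then 1 else 0)"
    and f: "\<And>i j. i \<in> F \<Longrightarrow> j \<in> F \<Longrightarrow> cinner (f i) (f j) = (if i = j then 1 else 0)"
  shows "(\<Sum>j\<in>F. cmod (cinner (Hk x (e j)) (f j))) \<le> tr x"
proof -
  define g where "g j m = cmod (cinner (Hk x (eps m)) (f j)) * cmod (cf (e j) m)" for j m
  have hs: "((\<lambda>m. cinner (Hk x (eps m)) (f j) * cnj (cf (e j) m)) has_sum cinner (Hk x (e j)) (f j)) UNIV" for j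
    using cinner_has_sum[of "Hk x (f j)" "e j"]
    by (simp add: cinner_Hk[of x "f j"] cinner_eps_right[symmetric] cinner_Hk[of x "f j" "eps _"])
  have gs: "(\<lambda>m. g j m) summable_on UNIV" for j
    using l2_mult_abs_summable[OF l2_cf[of "Hk x (f j)"] l2_cf[of "e j"]]
    by (simp add: g_def norm_mult cinner_eps_right[symmetric] cinner_Hk[of x "f j" "eps _"])
  have "cmod (cinner (Hk x (e j)) (f j)) \<le> infsum (g j) UNIV" for j
    using norm_infsum_bound[of "\<lambda>m. cinner (Hk x (eps m)) (f j) * cnj (cf (e j) m)" UNIV] gs[of j] infsumI[OF hs[of j]]
    by (simp add: g_def[abs_def] norm_mult)
  then have "(\<Sum>j\<in>F. cmod (cinner (Hk x (e j)) (f j))) \<le> (\<Sum>j\<in>F. infsum (g j) UNIV)" by (rule sum_mono)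
  also have "\<dots> \<le> tr x"
    unfolding tr_def
  proof (rule has_sum_mono[OF has_sum_finite_sum[OF F] has_sum_infsum[OF tr_summable]])
    show "(g j has_sum infsum (g j) UNIV) UNIV" for j using gs by simp
    fix m
    have "(\<Sum>j\<in>F. g j m) = (\<Sum>j\<in>F. \<bar>cmod (cinner (Hk x (eps m)) (f j))\<bar> * \<bar>cmod (cinner (eps m) (e j))\<bar>)"
      by (intro sum.cong refl) (simp add: g_def cinner_eps_right[symmetric] cinner_commute[of "eps m"])
    also have "\<dots> \<le> L2_set (\<lambda>j. cmod (cinner (Hk x (eps m)) (f j))) F * L2_set (\<lambda>j. cmod (cinner (eps m) (e j))) F"
      by (rule L2_set_mult_ineq)
    also have "\<dots> \<le> norm (Hk x (eps m)) * norm (eps m)"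
      unfolding L2_set_def by (intro mult_mono real_le_lsqrt bessel_ell2 F e f sum_nonneg) (auto intro: sum_nonneg)
    finally show "(\<Sum>j\<in>F. g j m) \<le> norm (Hk x (eps m))" by simp
  qed
  finally show ?thesis .
qed

text \<open>Even and odd coefficients are bounded separately, because a diagonal of the Hankel
  matrix shows only one parity.\<close>

lemma sum_pairs_le:
  fixes a :: "nat \<Rightarrow> real"
  assumes a: "\<And>k. a k \<ge> 0" and F: "finite F"
    and ev: "\<And>N. (\<Sum>l<N. a (2*l)) \<le> A" and od: "\<And>N. (\<Sum>l<N. a (2*l+1)) \<le> A'"
  shows "sum a F \<le> A + A'"
proof -
  obtain N where "F \<subseteq> {..<N}" using finite_nat_iff_bounded F by auto
  then have "sum a F \<le> (\<Sum>k<2*N. a k)" using a by (intro sum_mono2) auto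
  also have "\<dots> \<le> A + A'" unfolding sum_pairs by (intro add_mono ev od)
  finally show ?thesis .
qed

text \<open>Orthonormal families transported by \<open>e' = c(t) B e\<close> stay orthonormal and keep the matrix
  coefficients of the Hankel operator; hence the trace norm is conserved and controls the Wiener norm.\<close>

lemma wiener_norm_bound:
  assumes u: "\<And>t. (u has_vector_derivative c t *\<^sub>R X n (u t)) (at t)" and c: "continuous_on UNIV c"
  shows "n1 (U (u \<tau>)) \<le> 2 * tr (u 0)"
proof -
  have uc: "continuous_on UNIV u"
    by (intro continuous_at_imp_continuous_on ballI has_vector_derivative_continuous[OF u])
  \<comment> \<open>The linear transport equation of the Lax pair. Its Lipschitz constant is uniform
    on compact time intervals because the continuous curve \<open>u\<close> stays bounded
    there.\<close>
  define F where "F t h = c t *\<^sub>R B n (u t) h" for t h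
  have Fc: "continuous_on UNIV (\<lambda>(t,h). F t h)"
    unfolding F_def case_prod_unfold
    by (intro continuous_on_scaleR continuous_on_B continuous_on_compose2[OF c] continuous_on_compose2[OF uc]
        continuous_on_fst continuous_on_snd continuous_on_id subset_UNIV)
  have Fl: "\<exists>L. \<forall>t. \<bar>t\<bar> \<le> T \<longrightarrow> (\<forall>x y. norm (F t x - F t y) \<le> L * norm (x - y))" for T
  proof -
    have "bounded (u ` {-T..T})"
      by (intro compact_imp_bounded compact_continuous_image continuous_on_subset[OF uc]) auto
    then obtain R where R: "\<forall>x\<in>u ` {-T..T}. norm x \<le> R" unfolding bounded_iff by blast
    have "bounded (c ` {-T..T})"
      by (intro compact_imp_bounded compact_continuous_image continuous_on_subset[OF c]) auto
    then obtain Q where Q: "\<forall>x\<in>c ` {-T..T}. norm x \<le> Q" unfolding bounded_iff by blast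
    have "norm (F t x - F t y) \<le> (\<bar>Q\<bar> * (real n * (K * \<bar>R\<bar>) ^ (2*n-2))) * norm (x - y)" if t: "\<bar>t\<bar> \<le> T" for t x y
    proof -
      have t: "t \<in> {-T..T}" using t by auto
      have "n1 (U (u t)) \<le> K * \<bar>R\<bar>"
      proof (intro order_trans[OF n1_U_le] mult_left_mono K_nonneg)
        have "norm (u t) \<le> R" using R t by blast
        then show "norm (u t) \<le> \<bar>R\<bar>" by linarith
      qed
      then have "n1 (U (u t)) ^ (2*n-2) \<le> (K * \<bar>R\<bar>) ^ (2*n-2)" by (intro power_mono n1_nonneg)
      then have "real n * n1 (U (u t)) ^ (2*n-2) * norm (x - y) \<le> real n * (K * \<bar>R\<bar>) ^ (2*n-2) * norm (x - y)"
        by (intro mult_right_mono mult_left_mono) auto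
      then have "norm (B n (u t) (x - y)) \<le> real n * (K * \<bar>R\<bar>) ^ (2*n-2) * norm (x - y)"
        using norm_B[of n "u t" "x - y"] by linarith
      moreover have "\<bar>c t\<bar> \<le> \<bar>Q\<bar>" using Q t by force
      ultimately have "\<bar>c t\<bar> * norm (B n (u t) (x - y)) \<le> \<bar>Q\<bar> * (real n * (K * \<bar>R\<bar>) ^ (2*n-2) * norm (x - y))"
        by (intro mult_mono) auto
      then show ?thesis by (simp add: F_def scaleR_diff_right[symmetric] B_diff mult.assoc)
    qed
    then show ?thesis by blast
  qed
  \<comment> \<open>The data are prescribed at \<open>\<tau>\<close>, where the basis reads off
    Fourier coefficients; the families are then evaluated at 0, where \<open>tr (u 0)\<close>
    controls them.\<close>
  have "\<forall>k. \<exists>e. e \<tau> = eps k \<and> (\<forall>t. (e has_vector_derivative F t (e t)) (at t))"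
    using ode_global_solution[OF Fc Fl] by blast
  then obtain e where e0: "\<And>k. e k \<tau> = eps k" and e: "\<And>k t. (e k has_vector_derivative F t (e k t)) (at t)"
    by metis
  have const: "f t = f \<tau>" if d: "\<And>t. (f has_vector_derivative 0) (at t)" for f :: "real \<Rightarrow> complex" and t
  proof -
    obtain c where "\<And>x. x \<in> UNIV \<Longrightarrow> f x = c"
      by (rule has_vector_derivative_zero_constant[of UNIV f]) (use d in auto)
    then show ?thesis by simp
  qed
  have on: "cinner (e i t) (e j t) = (if i = j then 1 else 0)" for i j t
  proof -
    have "((\<lambda>t. cinner (e i t) (e j t)) has_vector_derivative cinner (e i t) (F t (e j t)) + cinner (F t (e i t)) (e j t)) (at t)" for t
      by (rule bounded_bilinear.has_vector_derivative[OF bounded_bilinear_cinner e e])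
    moreover have "cinner (e i t) (F t (e j t)) + cinner (F t (e i t)) (e j t) = 0" for t
      by (simp add: F_def scaleR_cscale cinner_cscale_left cinner_cscale_right cinner_B)
    ultimately have "cinner (e i t) (e j t) = cinner (e i \<tau>) (e j \<tau>)"
      using const[of "\<lambda>t. cinner (e i t) (e j t)" t] by simp
    then show ?thesis by (simp add: e0 cinner_eps)
  qed
  have mat: "cinner (Hk (u 0) (e i 0)) (e j 0) = U (u \<tau>) (i + j)" for i j
  proof -
    have "((\<lambda>t. cinner (Hk (u t) (e i t)) (e j t)) has_vector_derivative
        cinner (Hk (u t) (e i t)) (F t (e j t)) + cinner (Hk (u t) (F t (e i t)) + Hk (c t *\<^sub>R X n (u t)) (e i t)) (e j t)) (at t)" for t
      by (intro bounded_bilinear.has_vector_derivative[OF bounded_bilinear_cinner] 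
          bounded_bilinear.has_vector_derivative[OF bounded_bilinear_Hk] e u)
    \<comment> \<open>The two terms with \<open>Hk\<close> applied to \<open>B e\<close> cancel each
      other, and the term with \<open>B\<close> applied to \<open>Hk e\<close> cancels the
      derivative of the second argument by skew-adjointness. The factor \<open>c t\<close> is real
      and so passes unchanged through the antilinear operator.\<close>
    moreover have "cinner (Hk (u t) (e i t)) (F t (e j t)) + cinner (Hk (u t) (F t (e i t)) + Hk (c t *\<^sub>R X n (u t)) (e i t)) (e j t) = 0" for t
      by (simp add: F_def scaleR_cscale Hk_cscale_left Hk_cscale_right lax_identity cinner_cscale_left cinner_cscale_right
          cinner_add_left cinner_diff_left cinner_B algebra_simps)
    ultimately have "cinner (Hk (u 0) (e i 0)) (e j 0) = cinner (Hk (u \<tau>) (e i \<tau>)) (e j \<tau>)"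
      using const[of "\<lambda>t. cinner (Hk (u t) (e i t)) (e j t)" 0] by simp
    then show ?thesis by (simp add: e0 cinner_eps_right cf_Hk_eps add.commute)
  qed
  have ev: "(\<Sum>l<N. cmod (U (u \<tau>) (2*l))) \<le> tr (u 0)" for N
    using trace_bound[of "{..<N}" "\<lambda>l. e l 0" "\<lambda>l. e l 0" "u 0"] by (simp add: on mat mult_2)
  \<comment> \<open>Pairing \<open>e (Suc l)\<close> with \<open>e l\<close> moves to the
    neighbouring diagonal, where the indices add up to \<open>2*l+1\<close>.\<close>
  have od: "(\<Sum>l<N. cmod (U (u \<tau>) (2*l+1))) \<le> tr (u 0)" for N
    using trace_bound[of "{..<N}" "\<lambda>l. e (Suc l) 0" "\<lambda>l. e l 0" "u 0"] by (simp add: on mat mult_2)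
  have "(\<Sum>k\<in>F. cmod (U (u \<tau>) k)) \<le> tr (u 0) + tr (u 0)" if "finite F" for F
    by (rule sum_pairs_le[OF _ that ev od]) simp
  then have "n1 (U (u \<tau>)) \<le> tr (u 0) + tr (u 0)" by (rule l1_boundI(2))
  then show ?thesis by simp
qed

text \<open>The truncated field \<open>F\<close> is globally Lipschitz and still satisfies the Lax equation, up to a scalar
  factor. The a priori bound then shows that the truncation is never active.\<close>

theorem global_solution:
  "\<exists>u. u 0 = x0 \<and> (\<forall>t. (u has_vector_derivative X n (u t)) (at t))"
proof -
  \<comment> \<open>The Gronwall rate given by \<open>norm_X\<close> once the Wiener norm is
    replaced by its a priori bound \<open>2 * tr x0\<close>.\<close>
  define C where "C = (real n * (2 powr s * (2 + K))) * (2 * tr x0) ^ (2*n-2)"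
  define \<phi> :: "real \<Rightarrow> real" where "\<phi> r = max 0 (min 1 (1 - r))" for r
  \<comment> \<open>One more than the Gronwall bound, so that \<open>norm x - R t\<close> is
    negative along the solution and the cutoff equals 1; the cutoff vanishes from
    \<open>R t + 1\<close> on.\<close>
  define R where "R t = norm x0 * exp (C * \<bar>t\<bar>) + 1" for t :: real
  define F where "F t x = \<phi> (norm x - R t) *\<^sub>R X n x" for t x
  have Xc: "continuous_on UNIV (X n)" by (rule lipschitz_on_balls_continuous[OF lipschitz_X])
  have \<phi>c: "continuous_on T (\<lambda>t. \<phi> (f t))" if "continuous_on T f" for T and f :: "'b::topological_space \<Rightarrow> real"
    unfolding \<phi>_def by (intro continuous_intros that)
  have \<phi>01: "0 \<le> \<phi> r" "\<phi> r \<le> 1" for r by (auto simp: \<phi>_def)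
  have \<phi>l: "\<bar>\<phi> r - \<phi> r'\<bar> \<le> \<bar>r - r'\<bar>" for r r' by (auto simp: \<phi>_def max_def min_def)
  have \<phi>0: "\<phi> r = 0" if "r \<ge> 1" for r using that by (auto simp: \<phi>_def)
  have Rc: "continuous_on T (\<lambda>t. R (f t))" if "continuous_on T f" for T and f :: "'b::topological_space \<Rightarrow> real"
    unfolding R_def by (intro continuous_intros that)
  have Fc: "continuous_on UNIV (\<lambda>(t,x). F t x)"
    unfolding F_def case_prod_unfold
    by (intro continuous_on_scaleR \<phi>c continuous_on_diff continuous_on_norm Rc continuous_on_fst continuous_on_snd
        continuous_on_id continuous_on_compose2[OF Xc] subset_UNIV)
  have Fl: "\<exists>L. \<forall>t. \<bar>t\<bar> \<le> T \<longrightarrow> (\<forall>x y. norm (F t x - F t y) \<le> L * norm (x - y))" for T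
  proof -
    \<comment> \<open>A radius beyond which the truncated field vanishes for all times up to
      \<open>T\<close> in modulus.\<close>
    define Q where "Q = norm x0 * exp (\<bar>C\<bar> * \<bar>T\<bar>) + 2"
    obtain L where L: "L \<ge> 0" "\<And>x y. norm x \<le> Q \<Longrightarrow> norm y \<le> Q \<Longrightarrow> norm (X n x - X n y) \<le> L * norm (x - y)"
      using lipschitz_on_ballsE[OF lipschitz_X] by blast
    obtain M where M: "M \<ge> 0" "\<And>x. norm x \<le> Q \<Longrightarrow> norm (X n x) \<le> M"
      using lipschitz_on_balls_bounded[OF lipschitz_X] by blast
    have "norm (F t x - F t y) \<le> (M + L) * norm (x - y)" if t: "\<bar>t\<bar> \<le> T" for t x y
    proof -
      have "C * \<bar>t\<bar> \<le> \<bar>C\<bar> * \<bar>T\<bar>" using t by (intro mult_mono) auto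
      then have RQ: "R t + 1 \<le> Q" by (auto simp: R_def Q_def intro!: mult_left_mono)
      have out: "F t z = 0" if "norm z > Q" for z using \<phi>0[of "norm z - R t"] RQ that by (simp add: F_def)
      have dn: "\<bar>\<phi> (norm x - R t) - \<phi> (norm y - R t)\<bar> \<le> norm (x - y)" for x y :: ell2
        using \<phi>l[of "norm x - R t" "norm y - R t"] norm_triangle_ineq3[of x y] by simp
      \<comment> \<open>One point in the ball is enough: if the other lies outside, its cutoff and
        its field vanish, and the Lipschitz bound of the cutoff alone gives the estimate.\<close>
      have one: "norm (F t x - F t y) \<le> (M + L) * norm (x - y)" if x: "norm x \<le> Q" for x y
      proof (cases "norm y \<le> Q")
        case True
        have "F t x - F t y = (\<phi> (norm x - R t) - \<phi> (norm y - R t)) *\<^sub>R X n x + \<phi> (norm y - R t) *\<^sub>R (X n x - X n y)"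
          by (simp add: F_def algebra_simps)
        also have "norm \<dots> \<le> \<bar>\<phi> (norm x - R t) - \<phi> (norm y - R t)\<bar> * norm (X n x) + \<bar>\<phi> (norm y - R t)\<bar> * norm (X n x - X n y)"
          by (intro order_trans[OF norm_triangle_ineq]) simp
        also have "\<dots> \<le> norm (x - y) * M + 1 * (L * norm (x - y))"
          using dn M x L True \<phi>01 by (intro add_mono mult_mono) auto
        finally show ?thesis by (simp add: algebra_simps)
      next
        case False
        then have y0: "F t y = 0" "\<phi> (norm y - R t) = 0" using out \<phi>0[of "norm y - R t"] RQ by auto
        have "norm (F t x) = \<bar>\<phi> (norm x - R t) - \<phi> (norm y - R t)\<bar> * norm (X n x)" by (simp add: F_def y0)
        also have "\<dots> \<le> norm (x - y) * M" using dn M x by (intro mult_mono) auto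
        also have "\<dots> \<le> (M + L) * norm (x - y)" using L(1) by (simp add: algebra_simps)
        finally show ?thesis by (simp add: y0)
      qed
      show ?thesis
      proof (cases "norm x \<le> Q")
        case False
        then show ?thesis
        proof (cases "norm y \<le> Q")
          case True
          from one[OF this, of x] show ?thesis by (simp add: norm_minus_commute)
        next
          case y: False
          then show ?thesis using out False L(1) M(1) by simp
        qed
      qed (rule one)
    qed
    then show ?thesis by blast
  qed
  obtain u where u: "u 0 = x0" "\<And>t. (u has_vector_derivative F t (u t)) (at t)"
    using ode_global_solution[OF Fc Fl, of 0 x0] by blast
  have uc: "continuous_on UNIV u"
    by (intro continuous_at_imp_continuous_on ballI has_vector_derivative_continuous[OF u(2)])
  have "n1 (U (u t)) \<le> 2 * tr (u 0)" for t
    by (rule wiener_norm_bound[where c = "\<lambda>t. \<phi> (norm (u t) - R t)" and n = n])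
       (use u(2) in \<open>auto simp: F_def intro!: \<phi>c Rc continuous_intros uc\<close>)
  then have wb: "n1 (U (u t)) \<le> 2 * tr x0" for t by (simp add: u(1))
  have "norm (F t (u t)) \<le> C * norm (u t)" for t
  proof -
    have "norm (F t (u t)) \<le> norm (X n (u t))"
      using \<phi>01[of "norm (u t) - R t"] by (simp add: F_def mult_left_le_one_le)
    also have "\<dots> \<le> (real n * (2 powr s * (2 + K))) * n1 (U (u t)) ^ (2*n-2) * norm (u t)" by (rule norm_X)
    also have "\<dots> \<le> C * norm (u t)"
      unfolding C_def using K_nonneg by (intro mult_right_mono mult_left_mono power_mono wb n1_nonneg) auto
    finally show ?thesis .
  qed
  then have "norm (u t) \<le> norm (u 0) * exp (C * \<bar>t\<bar>)" for t
    by (intro gronwall_norm[where T = "\<bar>t\<bar>" and w' = "\<lambda>t. F t (u t)"] u(2)) auto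
  then have "F t (u t) = X n (u t)" for t
    by (simp add: F_def \<phi>_def R_def u(1))
  with u show ?thesis by auto
qed

text \<open>Both curves stay in one ball on a compact time interval, so a single Lipschitz constant
  applies there and Gronwall's lemma controls the difference.\<close>

theorem solution_unique:
  assumes u: "\<And>t. (u has_vector_derivative X n (u t)) (at t)" and v: "\<And>t. (v has_vector_derivative X n (v t)) (at t)"
    and 0: "u 0 = v 0"
  shows "u t = v t"
proof -
  define T where "T = \<bar>t\<bar>"
  have uc: "continuous_on UNIV u"
    by (intro continuous_at_imp_continuous_on ballI has_vector_derivative_continuous[OF u])
  have vc: "continuous_on UNIV v"
    by (intro continuous_at_imp_continuous_on ballI has_vector_derivative_continuous[OF v])
  have "bounded (u ` {-T..T} \<union> v ` {-T..T})"
    unfolding bounded_Un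
    by (intro conjI compact_imp_bounded compact_continuous_image continuous_on_subset[OF uc] continuous_on_subset[OF vc]) auto
  then obtain R where R: "\<forall>x\<in>u ` {-T..T} \<union> v ` {-T..T}. norm x \<le> R" unfolding bounded_iff by blast
  obtain L where L: "\<And>x y. norm x \<le> R \<Longrightarrow> norm y \<le> R \<Longrightarrow> norm (X n x - X n y) \<le> L * norm (x - y)"
    using lipschitz_on_ballsE[OF lipschitz_X] by blast
  have "norm (u t - v t) \<le> norm (u 0 - v 0) * exp (L * \<bar>t\<bar>)"
  proof (rule gronwall_norm[where T = T])
    show "((\<lambda>t. u t - v t) has_vector_derivative X n (u t) - X n (v t)) (at t)" for t
      by (intro has_vector_derivative_diff u v)
    show "norm (X n (u t) - X n (v t)) \<le> L * norm (u t - v t)" if "\<bar>t\<bar> \<le> T" for t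
    proof -
      have "t \<in> {-T..T}" using that by auto
      then show ?thesis using R by (intro L) auto
    qed
  qed (simp add: T_def)
  then show ?thesis using 0 by simp
qed

end

section \<open>From functions on the circle to sequences\<close>

definition fc :: "circfun \<Rightarrow> nat \<Rightarrow> complex" where "fc u k = fourier u (int k)"

text \<open>Young's inequality makes the coefficients of the product square summable, so
  Riesz-Fischer gives an element of \<open>L2\<close> with the same coefficients. It equals the
  product, so far only known to be integrable, by uniqueness in L^1.\<close>

lemma L2_mult:
  assumes u: "u \<in> L2" and h: "h \<in> L2" and l: "(\<lambda>k. cmod (fourier u k)) summable_on UNIV"
  shows "u * h \<in> L2"
proof -
  let ?a = "\<lambda>k. fourier (u * h) k"
  have shift: "(\<Sum>k\<in>F. (cmod (fourier h (k - l)))\<^sup>2) \<le> (norm_L2 h)\<^sup>2" if "finite F" for F l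
  proof -
    have "(\<Sum>k\<in>F. (cmod (fourier h (k - l)))\<^sup>2) = (\<Sum>j\<in>(\<lambda>k. k - l) ` F. (cmod (fourier h j))\<^sup>2)"
      by (subst sum.reindex) (auto simp: inj_on_def)
    also have "\<dots> \<le> (norm_L2 h)\<^sup>2" using that by (intro bessel h) auto
    finally show ?thesis .
  qed
  have sm: "(\<lambda>l. cmod (fourier u l * fourier h (k - l))) summable_on UNIV" for k
  proof (rule summable_on_comparison_test)
    show "(\<lambda>l. cmod (fourier u l) * norm_L2 h) summable_on UNIV" by (rule summable_on_cmult_left[OF l])
    show "cmod (fourier u l * fourier h (k - l)) \<le> cmod (fourier u l) * norm_L2 h" for l
    proof -
      have "(cmod (fourier h (k - l)))\<^sup>2 \<le> (norm_L2 h)\<^sup>2" using shift[of "{k}" l] by simp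
      then have "cmod (fourier h (k - l)) \<le> norm_L2 h" by (rule power2_le_imp_le) simp
      then show ?thesis by (simp add: norm_mult mult_left_mono)
    qed
  qed auto
  have bd: "cmod (?a k) \<le> (\<Sum>\<^sub>\<infinity>l. cmod (fourier u l) * cmod (fourier h (k - l)))" for k
    using norm_infsum_bound[OF sm[of k]] infsumI[OF fourier_mult[OF u h, of k]] by (simp add: norm_mult)
  have "(\<Sum>k\<in>F. (cmod (?a k))\<^sup>2) \<le> ((\<Sum>\<^sub>\<infinity>k. cmod (fourier u k)) * norm_L2 h)\<^sup>2" if F: "finite F" for F
  proof -
    have "(\<Sum>k\<in>F. (cmod (?a k))\<^sup>2) \<le> (\<Sum>k\<in>F. (\<Sum>\<^sub>\<infinity>l. cmod (fourier u l) * cmod (fourier h (k - l)))\<^sup>2)"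
      by (intro sum_mono power_mono bd) simp
    also have "\<dots> \<le> ((\<Sum>\<^sub>\<infinity>k. cmod (fourier u k)) * norm_L2 h)\<^sup>2"
      by (rule young2[OF l]) (use F shift in auto)
    finally show ?thesis .
  qed
  then have "(\<lambda>k. (cmod (?a k))\<^sup>2) summable_on UNIV"
    by (intro nonneg_bdd_above_summable_on) (auto intro!: bdd_aboveI)
  from riesz_fischer_L2[OF this] obtain g where g: "g \<in> L2" "\<And>k. fourier g k = ?a k" by blast
  have i1: "integrable_circ (u * h * monomial k)" for k
    using integrable_L2_mult[OF u L2_monomial_mult[OF h, of k]] by (simp add: mult_ac)
  have i2: "integrable_circ (g * monomial k)" for k by (rule integrable_L2_mult[OF g(1) L2_monomial])
  have "integrable_circ (u * h - g)"
  proof -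
    have "integrable_circ (u * h)" "integrable_circ g" using i1[of 0] i2[of 0] by simp_all
    then show ?thesis by transfer simp
  qed
  moreover have "circle_integral ((u * h - g) * monomial k) = 0" for k
    using g(2)[of "- k"] i1[of k] i2[of k]
    by (simp add: left_diff_distrib circle_integral_diff fourier_def inner_L2_def circ_conj_monomial)
  ultimately have "u * h - g = 0" by (rule circ_eq_0I)
  then show ?thesis using g(1) by simp
qed

lemma L2_plus_D: "u \<in> L2_plus \<Longrightarrow> u \<in> L2" "u \<in> L2_plus \<Longrightarrow> k < 0 \<Longrightarrow> fourier u k = 0"
  by (auto simp: L2_plus_iff)

lemma L2_plus_eqI:
  assumes "u \<in> L2_plus" "v \<in> L2_plus" "\<And>k. fc u k = fc v k"
  shows "u = v"
proof (rule fourier_inject)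
  show "u \<in> L2" "v \<in> L2" using assms L2_plus_D by auto
  fix k show "fourier u k = fourier v k"
    using assms(3)[of "nat k"] L2_plus_D(2)[OF assms(1)] L2_plus_D(2)[OF assms(2)]
    by (cases "k < 0") (auto simp: fc_def)
qed

lemma L2_plus_add: "u \<in> L2_plus \<Longrightarrow> v \<in> L2_plus \<Longrightarrow> u + v \<in> L2_plus"
  and L2_plus_diff: "u \<in> L2_plus \<Longrightarrow> v \<in> L2_plus \<Longrightarrow> u - v \<in> L2_plus"
  and L2_plus_const_mult: "u \<in> L2_plus \<Longrightarrow> const c * u \<in> L2_plus"
  by (auto simp: L2_plus_iff L2_add L2_diff L2_const_mult fourier_add fourier_diff fourier_const_mult)

lemma has_sum_int_plus:
  fixes f :: "int \<Rightarrow> 'b::{comm_monoid_add, t2_space}"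
  assumes "\<And>k. k < 0 \<Longrightarrow> f k = 0"
  shows "(f has_sum S) UNIV \<longleftrightarrow> ((\<lambda>k. f (int k)) has_sum S) UNIV"
proof -
  have "(f has_sum S) UNIV \<longleftrightarrow> (f has_sum S) (range int)"
  proof (rule has_sum_cong_neutral)
    fix k :: int assume "k \<in> UNIV - range int"
    then have "k < 0" by (metis DiffD2 nonneg_int_cases not_le rangeI)
    then show "f k = 0" by (rule assms)
  qed auto
  also have "\<dots> \<longleftrightarrow> ((f \<circ> int) has_sum S) UNIV" by (rule has_sum_reindex) auto
  finally show ?thesis by (simp add: o_def)
qed

lemma L2_plus_l2: "u \<in> L2_plus \<Longrightarrow> l2 (fc u)"
  unfolding l2_def fc_def by (rule fourier_nat_summable) (rule L2_plus_D)

text \<open>The unweighted encoding, an isometry of \<open>L2_plus\<close> onto \<open>ell2\<close>.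
  Its rules are confined to \<open>L2_plus\<close>, where no negative frequency is lost.\<close>

definition pc :: "circfun \<Rightarrow> ell2" where "pc u = Ell2 (fc u)"

lemma cf_pc: "u \<in> L2_plus \<Longrightarrow> cf (pc u) = fc u"
  by (simp add: pc_def cf_Ell2 L2_plus_l2)

lemma pc_inject: "u \<in> L2_plus \<Longrightarrow> v \<in> L2_plus \<Longrightarrow> pc u = pc v \<Longrightarrow> u = v"
  by (rule L2_plus_eqI) (auto simp: cf_pc[symmetric])

lemma pc_add: "u \<in> L2_plus \<Longrightarrow> v \<in> L2_plus \<Longrightarrow> pc (u + v) = pc u + pc v"
  and pc_diff: "u \<in> L2_plus \<Longrightarrow> v \<in> L2_plus \<Longrightarrow> pc (u - v) = pc u - pc v"
  and pc_const_mult: "u \<in> L2_plus \<Longrightarrow> pc (const c * u) = cscale c (pc u)"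
  by (auto intro!: ell2_eqI simp: cf_pc L2_plus_add L2_plus_diff L2_plus_const_mult fc_def fourier_add fourier_diff fourier_const_mult L2_plus_D)

lemma L2_plus_0: "0 \<in> L2_plus" using fourier_const_mult[of 0 0] by (auto simp: L2_plus_iff L2_0)

lemma pc_0: "pc 0 = 0" using pc_const_mult[OF L2_plus_0, of 0] by simp

lemma L2_plus_sum: "(\<And>i. i \<in> I \<Longrightarrow> f i \<in> L2_plus) \<Longrightarrow> sum f I \<in> L2_plus"
  by (induction I rule: infinite_finite_induct) (auto intro: L2_plus_add L2_plus_0)

lemma pc_sum: "(\<And>i. i \<in> I \<Longrightarrow> f i \<in> L2_plus) \<Longrightarrow> pc (sum f I) = (\<Sum>i\<in>I. pc (f i))"
  by (induction I rule: infinite_finite_induct) (auto simp: pc_add L2_plus_sum pc_0)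

lemma inner_pc: "u \<in> L2_plus \<Longrightarrow> v \<in> L2_plus \<Longrightarrow> inner_L2 u v = cinner (pc u) (pc v)"
proof -
  assume u: "u \<in> L2_plus" and v: "v \<in> L2_plus"
  have "((\<lambda>k. fourier u (int k) * cnj (fourier v (int k))) has_sum inner_L2 u v) UNIV"
    using parseval_inner[OF L2_plus_D(1)[OF u] L2_plus_D(1)[OF v]]
    by (subst (asm) has_sum_int_plus) (auto simp: L2_plus_D(2)[OF u])
  from infsumI[OF this] show ?thesis by (simp add: cinner_def cf_pc u v fc_def)
qed

lemma norm_pc: "u \<in> L2_plus \<Longrightarrow> norm_L2 u = norm (pc u)"
  by (simp add: norm_L2_def inner_pc norm_ell2_def)

lemma pc_surj: "\<exists>u\<in>L2_plus. pc u = x"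
proof -
  obtain u where u: "u \<in> L2_plus" "\<And>k. fourier u (int k) = cf x k"
    using L2_plus_exists[of "cf x"] l2_cf[of x] unfolding l2_def by blast
  have "pc u = x" by (rule ell2_eqI) (simp add: cf_pc u fc_def)
  with u show ?thesis by blast
qed

text \<open>Neither factor has negative frequencies, so the two-sided convolution has finitely many
  nonzero terms, and none when \<open>k\<close> is negative.\<close>

lemma mult_plus:
  assumes u: "u \<in> L2_plus" and h: "h \<in> L2_plus" and uh: "u * h \<in> L2"
  shows "u * h \<in> L2_plus" "fc (u * h) k = conv (fc u) (fc h) k"
proof -
  have 1: "((\<lambda>l. fourier u l * fourier h (k - l)) has_sum (\<Sum>l\<in>int ` {..nat k}. fourier u l * fourier h (k - l))) UNIV" for k
  proof (rule has_sum_finite_neutralI)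
    fix l assume l: "l \<in> UNIV - int ` {..nat k}"
    have "l < 0 \<or> k - l < 0"
    proof (rule ccontr)
      assume "\<not> ?thesis"
      then have "l = int (nat l)" "nat l \<le> nat k" by auto
      then show False using l by blast
    qed
    then show "fourier u l * fourier h (k - l) = 0" using L2_plus_D(2)[OF u] L2_plus_D(2)[OF h] by auto
  qed auto
  have 2: "fourier (u * h) k = (\<Sum>l\<in>int ` {..nat k}. fourier u l * fourier h (k - l))" for k
    using has_sum_unique[OF fourier_mult[OF L2_plus_D(1)[OF u] L2_plus_D(1)[OF h]] 1[of k]] .
  show "u * h \<in> L2_plus" unfolding L2_plus_iff
  proof (intro conjI allI impI uh)
    fix k :: int assume "k < 0"
    then show "fourier (u * h) k = 0" unfolding 2 by (simp add: L2_plus_D(2)[OF h])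
  qed
  show "fc (u * h) k = conv (fc u) (fc h) k"
    unfolding fc_def 2 conv_def by (subst sum.reindex) (auto intro!: sum.cong simp: of_nat_diff)
qed

text \<open>Shifting the summation index by \<open>k\<close> turns the convolution with the
  conjugate into a correlation, and the absence of negative frequencies in \<open>h\<close> cuts it
  down to natural indices.\<close>

lemma szego_mult_conj:
  assumes u: "u \<in> L2_plus" and h: "h \<in> L2_plus" and uh: "u * circ_conj h \<in> L2"
  shows "fc (szego (u * circ_conj h)) k = corr (fc u) (fc h) k"
proof -
  have "((\<lambda>m. fourier u m * fourier (circ_conj h) (int k - m)) has_sum fourier (u * circ_conj h) (int k)) UNIV"
    by (intro fourier_mult L2_conj L2_plus_D(1) u h)
  then have "((\<lambda>m. fourier u m * cnj (fourier h (m - int k))) has_sum fourier (u * circ_conj h) (int k)) UNIV"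
    by (simp add: fourier_conj)
  then have "((\<lambda>l. fourier u (l + int k) * cnj (fourier h l)) has_sum fourier (u * circ_conj h) (int k)) UNIV"
    by (subst (asm) has_sum_reindex_bij_betw[symmetric, of "\<lambda>l. l + int k" UNIV UNIV]) (auto intro!: bij_betwI[of _ _ _ "\<lambda>l. l - int k"])
  then have "((\<lambda>l. fourier u (int l + int k) * cnj (fourier h (int l))) has_sum fourier (u * circ_conj h) (int k)) UNIV"
    by (subst (asm) has_sum_int_plus) (auto simp: L2_plus_D(2)[OF h])
  from infsumI[OF this] show ?thesis
    by (simp add: fc_def fourier_szego[OF uh] corr_def add.commute)
qed

context sobolev begin

section \<open>Dictionary between the Sobolev space on the circle and its encoding\<close>

definition coef :: "circfun \<Rightarrow> ell2" where "coef u = Ell2 (\<lambda>k. of_real (w k) * fc u k)"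

lemma w_sq: "(w k)\<^sup>2 = (1 + (real_of_int (int k))\<^sup>2) powr s"
proof -
  have "(w k)\<^sup>2 = w k powr 2" by (simp add: powr_numeral)
  then show ?thesis by (simp add: w_def powr_powr)
qed

lemma Hs_weight: "(1 + (real_of_int (int k))\<^sup>2) powr s * (cmod (fourier u (int k)))\<^sup>2 = (cmod (of_real (w k) * fc u k))\<^sup>2"
  by (simp only: w_sq[symmetric] fc_def norm_mult power_mult_distrib norm_of_real power2_abs)

lemma Hs_plus_iff: "u \<in> Hs_plus s \<longleftrightarrow> u \<in> L2_plus \<and> l2 (\<lambda>k. of_real (w k) * fc u k)"
proof -
  have "(\<lambda>k. (1 + (real_of_int k)\<^sup>2) powr s * (cmod (fourier u k))\<^sup>2) summable_on UNIV \<longleftrightarrow> l2 (\<lambda>k. of_real (w k) * fc u k)"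
    if "u \<in> L2_plus"
  proof -
    have "(\<lambda>k. (1 + (real_of_int k)\<^sup>2) powr s * (cmod (fourier u k))\<^sup>2) summable_on UNIV \<longleftrightarrow>
      (\<lambda>k. (1 + (real_of_int (int k))\<^sup>2) powr s * (cmod (fourier u (int k)))\<^sup>2) summable_on UNIV"
      unfolding summable_on_def by (subst has_sum_int_plus) (auto simp: L2_plus_D(2)[OF that])
    then show ?thesis unfolding l2_def Hs_weight .
  qed
  then show ?thesis unfolding plus_part_def Hs_def by blast
qed

lemma Hs_plus_L2_plus: "u \<in> Hs_plus s \<Longrightarrow> u \<in> L2_plus" by (simp add: Hs_plus_iff)

lemma cf_coef: "u \<in> Hs_plus s \<Longrightarrow> cf (coef u) k = of_real (w k) * fc u k"
  by (simp add: coef_def cf_Ell2 Hs_plus_iff)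

lemma U_coef: "u \<in> Hs_plus s \<Longrightarrow> U (coef u) = fc u"
  by (rule ext) (simp add: U_def cf_coef)

lemma V_coef: "u \<in> Hs_plus s \<Longrightarrow> V (coef u) = pc u"
  by (simp add: V_def U_coef pc_def)

text \<open>Membership in the Sobolev space and the value of the encoding are obtained together, by
  recognising the coefficients as those of some \<open>x\<close>.\<close>

lemma coefI: 
  assumes "u \<in> L2_plus" "\<And>k. fc u k = U x k"
  shows "u \<in> Hs_plus s" "coef u = x"
proof -
  have "of_real (w k) * fc u k = cf x k" for k by (simp add: assms U_def)
  then show "u \<in> Hs_plus s" using assms by (simp add: Hs_plus_iff)
  then show "coef u = x" by (intro ell2_eqI) (simp add: cf_coef assms U_def)
qed

lemma coef_inject: "u \<in> Hs_plus s \<Longrightarrow> v \<in> Hs_plus s \<Longrightarrow> coef u = coef v \<Longrightarrow> u = v"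
  by (rule L2_plus_eqI) (auto simp: Hs_plus_L2_plus U_coef[symmetric])

lemma coef_surj: "\<exists>u\<in>Hs_plus s. coef u = x"
proof -
  obtain u where u: "u \<in> L2_plus" "pc u = V x" using pc_surj by blast
  have "fc u k = U x k" for k using cf_pc[OF u(1)] u(2) by (simp add: cf_V)
  with coefI[OF u(1)] show ?thesis by blast
qed

lemma norm_Hs_coef: assumes "u \<in> Hs_plus s" shows "norm_Hs s u = norm (coef u)"
proof -
  have "((\<lambda>k. (1 + (real_of_int (int k))\<^sup>2) powr s * (cmod (fourier u (int k)))\<^sup>2) has_sum (norm (coef u))\<^sup>2) UNIV"
    using norm_ell2_has_sum[of "coef u"] by (simp only: Hs_weight cf_coef[OF assms])
  then have "((\<lambda>k. (1 + (real_of_int k)\<^sup>2) powr s * (cmod (fourier u k))\<^sup>2) has_sum (norm (coef u))\<^sup>2) UNIV"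
    by (subst has_sum_int_plus) (auto simp: L2_plus_D(2)[OF Hs_plus_L2_plus[OF assms]])
  then show ?thesis by (simp add: norm_Hs_def infsumI)
qed

lemma Hs_add: "u \<in> Hs_plus s \<Longrightarrow> v \<in> Hs_plus s \<Longrightarrow> u + v \<in> Hs_plus s \<and> coef (u + v) = coef u + coef v"
  using coefI[of "u + v" "coef u + coef v"]
  by (simp add: L2_plus_add Hs_plus_L2_plus U_add U_coef fc_def fourier_add L2_plus_D)

lemma Hs_const_mult: "u \<in> Hs_plus s \<Longrightarrow> const c * u \<in> Hs_plus s \<and> coef (const c * u) = cscale c (coef u)"
  using coefI[of "const c * u" "cscale c (coef u)"]
  by (simp add: L2_plus_const_mult Hs_plus_L2_plus U_cscale U_coef fc_def fourier_const_mult)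

lemma Hs_diff: "u \<in> Hs_plus s \<Longrightarrow> v \<in> Hs_plus s \<Longrightarrow> u - v \<in> Hs_plus s \<and> coef (u - v) = coef u - coef v"
  using Hs_add[of u "const (-1) * v"] Hs_const_mult[of v "-1"] by (simp add: const_minus cscale_minus_left)

lemma Hs_0: "0 \<in> Hs_plus s \<and> coef 0 = 0"
  using coefI[OF L2_plus_0, of 0] fourier_const_mult[of 0 0] by (simp add: U_def fc_def)

lemma Hs_sum: "(\<And>i. i \<in> I \<Longrightarrow> f i \<in> Hs_plus s) \<Longrightarrow> sum f I \<in> Hs_plus s \<and> coef (sum f I) = (\<Sum>i\<in>I. coef (f i))"
  by (induction I rule: infinite_finite_induct) (auto simp: Hs_0 Hs_add)

lemma Hs_monomial: "monomial (int k) \<in> Hs_plus s" and pc_monomial: "pc (monomial (int k)) = eps k"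
  and Hs_1: "1 \<in> Hs_plus s" and coef_1: "coef 1 = eps 0"
proof -
  have m: "monomial (int k) \<in> L2_plus" for k by (auto simp: L2_plus_iff L2_monomial fourier_monomial)
  have f: "fc (monomial (int k)) l = U (cscale (of_real (w k)) (eps k)) l" for k l
    by (simp add: fc_def fourier_monomial U_def)
  show "monomial (int k) \<in> Hs_plus s" by (rule coefI(1)[OF m f])
  show "pc (monomial (int k)) = eps k" by (rule ell2_eqI) (simp add: cf_pc m fc_def fourier_monomial)
  show "1 \<in> Hs_plus s" "coef 1 = eps 0" using coefI[OF m f, of 0] by simp_all
qed

lemma pc_1: "pc 1 = eps 0" using pc_monomial[of 0] by simp

lemma Hs_fourier_summable: assumes "u \<in> Hs_plus s" shows "(\<lambda>k. cmod (fourier u k)) summable_on UNIV"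
proof -
  have "(\<lambda>k. cmod (fourier u (int k))) summable_on UNIV"
    using l1_U[of "coef u"] by (simp add: U_coef[OF assms] l1_def fc_def)
  then show ?thesis unfolding summable_on_def
    by (subst has_sum_int_plus) (auto simp: L2_plus_D(2)[OF Hs_plus_L2_plus[OF assms]])
qed

lemma Hs_mult_L2: "a \<in> Hs_plus s \<Longrightarrow> h \<in> L2 \<Longrightarrow> a * h \<in> L2"
  by (rule L2_mult) (auto simp: Hs_fourier_summable Hs_plus_L2_plus L2_plus_D)

lemma Hs_conj_mult_L2: "a \<in> Hs_plus s \<Longrightarrow> h \<in> L2 \<Longrightarrow> circ_conj a * h \<in> L2"
  using L2_conj[OF Hs_mult_L2[of a "circ_conj h"]] by (simp add: L2_conj circ_conj_mult)

lemma hankel_pc: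
  assumes u: "u \<in> Hs_plus s" and h: "h \<in> L2_plus"
  shows "hankel u h \<in> L2_plus" "pc (hankel u h) = Hk (coef u) (pc h)"
proof -
  have l: "u * circ_conj h \<in> L2" by (intro Hs_mult_L2 u L2_conj L2_plus_D h)
  show m: "hankel u h \<in> L2_plus" unfolding hankel_def by (rule szego_in[OF l])
  have "cf (pc (hankel u h)) k = fc (szego (u * circ_conj h)) k" for k
    by (simp only: cf_pc[OF m]) (simp only: hankel_def)
  then show "pc (hankel u h) = Hk (coef u) (pc h)"
    by (intro ell2_eqI)
       (simp add: cf_Hk U_coef[OF u] cf_pc[OF h] szego_mult_conj[OF Hs_plus_L2_plus[OF u] h l])
qed

lemma hankel_coef:
  assumes u: "u \<in> Hs_plus s" and h: "h \<in> Hs_plus s"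
  shows "hankel u h \<in> Hs_plus s" "coef (hankel u h) = Hw (coef u) (coef h)"
proof -
  note p = hankel_pc[OF u Hs_plus_L2_plus[OF h]]
  have "fc (hankel u h) k = U (Hw (coef u) (coef h)) k" for k
    using cf_pc[OF p(1)] p(2) by (simp add: U_Hw cf_Hk cf_pc Hs_plus_L2_plus h U_coef)
  from coefI[OF p(1) this] show "hankel u h \<in> Hs_plus s" "coef (hankel u h) = Hw (coef u) (coef h)" .
qed

lemma hankel_pow:
  assumes u: "u \<in> Hs_plus s"
  shows "(hankel u ^^ j) 1 \<in> Hs_plus s" "coef ((hankel u ^^ j) 1) = aw (coef u) j"
  by (induction j) (simp_all add: Hs_1 coef_1 hankel_coef u aw_Suc)

lemma mult_pc:
  assumes a: "a \<in> Hs_plus s" and h: "h \<in> L2_plus"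
  shows "a * h \<in> L2_plus" "pc (a * h) = Cv (coef a) (pc h)"
proof -
  have l: "a * h \<in> L2" by (intro Hs_mult_L2 a L2_plus_D h)
  show m: "a * h \<in> L2_plus" by (rule mult_plus(1)[OF Hs_plus_L2_plus[OF a] h l])
  show "pc (a * h) = Cv (coef a) (pc h)"
    by (rule ell2_eqI) (simp add: cf_pc[OF m] cf_Cv U_coef[OF a] cf_pc[OF h] mult_plus(2)[OF Hs_plus_L2_plus[OF a] h l])
qed

lemma mult_coef:
  assumes u: "u \<in> Hs_plus s" and v: "v \<in> Hs_plus s"
  shows "u * v \<in> Hs_plus s" "coef (u * v) = Cw (coef u) (coef v)"
proof -
  note p = mult_pc[OF u Hs_plus_L2_plus[OF v]]
  have "fc (u * v) k = U (Cw (coef u) (coef v)) k" for k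
    using cf_pc[OF p(1)] p(2) by (simp add: U_Cw cf_Cv cf_pc Hs_plus_L2_plus v u U_coef)
  from coefI[OF p(1) this] show "u * v \<in> Hs_plus s" "coef (u * v) = Cw (coef u) (coef v)" .
qed

lemma toeplitz_pc:
  assumes a: "a \<in> Hs_plus s" and h: "h \<in> L2_plus"
  shows "szego (circ_conj a * h) \<in> L2_plus" "pc (szego (circ_conj a * h)) = Tp (coef a) (pc h)"
proof -
  have l: "circ_conj a * h \<in> L2" by (intro Hs_conj_mult_L2 a L2_plus_D h)
  then have l': "h * circ_conj a \<in> L2" by (simp add: mult.commute)
  show m: "szego (circ_conj a * h) \<in> L2_plus" by (rule szego_in[OF l])
  have "cf (pc (szego (circ_conj a * h))) k = fc (szego (h * circ_conj a)) k" for k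
    by (simp only: cf_pc[OF m]) (simp only: mult.commute)
  then show "pc (szego (circ_conj a * h)) = Tp (coef a) (pc h)"
    by (intro ell2_eqI)
       (simp add: cf_Tp U_coef[OF a] cf_pc[OF h] szego_mult_conj[OF h Hs_plus_L2_plus[OF a] l'])
qed

text \<open>Sorts the sum in \<open>lax_B\<close> by parity and reverses the rank one sum. The
  condition on \<open>n\<close> guards the truncated subtraction: for \<open>n = 0\<close> the range
  \<open>0..2*n-2\<close> would still contain the index 0.\<close>

lemma Se_So_eq:
  assumes n: "n \<ge> 1"
  shows "Se n x h + So n x h = (\<Sum>j=0..2*n-2. P j (2*n-2-j) x h)
    - (\<Sum>k=1..n-1. cscale (cinner h (V (aw x (2*k-1)))) (V (aw x (2*n-2*k-1))))"
proof -
  have split: "(\<Sum>j=0..2*n-2. f j) = (\<Sum>l<n. f (2*l)) + (\<Sum>l=1..<n. f (2*l-1))" for f :: "nat \<Rightarrow> ell2"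
    using n
  proof (induction n rule: nat_induct_at_least)
    case (Suc n)
    have "{0..2 * Suc n - 2} = insert (2*n) (insert (2*n-1) {0..2*n-2})" using Suc(1) by auto
    moreover have "2*n \<notin> insert (2*n-1) {0..2*n-2}" "2*n-1 \<notin> {0..2*n-2}" using Suc(1) by auto
    ultimately have "(\<Sum>j=0..2 * Suc n - 2. f j) = f (2*n) + (f (2*n-1) + (\<Sum>j=0..2*n-2. f j))" by simp
    moreover have "{1..<Suc n} = insert n {1..<n}" using Suc(1) by auto
    ultimately show ?case using Suc(2) by (simp add: algebra_simps)
  qed simp
  have 1: "(\<Sum>k=1..n-1. cscale (cinner h (V (aw x (2*k-1)))) (V (aw x (2*n-2*k-1))))
     = (\<Sum>l=1..<n. cscale (cinner h (V (aw x (2*n-2*l-1)))) (V (aw x (2*l-1))))"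
  proof (rule sum.reindex_bij_witness[of _ "\<lambda>l. n - l" "\<lambda>l. n - l"])
    fix l assume "l \<in> {1..n-1}"
    then have "2*n-2*(n-l)-1 = 2*l-1" "2*(n-l)-1 = 2*n-2*l-1" by auto
    then show "cscale (cinner h (V (aw x (2*n-2*(n-l)-1)))) (V (aw x (2*(n-l)-1)))
      = cscale (cinner h (V (aw x (2*l-1)))) (V (aw x (2*n-2*l-1)))" by simp
  qed auto
  have 2: "(\<Sum>l=1..<n. P (2*l-1) (2*n-2-(2*l-1)) x h) = (\<Sum>l=1..<n. P (2*l-1) (2*n-1-2*l) x h)"
    by (intro sum.cong refl arg_cong2[where f = "\<lambda>a b. P a b x h"]) auto
  show ?thesis unfolding split 1 2 Se_def So_def sum_subtractf by (simp add: algebra_simps)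
qed

lemma lax_B_pc:
  assumes n: "n \<ge> 1" and u: "u \<in> Hs_plus s" and h: "h \<in> L2_plus"
  shows "lax_B u n h \<in> L2_plus" "pc (lax_B u n h) = B n (coef u) (pc h)"
proof -
  let ?a = "\<lambda>j. (hankel u ^^ j) 1"
  have va: "V (aw (coef u) j) = pc (?a j)" for j
    using V_coef[OF hankel_pow(1)[OF u, of j]] by (simp add: hankel_pow u)
  have aL: "?a j \<in> L2_plus" for j by (rule Hs_plus_L2_plus[OF hankel_pow(1)[OF u]])
  have 1: "?a j * szego (circ_conj (?a m) * h) \<in> L2_plus"
    "pc (?a j * szego (circ_conj (?a m) * h)) = P j m (coef u) (pc h)" for j m
    using mult_pc[OF hankel_pow(1)[OF u] toeplitz_pc(1)[OF hankel_pow(1)[OF u] h]]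
    by (simp_all add: hankel_pow u P_def toeplitz_pc h)
  have 2: "const (inner_L2 h (?a j)) * ?a m \<in> L2_plus"
    "pc (const (inner_L2 h (?a j)) * ?a m) = cscale (cinner (pc h) (V (aw (coef u) j))) (V (aw (coef u) m))" for j m
    by (simp_all add: L2_plus_const_mult aL pc_const_mult inner_pc h va)
  show "lax_B u n h \<in> L2_plus"
    unfolding lax_B_def by (intro L2_plus_const_mult L2_plus_diff L2_plus_sum 1 2)
  show "pc (lax_B u n h) = B n (coef u) (pc h)"
    unfolding lax_B_def B_def Se_So_eq[OF n]
    by (simp add: pc_const_mult pc_diff pc_sum 1 2 L2_plus_diff L2_plus_sum)
qed

subsection \<open>Hamiltonian vector fields\<close>

definition Xc :: "nat \<Rightarrow> circfun \<Rightarrow> circfun" where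
  "Xc n u = const (- \<i> / 2) * (\<Sum>l<n. (hankel u ^^ (2*l)) 1 * (hankel u ^^ (2*n-2*l-1)) 1)"

lemma Xc_Hs: assumes u: "u \<in> Hs_plus s" shows "Xc n u \<in> Hs_plus s" "coef (Xc n u) = X n (coef u)"
proof -
  have *: "(hankel u ^^ i) 1 * (hankel u ^^ j) 1 \<in> Hs_plus s" "coef ((hankel u ^^ i) 1 * (hankel u ^^ j) 1) = Cw (aw (coef u) i) (aw (coef u) j)" for i j
    using mult_coef[OF hankel_pow(1)[OF u] hankel_pow(1)[OF u]] by (simp_all add: hankel_pow u)
  have S: "(\<Sum>l<n. (hankel u ^^ (2*l)) 1 * (hankel u ^^ (2*n-2*l-1)) 1) \<in> Hs_plus s \<and>
     coef (\<Sum>l<n. (hankel u ^^ (2*l)) 1 * (hankel u ^^ (2*n-2*l-1)) 1) = Y n (coef u)"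
    using Hs_sum[of "{..<n}" "\<lambda>l. (hankel u ^^ (2*l)) 1 * (hankel u ^^ (2*n-2*l-1)) 1"] * by (simp add: Y_def)
  show "Xc n u \<in> Hs_plus s" "coef (Xc n u) = X n (coef u)"
    using Hs_const_mult[OF conjunct1[OF S], of "- \<i> / 2"] S by (simp_all add: Xc_def X_def)
qed

lemma J_coef: assumes u: "u \<in> Hs_plus s" shows "J m u = V (aw (coef u) m) \<bullet> eps 0"
proof -
  have "V (aw (coef u) m) = pc ((hankel u ^^ m) 1)"
    using V_coef[OF hankel_pow(1)[OF u, of m]] by (simp add: hankel_pow u)
  then show ?thesis
    by (simp add: J_def inner_pc Hs_plus_L2_plus hankel_pow u Hs_1 inner_ell2_def pc_1)
qed

lemma symp_form_pc: "u \<in> L2_plus \<Longrightarrow> v \<in> L2_plus \<Longrightarrow> symp_form u v = 4 * Im (cinner (pc u) (pc v))"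
  by (simp add: symp_form_def inner_pc)

text \<open>The segment from \<open>u\<close> in the direction \<open>h\<close> becomes a straight
  line in the Sobolev encoding, where the iterates are differentiable and
  \<open>inner_V_daw_eps0\<close> identifies the derivative.\<close>

lemma is_hamiltonian_Xc:
  assumes u: "u \<in> Hs_plus s"
  shows "is_hamiltonian_vector_at (Hs_plus s) (J (2*n)) u (Xc n u)"
  unfolding is_hamiltonian_vector_at_def
proof (intro conjI ballI)
  show "Xc n u \<in> L2_plus" by (rule Hs_plus_L2_plus[OF Xc_Hs(1)[OF u]])
  fix h assume h: "h \<in> Hs_plus s"
  define \<gamma> where "\<gamma> t = coef u + t *\<^sub>R coef h" for t :: real
  have \<gamma>: "(\<gamma> has_vector_derivative coef h) (at 0)"
    unfolding \<gamma>_def by (auto intro!: derivative_eq_intros simp: has_vector_derivative_def)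
  have J\<gamma>: "J (2*n) (u + const (of_real t) * h) = V (aw (\<gamma> t) (2*n)) \<bullet> eps 0" for t
    using Hs_add[OF u conjunct1[OF Hs_const_mult[OF h]], of "of_real t"] Hs_const_mult[OF h, of "of_real t"]
    by (simp add: J_coef \<gamma>_def scaleR_cscale)
  have "((\<lambda>t. V (aw (\<gamma> t) (2*n)) \<bullet> eps 0) has_vector_derivative V (daw (\<gamma> 0) (coef h) (2*n)) \<bullet> eps 0) (at 0)"
    by (rule bounded_linear.has_vector_derivative[OF bounded_linear_inner_left
        bounded_linear.has_vector_derivative[OF bounded_linear_V aw_has_derivative[OF \<gamma>]]])
  then have "((\<lambda>t. V (aw (\<gamma> t) (2*n)) \<bullet> eps 0) has_real_derivative symp_form h (Xc n u)) (at 0)"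
    by (simp add: has_real_derivative_iff_has_vector_derivative inner_V_daw_eps0 symp_form_pc Hs_plus_L2_plus h u Xc_Hs
        V_coef[symmetric] \<gamma>_def)
  then have "((\<lambda>t. (V (aw (\<gamma> t) (2*n)) \<bullet> eps 0 - V (aw (\<gamma> 0) (2*n)) \<bullet> eps 0) / t) \<longlongrightarrow> symp_form h (Xc n u)) (at 0)"
    by (simp add: DERIV_def)
  then show "((\<lambda>t. (J (2*n) (u + const (of_real t) * h) - J (2*n) u) / t) \<longlongrightarrow> symp_form h (Xc n u)) (at 0)"
    unfolding J\<gamma> using J\<gamma>[of 0] by simp
qed

text \<open>Uniqueness is what the definite description asks for: testing with \<open>z^k\<close>
  determines the imaginary parts, and with \<open>\<i> z^k\<close> the real parts, of the
  coefficients.\<close>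

lemma hamiltonian_vf_eq:
  assumes u: "u \<in> Hs_plus s"
  shows "hamiltonian_vf (Hs_plus s) (J (2*n)) u = Xc n u"
  unfolding hamiltonian_vf_def
proof (rule the_equality)
  show "is_hamiltonian_vector_at (Hs_plus s) (J (2*n)) u (Xc n u)" by (rule is_hamiltonian_Xc[OF u])
  fix v assume v: "is_hamiltonian_vector_at (Hs_plus s) (J (2*n)) u v"
  then have vL: "v \<in> L2_plus" by (simp add: is_hamiltonian_vector_at_def)
  have XL: "Xc n u \<in> L2_plus" by (rule Hs_plus_L2_plus[OF Xc_Hs(1)[OF u]])
  have eq: "symp_form h v = symp_form h (Xc n u)" if "h \<in> Hs_plus s" for h
  proof (rule tendsto_unique[OF trivial_limit_at])
    show "((\<lambda>t. (J (2*n) (u + const (of_real t) * h) - J (2*n) u) / t) \<longlongrightarrow> symp_form h v) (at (0::real))"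
      using v that by (simp add: is_hamiltonian_vector_at_def)
    show "((\<lambda>t. (J (2*n) (u + const (of_real t) * h) - J (2*n) u) / t) \<longlongrightarrow> symp_form h (Xc n u)) (at (0::real))"
      using is_hamiltonian_Xc[OF u, of n] that by (simp add: is_hamiltonian_vector_at_def)
  qed
  show "v = Xc n u"
  proof (rule pc_inject[OF vL XL], rule ell2_eqI)
    fix k
    have c: "cinner (pc (monomial (int k))) x = cnj (cf x k)" for x
      unfolding pc_monomial by (subst cinner_commute) (simp add: cinner_eps_right)
    have m: "monomial (int k) \<in> L2_plus" by (rule Hs_plus_L2_plus[OF Hs_monomial])
    have "Im (cf (pc v) k) = Im (cf (pc (Xc n u)) k)"
      using eq[OF Hs_monomial[of k]] by (simp add: symp_form_pc m vL XL c)
    moreover have "Re (cf (pc v) k) = Re (cf (pc (Xc n u)) k)"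
      using eq[OF conjunct1[OF Hs_const_mult[OF Hs_monomial[of k], of \<i>]]]
      by (simp add: symp_form_pc L2_plus_const_mult m vL XL pc_const_mult cinner_cscale_left c)
    ultimately show "cf (pc v) k = cf (pc (Xc n u)) k" by (rule complex_eqI[rotated])
  qed
qed

lemma poisson_eq_0:
  assumes u: "u \<in> Hs_plus s"
  shows "poisson (Hs_plus s) (J (2*n)) (J (2*p)) u = 0"
  using poisson_commute_V[of n "coef u" p] Xc_Hs[OF u]
  by (simp add: poisson_def hamiltonian_vf_eq[OF u] symp_form_pc Hs_plus_L2_plus V_coef[symmetric])

subsection \<open>Solutions\<close>

text \<open>Brings the derivative into the form of difference quotients, in which
  \<open>Hs_solution\<close> and \<open>has_operator_derivative\<close> are phrased.\<close>

lemma has_vector_derivative_quotient: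
  fixes f :: "real \<Rightarrow> 'a::real_normed_vector"
  shows "(f has_vector_derivative D) (at t) \<longleftrightarrow> ((\<lambda>r. norm ((1 / r) *\<^sub>R (f (t + r) - f t) - D)) \<longlongrightarrow> 0) (at 0)"
proof -
  have "norm (f (t + r) - f t - r *\<^sub>R D) / norm r = norm ((1 / r) *\<^sub>R (f (t + r) - f t) - D)" if "r \<noteq> 0" for r
  proof -
    have "(1 / r) *\<^sub>R (f (t + r) - f t) - D = (1 / r) *\<^sub>R (f (t + r) - f t - r *\<^sub>R D)"
      using that by (simp add: scaleR_diff_right)
    then show ?thesis by (simp add: divide_inverse mult.commute)
  qed
  then have "((\<lambda>r. norm (f (t + r) - f t - r *\<^sub>R D) / norm r) \<longlongrightarrow> 0) (at 0) \<longleftrightarrow>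
    ((\<lambda>r. norm ((1 / r) *\<^sub>R (f (t + r) - f t) - D)) \<longlongrightarrow> 0) (at 0)"
    by (intro Lim_cong_within) auto
  then show ?thesis
    by (simp add: has_vector_derivative_def has_derivative_at bounded_linear_scaleR_left)
qed

text \<open>The continuity clause follows from differentiability, and difference quotients
  correspond because \<open>coef\<close> is linear and isometric.\<close>

lemma Hs_solution_iff:
  assumes u0: "u0 \<in> Hs_plus s"
  shows "Hs_solution s (hamiltonian_vf (Hs_plus s) (J (2*n))) u0 u \<longleftrightarrow>
    (\<forall>t. u t \<in> Hs_plus s) \<and> (\<forall>t. ((\<lambda>t. coef (u t)) has_vector_derivative X n (coef (u t))) (at t)) \<and> u 0 = u0"
proof (cases "\<forall>t. u t \<in> Hs_plus s")
  case True
  then have u: "\<And>t. u t \<in> Hs_plus s" by blast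
  have 1: "tendsto_Hs s (\<lambda>r. const (1 / of_real r) * (u (t + r) - u t)) (hamiltonian_vf (Hs_plus s) (J (2*n)) (u t)) (at 0)
    \<longleftrightarrow> ((\<lambda>t. coef (u t)) has_vector_derivative X n (coef (u t))) (at t)" for t
  proof -
    have d: "const (1 / of_real r) * (u (t + r) - u t) \<in> Hs_plus s"
      "coef (const (1 / of_real r) * (u (t + r) - u t)) = (1 / r) *\<^sub>R (coef (u (t + r)) - coef (u t))" for r :: real
      using Hs_const_mult[OF conjunct1[OF Hs_diff[OF u[of "t + r"] u[of t]]], of "1 / of_real r"] Hs_diff[OF u[of "t + r"] u[of t]]
      by (simp_all add: scaleR_cscale)
    have "norm_Hs s (const (1 / of_real r) * (u (t + r) - u t) - Xc n (u t)) = norm ((1 / r) *\<^sub>R (coef (u (t + r)) - coef (u t)) - X n (coef (u t)))"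
      for r :: real
      using Hs_diff[OF d(1)[of r] Xc_Hs(1)[OF u[of t], of n]] by (simp add: norm_Hs_coef d Xc_Hs u)
    then show ?thesis
      unfolding tendsto_Hs_def has_vector_derivative_quotient hamiltonian_vf_eq[OF u] by (simp add: d Xc_Hs u)
  qed
  have 2: "tendsto_Hs s u (u t) (at t)" if "((\<lambda>t. coef (u t)) has_vector_derivative X n (coef (u t))) (at t)" for t
  proof -
    have "isCont (\<lambda>t. coef (u t)) t" by (rule has_vector_derivative_continuous[OF that])
    then have "((\<lambda>r. norm (coef (u r) - coef (u t))) \<longlongrightarrow> 0) (at t)"
      unfolding isCont_def by (simp add: tendsto_norm_zero_iff LIM_zero_iff)
    moreover have "norm_Hs s (u r - u t) = norm (coef (u r) - coef (u t))" for r
      using Hs_diff[OF u u] by (simp add: norm_Hs_coef)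
    ultimately show ?thesis by (simp add: tendsto_Hs_def u)
  qed
  show ?thesis unfolding Hs_solution_def 1 using 2 u by blast
next
  case False
  then show ?thesis unfolding Hs_solution_def by blast
qed

text \<open>Since \<open>coef\<close> is a bijection of \<open>Hs_plus s\<close> onto
  \<open>ell2\<close>, existence and uniqueness are inherited from the equation for
  sequences.\<close>

lemma ex1_solution:
  assumes u0: "u0 \<in> Hs_plus s"
  shows "\<exists>!u. Hs_solution s (hamiltonian_vf (Hs_plus s) (J (2*n))) u0 u"
  unfolding Hs_solution_iff[OF u0]
proof (rule ex_ex1I)
  obtain y where y: "y 0 = coef u0" "\<And>t. (y has_vector_derivative X n (y t)) (at t)"
    using global_solution by blast
  have "\<forall>t. \<exists>v. v \<in> Hs_plus s \<and> coef v = y t" using coef_surj by blast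
  then obtain u where u: "\<And>t. u t \<in> Hs_plus s" "\<And>t. coef (u t) = y t" by metis
  then have "u 0 = u0" using coef_inject[OF u(1) u0] y(1) by simp
  with u y show "\<exists>u. (\<forall>t. u t \<in> Hs_plus s) \<and> (\<forall>t. ((\<lambda>t. coef (u t)) has_vector_derivative X n (coef (u t))) (at t)) \<and> u 0 = u0"
    by (intro exI[of _ u]) simp
next
  fix u v
  assume u: "(\<forall>t. u t \<in> Hs_plus s) \<and> (\<forall>t. ((\<lambda>t. coef (u t)) has_vector_derivative X n (coef (u t))) (at t)) \<and> u 0 = u0"
    and v: "(\<forall>t. v t \<in> Hs_plus s) \<and> (\<forall>t. ((\<lambda>t. coef (v t)) has_vector_derivative X n (coef (v t))) (at t)) \<and> v 0 = u0"
  have "coef (u t) = coef (v t)" for t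
    by (rule solution_unique[of "\<lambda>t. coef (u t)" n "\<lambda>t. coef (v t)"]) (use u v in auto)
  then show "u = v" using u v by (intro ext coef_inject) auto
qed

text \<open>A Hankel operator is linear in its symbol, so by the Lax identity the error of the
  difference quotient is the Hankel operator with symbol \<open>q r\<close>. Its norm is at most
  \<open>K * norm (q r)\<close>, which tends to 0 by differentiability in the Sobolev norm.\<close>

lemma lax_equation:
  assumes n: "n \<ge> 1" and u: "\<And>t. u t \<in> Hs_plus s"
    and du: "((\<lambda>t. coef (u t)) has_vector_derivative X n (coef (u t))) (at t)"
  shows "has_operator_derivative (\<lambda>r. hankel (u r)) (commutator (lax_B (u t) n) (hankel (u t))) t"
proof -
  define q where "q r = (1 / r) *\<^sub>R (coef (u (t + r)) - coef (u t)) - X n (coef (u t))" for r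
  have q: "((\<lambda>r. norm (q r)) \<longlongrightarrow> 0) (at 0)" using du unfolding has_vector_derivative_quotient q_def .
  have "norm_L2 (const (1 / of_real r) * (hankel (u (t + r)) h - hankel (u t) h) - commutator (lax_B (u t) n) (hankel (u t)) h) \<le> K * norm (q r)"
    if h: "h \<in> L2_plus" "norm_L2 h \<le> 1" for r h
  proof -
    note H = hankel_pc[OF u] and L = lax_B_pc[OF n u]
    let ?g = "const (1 / of_real r) * (hankel (u (t + r)) h - hankel (u t) h) - commutator (lax_B (u t) n) (hankel (u t)) h"
    have g: "?g \<in> L2_plus" unfolding commutator_def
      by (intro L2_plus_diff L2_plus_const_mult H L h)
    have "pc ?g = cscale (1 / of_real r) (Hk (coef (u (t + r))) (pc h) - Hk (coef (u t)) (pc h))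
       - (B n (coef (u t)) (Hk (coef (u t)) (pc h)) - Hk (coef (u t)) (B n (coef (u t)) (pc h)))"
      unfolding commutator_def
      by (simp add: pc_diff pc_const_mult H L h L2_plus_diff L2_plus_const_mult)
    also have "\<dots> = Hk (q r) (pc h)"
      unfolding lax_identity[symmetric] q_def
      by (simp add: bounded_bilinear.diff_left[OF bounded_bilinear_Hk] scaleR_cscale Hk_cscale_left)
    finally have "norm_L2 ?g = norm (Hk (q r) (pc h))" by (simp add: norm_pc[OF g])
    also have "\<dots> \<le> n1 (U (q r)) * norm (pc h)" by (rule norm_Hk)
    also have "\<dots> \<le> (K * norm (q r)) * 1"
      using h by (intro mult_mono n1_U_le) (auto simp: norm_pc K_nonneg)
    finally show ?thesis by simp
  qed
  then have up: "\<forall>\<^sub>F r in at 0. opnorm_L2_plus (\<lambda>h. const (1 / of_real r) * (hankel (u (t + r)) h - hankel (u t) h)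
      - commutator (lax_B (u t) n) (hankel (u t)) h) \<le> ennreal (K * norm (q r))"
    unfolding opnorm_L2_plus_def by (intro always_eventually allI SUP_least ennreal_leI) auto
  have "((\<lambda>r. K * norm (q r)) \<longlongrightarrow> K * 0) (at 0)" by (intro tendsto_mult tendsto_const q)
  from tendsto_ennrealI[OF this] have lim: "((\<lambda>r. ennreal (K * norm (q r))) \<longlongrightarrow> 0) (at 0)" by simp
  show ?thesis unfolding has_operator_derivative_def
    by (rule tendsto_sandwich[OF _ up tendsto_const lim]) simp
qed

end

theorem corollary8:
  fixes s :: real
  assumes "s > 1"
  shows "(\<forall>n::nat. n \<ge> 1 \<longrightarrow> (\<forall>u0 \<in> Hs_plus s.
            (\<exists>!u. Hs_solution s (hamiltonian_vf (Hs_plus s) (J (2*n))) u0 u) \<and>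
            (\<forall>u. Hs_solution s (hamiltonian_vf (Hs_plus s) (J (2*n))) u0 u \<longrightarrow>
               (\<forall>t. has_operator_derivative (\<lambda>r. hankel (u r))
                      (commutator (lax_B (u t) n) (hankel (u t))) t)))) \<and>
         (\<forall>n p::nat. n \<ge> 1 \<longrightarrow> p \<ge> 1 \<longrightarrow>
            (\<forall>u \<in> Hs_plus s. poisson (Hs_plus s) (J (2*n)) (J (2*p)) u = 0))"
proof -
  interpret sobolev s by (rule sobolev.intro) (rule assms)
  show ?thesis
    using ex1_solution poisson_eq_0 lax_equation by (auto simp: Hs_solution_iff)
qed

end
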